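(* (i) Let $\mathcal{G}$ and $\mathcal{G}'$ be free framed graphs with $\operatorname{corank}_{\mathbb{Z}_2}(A(\mathcal{G})+E)=0$ and $\operatorname{corank}_{\mathbb{Z}_2}(A(\mathcal{G}')+E)=0$ which represent the same free graph-link (i.e. the same free graph-knot). Then $[\mathcal{G}]=[\mathcal{G}']$ in $\mathbb{Z}_2\mathcal{G}_1$. (ii) Let $\mathcal{H}$ and $\mathcal{H}'$ be free framed graphs with $\operatorname{corank}_{\mathbb{Z}_2}(A(\mathcal{H})+E)=\operatorname{corank}_{\mathbb{Z}_2}(A(\mathcal{H}')+E)=1$ which represent the same free graph-link (i.e. the same free two-component graph-link). Then $\{\mathcal{H}\}=\{\mathcal{H}'\}$ in $\bigoplus_{i\ge 1}\mathbb{Z}_2\mathcal{G}_i$.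
   Context: All graphs are finite. A framed simple graph is a simple graph $G$ (the empty graph is allowed) each of whose vertices carries a framing in $\{0,1\}$; graphs are considered up to framing-preserving isomorphism. $N(v)$ is the set of neighbours of $v$. The local complementation $\operatorname{LC}(G;v)$ toggles adjacency of every pair $a\ne b$ in $N(v)$. The pivot $\operatorname{piv}(G;u,v)$ toggles adjacency of every pair $x,y\notin\{u,v\}$ with $x\in N(u)$, $y\in N(v)$ and ($x\notin N(v)$ or $y\notin N(u)$). Moves. $\Omega_g1$: add/remove an isolated vertex of framing $0$. $\Omega_g2$: add/remove two non-adjacent vertices both of framing $0$, or two adjacent vertices both of framing $1$, having the same adjacencies with all other vertices. $\Omega_g3$: if $u,v,w$ are distinct vertices of framing $0$ and $u$ is adjacent exactly to $v$ and $w$, change the adjacency of $u$ with each $t\in (N(v)\setminus N(w))\cup(N(w)\setminus N(v))$; also the inverse operation. $\Omega_g4$: for adjacent $u,v$ both of framing $0$, replace $G$ by $\operatorname{piv}(G;u,v)$, where, for the purpose of identifying vertices before and after the move, the old vertex $u$ is identified with the new vertex $v$ and the old $v$ with the new $u$, all other vertices with themselves. $\Omega_g4'$: for $v$ of framing $1$, replace $G$ by $\operatorname{LC}(G;v)$ and change the framing of each vertex of $N(v)$ (vertices are identified with themselves). A free framed graph is an equivalence class of framed simple graphs under $\Omega_g4,\Omega_g4'$; its vertex set is the common vertex set of its representatives, where vertices of representatives related by a move $\Omega_g4$ at $u,v$ are identified by matching the old $u$ with the new $v$, the old $v$ with the new $u$ and every other vertex with itself, and vertices of representatives related by a move $\Omega_g4'$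 are identified by matching every vertex with itself. A free graph-link is an equivalence class of free framed graphs under $\Omega_g1$, $\Omega_g2$, $\Omega_g3$ (applied to representatives). $A(G)$ is the symmetric matrix over $\mathbb{Z}_2$ with $a_{ii}$ the framing of $v_i$ and, for $i\neq j$, $a_{ij}=1$ iff $v_i,v_j$ are adjacent; $E$ is the identity matrix; $B_i(G)=A(G)+E+E_{ii}$, where $E_{ii}$ has its only nonzero entry, $1$, at position $(i,i)$. The number $\operatorname{corank}_{\mathbb{Z}_2}(A(G)+E)$ depends only on the free graph-link; it equals $0$ for free graph-knots and $1$ for free two-component graph-links. Smoothing of a free framed graph $\mathcal{G}$ at a vertex $v$. If in some (equivalently every) representative $v$ has framing $1$ or positive degree, there are two representatives $H_1,H_2$ that differ by one move $\Omega_g4$ or $\Omega_g4'$ at $v$; the two smoothings at $v$ are the free framed graphs of $H_1\setminus\{v\}$ and $H_2\setminus\{v\}$. Otherwise $v$ is isolated with framing $0$ in every representative; for a representative $H$ the two smoothings are the free framed graphs of $H\setminus\{v\}$ and of $H'$, where $H'$ is $H$ with a new vertex $u$ of framing $0$ adjacent only to $v$. A smoothing at a collection of vertices is obtained by performing smoothings at these vertices one after another. $\mathbb{Z}_2\mathcal{G}_i$ ($i>1$) is the $\mathbb{Z}_2$-vector space generated by free framed graphs $\mathcal{G}$ with $\operatorname{corank}_{\mathbb{Z}_2}(A(\mathcal{G})+E)=i-1$ modulo: 1) $\mathcal{G}=\mathcal{G}'$ if they are related by $\Omega_g2$; 2) $\mathcal{G}=0$ if $\mathcal{G}$ has two vertices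 of framing $0$ adjacent only to each other. $\mathbb{Z}_2\mathcal{G}_1$ is defined in the same way with relation 1) only. Parity. If $\operatorname{corank}_{\mathbb{Z}_2}(A(\mathcal{G})+E)=0$, let $L$ be the simple graph on the same vertices whose adjacency matrix agrees with $(A(G)+E)^{-1}$ off the diagonal ($G$ a representative of $\mathcal G$); a vertex is even if its degree in $L$ is even and odd otherwise. If $\operatorname{corank}_{\mathbb{Z}_2}(A(\mathcal{H})+E)=1$, a vertex $v_i$ is even if it is oriented, i.e. $\operatorname{corank}_{\mathbb{Z}_2}(A(\mathcal{H})+E)\le\operatorname{corank}_{\mathbb{Z}_2}B_i(\mathcal{H})$, and odd otherwise. Brackets. $[\mathcal{G}]=\sum_s \mathcal{G}_s$, the sum over all smoothings $s$ at all even vertices of $\mathcal{G}$ (two choices at each even vertex) for which $\operatorname{corank}_{\mathbb{Z}_2}(A(\mathcal{G}_s)+E)=0$. $\{\mathcal{H}\}=\sum_s\mathcal{H}_s$, the sum over all smoothings $s$ at all even vertices of $\mathcal{H}$ for which $\mathcal{H}_s$ is not equivalent (by $\Omega_g2,\Omega_g4,\Omega_g4'$) to any framed simple graph having two vertices of framing $0$ which are adjacent only to each other.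
   Formalization: In Ω_g3 the adjacency of u is changed along the symmetric difference of the closed neighbourhoods of v and w, not the open ones; with open ones corank(A+E) is not invariant and (ii) fails for one vertex of framing 1 versus an edge with framings 0. *)

theory Defs
  imports
    "HOL-Library.Z2"
    "HOL-Library.Poly_Mapping"
    "HOL-Library.Multiset"
    "HOL-Combinatorics.Transposition"
    "Jordan_Normal_Form.Gauss_Jordan_Elimination"
    "Jordan_Normal_Form.DL_Rank"
begin

section \<open>Framed simple graphs\<close>

text \<open>
  Vertices are labelled by natural numbers; graphs up to isomorphism are obtained by a quotient
  further below. A graph is its vertex set, its adjacency relation and its framing. The framing is
  \<^term>\<open>0\<close> off the vertex set, so that equality of the type is equality of labelled graphs.
\<close>

typedef framed_graph =
  "{(V :: nat set, E :: nat \<Rightarrow> nat \<Rightarrow> bool, f :: nat \<Rightarrow> bit).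
     finite V \<and> (\<forall>x y. E x y \<longrightarrow> x \<in> V \<and> y \<in> V \<and> x \<noteq> y \<and> E y x) \<and> (\<forall>x. x \<notin> V \<longrightarrow> f x = 0)}"
  by (rule exI[of _ "({}, \<lambda>_ _. False, \<lambda>_. 0)"]) simp

definition vertices :: "framed_graph \<Rightarrow> nat set" where
  "vertices G = fst (Rep_framed_graph G)"

definition adj :: "framed_graph \<Rightarrow> nat \<Rightarrow> nat \<Rightarrow> bool" where
  "adj G = fst (snd (Rep_framed_graph G))"

definition framing :: "framed_graph \<Rightarrow> nat \<Rightarrow> bit" where
  "framing G = snd (snd (Rep_framed_graph G))"

text \<open>\<open>mk_graph V P f\<close> joins two distinct vertices \<open>x, y\<close> iff \<open>P x y\<close> or \<open>P y x\<close>.\<close>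

definition mk_graph :: "nat set \<Rightarrow> (nat \<Rightarrow> nat \<Rightarrow> bool) \<Rightarrow> (nat \<Rightarrow> bit) \<Rightarrow> framed_graph" where
  "mk_graph V P f = Abs_framed_graph
     (V, \<lambda>x y. x \<in> V \<and> y \<in> V \<and> x \<noteq> y \<and> (P x y \<or> P y x), \<lambda>x. if x \<in> V then f x else 0)"

lemma finite_vertices [simp]: "finite (vertices G)"
  using Rep_framed_graph[of G] by (auto simp: vertices_def)

lemma adjD: "adj G x y \<Longrightarrow> x \<in> vertices G \<and> y \<in> vertices G \<and> x \<noteq> y \<and> adj G y x"
  using Rep_framed_graph[of G] by (auto simp: vertices_def adj_def split: prod.splits)

lemma framing_outside: "x \<notin> vertices G \<Longrightarrow> framing G x = 0"
  using Rep_framed_graph[of G] by (auto simp: vertices_def framing_def split: prod.splits)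

lemma
  assumes "finite V"
  shows vertices_mk_graph [simp]: "vertices (mk_graph V P f) = V"
    and adj_mk_graph [simp]:
      "adj (mk_graph V P f) x y \<longleftrightarrow> x \<in> V \<and> y \<in> V \<and> x \<noteq> y \<and> (P x y \<or> P y x)"
    and framing_mk_graph [simp]: "framing (mk_graph V P f) x = (if x \<in> V then f x else 0)"
proof -
  have "Rep_framed_graph (mk_graph V P f) =
     (V, \<lambda>x y. x \<in> V \<and> y \<in> V \<and> x \<noteq> y \<and> (P x y \<or> P y x), \<lambda>x. if x \<in> V then f x else 0)"
    unfolding mk_graph_def by (rule Abs_framed_graph_inverse) (use assms in auto)
  then show "vertices (mk_graph V P f) = V"
    "adj (mk_graph V P f) x y \<longleftrightarrow> x \<in> V \<and> y \<in> V \<and> x \<noteq> y \<and> (P x y \<or> P y x)"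
    "framing (mk_graph V P f) x = (if x \<in> V then f x else 0)"
    by (simp_all add: vertices_def adj_def framing_def)
qed

lemma framed_graph_eqI:
  assumes "vertices G = vertices H" and "\<And>x y. adj G x y = adj H x y"
    and "\<And>x. framing G x = framing H x"
  shows "G = H"
  using assms
  by (auto simp: vertices_def adj_def framing_def fun_eq_iff prod_eq_iff simp flip: Rep_framed_graph_inject)

definition nbhd :: "framed_graph \<Rightarrow> nat \<Rightarrow> nat set" where
  "nbhd G v = {x. adj G v x}"

definition delete_vertices :: "nat set \<Rightarrow> framed_graph \<Rightarrow> framed_graph" where
  "delete_vertices S G = mk_graph (vertices G - S) (adj G) (framing G)"

definition graph_iso :: "framed_graph \<Rightarrow> framed_graph \<Rightarrow> bool" where
  "graph_iso G H \<longleftrightarrow> (\<exists>p. bij_betw p (vertices G) (vertices H) \<and>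
     (\<forall>x\<in>vertices G. framing H (p x) = framing G x) \<and>
     (\<forall>x\<in>vertices G. \<forall>y\<in>vertices G. adj H (p x) (p y) \<longleftrightarrow> adj G x y))"


section \<open>Moves\<close>

definition local_compl :: "framed_graph \<Rightarrow> nat \<Rightarrow> framed_graph" where
  "local_compl G v = mk_graph (vertices G)
     (\<lambda>a b. adj G a b \<noteq> (a \<in> nbhd G v \<and> b \<in> nbhd G v)) (framing G)"

definition pivot_toggles :: "framed_graph \<Rightarrow> nat \<Rightarrow> nat \<Rightarrow> nat \<Rightarrow> nat \<Rightarrow> bool" where
  "pivot_toggles G u v x y \<longleftrightarrow> x \<notin> {u, v} \<and> y \<notin> {u, v} \<and> x \<in> nbhd G u \<and> y \<in> nbhd G v \<and>
     (x \<notin> nbhd G v \<or> y \<notin> nbhd G u)"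

definition pivot :: "framed_graph \<Rightarrow> nat \<Rightarrow> nat \<Rightarrow> framed_graph" where
  "pivot G u v = mk_graph (vertices G)
     (\<lambda>x y. adj G x y \<noteq> (pivot_toggles G u v x y \<or> pivot_toggles G u v y x)) (framing G)"

definition swap_labels :: "nat \<Rightarrow> nat \<Rightarrow> framed_graph \<Rightarrow> framed_graph" where
  "swap_labels u v G = mk_graph (transpose u v ` vertices G)
     (\<lambda>x y. adj G (transpose u v x) (transpose u v y)) (\<lambda>x. framing G (transpose u v x))"

definition omega1 :: "framed_graph \<Rightarrow> framed_graph \<Rightarrow> bool" where
  "omega1 G G' \<longleftrightarrow> (\<exists>x\<in>vertices G. nbhd G x = {} \<and> framing G x = 0 \<and> G' = delete_vertices {x} G)"

definition omega2 :: "framed_graph \<Rightarrow> framed_graph \<Rightarrow> bool" where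
  "omega2 G G' \<longleftrightarrow> (\<exists>x\<in>vertices G. \<exists>y\<in>vertices G. x \<noteq> y \<and>
     (\<not> adj G x y \<and> framing G x = 0 \<and> framing G y = 0 \<or>
      adj G x y \<and> framing G x = 1 \<and> framing G y = 1) \<and>
     (\<forall>t\<in>vertices G - {x, y}. adj G x t \<longleftrightarrow> adj G y t) \<and>
     G' = delete_vertices {x, y} G)"

text \<open>
  In the third move the adjacency of \<open>u\<close> is toggled along the symmetric difference of the closed
  neighbourhoods of \<open>v\<close> and \<open>w\<close>, so that afterwards \<open>u\<close> is adjacent exactly to the symmetric
  difference of the open neighbourhoods. Toggling along the symmetric difference of the open
  neighbourhoods instead would not preserve \<open>corank (A(G) + E)\<close>: the path \<open>w - u - v - t\<close> with all
  framings \<open>0\<close> has corank \<open>0\<close>, but after joining \<open>u\<close> to \<open>t\<close> the rows of \<open>v\<close> and \<open>t\<close> coincide.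
\<close>

definition closed_nbhd :: "framed_graph \<Rightarrow> nat \<Rightarrow> nat set" where
  "closed_nbhd G v = insert v (nbhd G v)"

definition omega3 :: "framed_graph \<Rightarrow> framed_graph \<Rightarrow> bool" where
  "omega3 G G' \<longleftrightarrow> (\<exists>u\<in>vertices G. \<exists>v\<in>vertices G. \<exists>w\<in>vertices G. distinct [u, v, w] \<and>
     framing G u = 0 \<and> framing G v = 0 \<and> framing G w = 0 \<and> nbhd G u = {v, w} \<and>
     (let T = (closed_nbhd G v - closed_nbhd G w) \<union> (closed_nbhd G w - closed_nbhd G v) in
      G' = mk_graph (vertices G)
        (\<lambda>x y. adj G x y \<noteq> (x = u \<and> y \<in> T \<or> y = u \<and> x \<in> T)) (framing G)))"

text \<open>
  Labels record the identification of vertices before and after a move. The new vertex \<open>v\<close> of the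
  pivot is the old vertex \<open>u\<close>, hence the interchange of the two labels.
\<close>

definition omega4_at :: "nat \<Rightarrow> nat \<Rightarrow> framed_graph \<Rightarrow> framed_graph \<Rightarrow> bool" where
  "omega4_at u v G G' \<longleftrightarrow> adj G u v \<and> framing G u = 0 \<and> framing G v = 0 \<and>
     G' = swap_labels u v (pivot G u v)"

definition omega4'_at :: "nat \<Rightarrow> framed_graph \<Rightarrow> framed_graph \<Rightarrow> bool" where
  "omega4'_at v G G' \<longleftrightarrow> v \<in> vertices G \<and> framing G v = 1 \<and>
     G' = mk_graph (vertices G) (adj (local_compl G v))
       (\<lambda>x. if x \<in> nbhd G v then framing G x + 1 else framing G x)"

definition free_move_at :: "nat \<Rightarrow> framed_graph \<Rightarrow> framed_graph \<Rightarrow> bool" where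
  "free_move_at v G G' \<longleftrightarrow> (\<exists>u. omega4_at v u G G') \<or> omega4'_at v G G'"

definition free_move :: "framed_graph \<Rightarrow> framed_graph \<Rightarrow> bool" where
  "free_move G G' \<longleftrightarrow> (\<exists>v. free_move_at v G G')"


section \<open>Free framed graphs and graph-links\<close>

text \<open>
  A \<open>labelled_free_graph\<close> is a free framed graph together with its vertex set; isomorphism classes
  of these form the type \<open>free_graph\<close>.
\<close>

quotient_type labelled_free_graph = framed_graph / "equivclp free_move"
  by (rule equivp_evquivclp)

definition free_graph_of :: "framed_graph \<Rightarrow> labelled_free_graph" where
  "free_graph_of G = abs_labelled_free_graph G"

definition representatives :: "labelled_free_graph \<Rightarrow> framed_graph set" where
  "representatives \<G> = {G. free_graph_of G = \<G>}"

definition some_rep :: "labelled_free_graph \<Rightarrow> framed_graph" where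
  "some_rep \<G> = (SOME G. G \<in> representatives \<G>)"

quotient_type free_graph = labelled_free_graph /
    "equivclp (\<lambda>\<G> \<H>. \<exists>G\<in>representatives \<G>. \<exists>H\<in>representatives \<H>. graph_iso G H)"
  by (rule equivp_evquivclp)

definition iso_class :: "labelled_free_graph \<Rightarrow> free_graph" where
  "iso_class \<G> = abs_free_graph \<G>"

definition free_class :: "framed_graph \<Rightarrow> free_graph" where
  "free_class G = iso_class (free_graph_of G)"

definition omega2_related :: "free_graph \<Rightarrow> free_graph \<Rightarrow> bool" where
  "omega2_related x y \<longleftrightarrow> (\<exists>G G'. free_class G = x \<and> free_class G' = y \<and> omega2 G G')"

definition link_move :: "free_graph \<Rightarrow> free_graph \<Rightarrow> bool" where
  "link_move x y \<longleftrightarrow> (\<exists>G G'. free_class G = x \<and> free_class G' = y \<and>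
     (omega1 G G' \<or> omega2 G G' \<or> omega3 G G'))"

quotient_type graph_link = free_graph / "equivclp link_move"
  by (rule equivp_evquivclp)

definition graph_link_of :: "labelled_free_graph \<Rightarrow> graph_link" where
  "graph_link_of \<G> = abs_graph_link (iso_class \<G>)"

lemma representatives_nonempty: "some_rep \<G> \<in> representatives \<G>"
proof -
  have "\<exists>G. G \<in> representatives \<G>"
    unfolding representatives_def free_graph_of_def
    using Quotient3_abs_rep[OF Quotient3_labelled_free_graph] by blast
  then show ?thesis
    unfolding some_rep_def by (rule someI_ex)
qed

lemma vertices_free_move:
  assumes "free_move G G'"
  shows "vertices G' = vertices G"
proof -
  have swap: "transpose u v ` V = V" if "u \<in> V" "v \<in> V" for u v :: nat and V
    using that by (auto simp: transpose_def image_iff)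
  from assms consider u v where "omega4_at u v G G'" | v where "omega4'_at v G G'"
    unfolding free_move_def free_move_at_def by blast
  then show ?thesis
  proof cases
    case 1
    then have "u \<in> vertices G" "v \<in> vertices G"
      unfolding omega4_at_def by (blast dest: adjD)+
    with 1 show ?thesis
      by (simp add: omega4_at_def swap_labels_def pivot_def swap)
  next
    case 2
    then show ?thesis
      by (simp add: omega4'_at_def)
  qed
qed

lemma vertices_representatives:
  assumes "G \<in> representatives \<G>" "H \<in> representatives \<G>"
  shows "vertices G = vertices H"
proof -
  have "equivclp free_move G H"
    using assms unfolding representatives_def free_graph_of_def
    by (metis (mono_tags) labelled_free_graph.abs_eq_iff mem_Collect_eq)
  then show ?thesis
  proof (induction rule: equivclp_induct)
    case base
    show ?case by (rule refl)
  next
    case (step y z)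
    then show ?case by (metis vertices_free_move)
  qed
qed


section \<open>Matrices, corank and parity\<close>

definition vertex_list :: "framed_graph \<Rightarrow> nat list" where
  "vertex_list G = sorted_list_of_set (vertices G)"

definition num_vertices :: "framed_graph \<Rightarrow> nat" where
  "num_vertices G = card (vertices G)"

definition adj_matrix :: "framed_graph \<Rightarrow> bit mat" where
  "adj_matrix G = mat (num_vertices G) (num_vertices G) (\<lambda>(i, j).
     if i = j then framing G (vertex_list G ! i)
     else of_bool (adj G (vertex_list G ! i) (vertex_list G ! j)))"

definition shifted_matrix :: "framed_graph \<Rightarrow> bit mat" where
  "shifted_matrix G = adj_matrix G + 1\<^sub>m (num_vertices G)"

definition unit_matrix :: "nat \<Rightarrow> nat \<Rightarrow> bit mat" where
  "unit_matrix n i = mat n n (\<lambda>(k, l). of_bool (k = i \<and> l = i))"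

definition B_matrix :: "framed_graph \<Rightarrow> nat \<Rightarrow> bit mat" where
  "B_matrix G i = adj_matrix G + 1\<^sub>m (num_vertices G) + unit_matrix (num_vertices G) i"

definition corank :: "bit mat \<Rightarrow> nat" where
  "corank M = dim_col M - vec_space.rank (dim_row M) M"

definition graph_corank :: "framed_graph \<Rightarrow> nat" where
  "graph_corank G = corank (shifted_matrix G)"

definition free_corank :: "labelled_free_graph \<Rightarrow> nat" where
  "free_corank \<G> = graph_corank (some_rep \<G>)"

text \<open>Adjacency of the \<open>i\<close>-th and \<open>j\<close>-th vertex in the simple graph \<open>L\<close>.\<close>

definition L_adj :: "framed_graph \<Rightarrow> nat \<Rightarrow> nat \<Rightarrow> bool" where
  "L_adj G i j \<longleftrightarrow> i < num_vertices G \<and> j < num_vertices G \<and> i \<noteq> j \<and>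
     the (mat_inverse (shifted_matrix G)) $$ (i, j) = 1"

definition even_vertices_knot :: "labelled_free_graph \<Rightarrow> nat set" where
  "even_vertices_knot \<G> = (let G = some_rep \<G> in
     {vertex_list G ! i | i. i < num_vertices G \<and> even (card {j. L_adj G i j})})"

definition oriented_vertices :: "labelled_free_graph \<Rightarrow> nat set" where
  "oriented_vertices \<H> = (let H = some_rep \<H> in
     {vertex_list H ! i | i. i < num_vertices H \<and> graph_corank H \<le> corank (B_matrix H i)})"


section \<open>Smoothings\<close>

definition attach_leaf :: "nat \<Rightarrow> nat \<Rightarrow> framed_graph \<Rightarrow> framed_graph" where
  "attach_leaf v u G = mk_graph (insert u (vertices G)) (\<lambda>x y. adj G x y \<or> x = v \<and> y = u) (framing G)"

text \<open>The two smoothings at \<open>v\<close>, as a multiset because they may coincide.\<close>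

definition smoothings_at :: "nat \<Rightarrow> labelled_free_graph \<Rightarrow> labelled_free_graph multiset" where
  "smoothings_at v \<G> =
    (if \<exists>H\<in>representatives \<G>. framing H v = 1 \<or> nbhd H v \<noteq> {}
     then let (H1, H2) = (SOME (H1, H2).
                H1 \<in> representatives \<G> \<and> H2 \<in> representatives \<G> \<and> free_move_at v H1 H2)
          in {#free_graph_of (delete_vertices {v} H1), free_graph_of (delete_vertices {v} H2)#}
     else let H = some_rep \<G>; u = (SOME u. u \<notin> vertices H)
          in {#free_graph_of (delete_vertices {v} H), free_graph_of (attach_leaf v u H)#})"

primrec smoothings_along :: "nat list \<Rightarrow> labelled_free_graph \<Rightarrow> labelled_free_graph multiset" where
  "smoothings_along [] \<G> = {#\<G>#}"
| "smoothings_along (v # vs) \<G> = (\<Sum>\<K>\<in>#smoothings_at v \<G>. smoothings_along vs \<K>)"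

text \<open>Smoothings at different vertices commute; the vertices are taken in increasing order of labels.\<close>

definition smoothings :: "nat set \<Rightarrow> labelled_free_graph \<Rightarrow> labelled_free_graph multiset" where
  "smoothings S \<G> = smoothings_along (sorted_list_of_set S) \<G>"


section \<open>The spaces and the brackets\<close>

type_synonym chain = "free_graph \<Rightarrow>\<^sub>0 bit"

lemma lookup_scale_chain:
  fixes c :: bit and x :: "'a \<Rightarrow>\<^sub>0 bit"
  shows "poly_mapping.lookup (Poly_Mapping.map ((*) c) x) k = c * poly_mapping.lookup x k"
  by (cases c) (simp_all add: Poly_Mapping.map.rep_eq when_def del: mult_bit_eq_and)

global_interpretation chain: vector_space "\<lambda>(c::bit) (x::chain). Poly_Mapping.map ((*) c) x"
  by standard
    (rule poly_mapping_eqI,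
      simp add: lookup_scale_chain lookup_add distrib_left distrib_right mult.assoc del: mult_bit_eq_and add_bit_eq_xor)+

definition gen :: "free_graph \<Rightarrow> chain" where
  "gen x = Poly_Mapping.single x 1"

definition has_isolated_edge :: "free_graph \<Rightarrow> bool" where
  "has_isolated_edge x \<longleftrightarrow> (\<exists>G u v. free_class G = x \<and> framing G u = 0 \<and> framing G v = 0 \<and>
     nbhd G u = {v} \<and> nbhd G v = {u})"

definition generators :: "nat \<Rightarrow> free_graph set" where
  "generators i = {x. \<exists>G. free_class G = x \<and> graph_corank G + 1 = i}"

definition relations :: "nat \<Rightarrow> chain set" where
  "relations i =
     {gen x - gen y | x y. x \<in> generators i \<and> y \<in> generators i \<and> omega2_related x y} \<union>
     (if i > 1 then {gen x | x. x \<in> generators i \<and> has_isolated_edge x} else {})"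

text \<open>
  The \<open>i\<close>-th space is the quotient of the space of chains supported on \<open>generators i\<close> by the span
  of \<open>relations i\<close>. The class of such a chain is its coset.
\<close>

definition space_class :: "nat \<Rightarrow> chain \<Rightarrow> chain set" where
  "space_class i x = {x + r | r. r \<in> chain.span (relations i)}"

definition component :: "nat \<Rightarrow> chain \<Rightarrow> chain" where
  "component i x = Poly_Mapping.mapp (\<lambda>k c. if k \<in> generators i then c else 0) x"

text \<open>An element of the direct sum over \<open>i \<ge> 1\<close> is the family of its components.\<close>

definition direct_sum_class :: "chain \<Rightarrow> nat \<Rightarrow> chain set" where
  "direct_sum_class x = (\<lambda>i\<in>{1..}. space_class i (component i x))"

definition square_bracket :: "labelled_free_graph \<Rightarrow> chain" where
  "square_bracket \<G> =
     (\<Sum>s\<in>#{#s \<in># smoothings (even_vertices_knot \<G>) \<G>. free_corank s = 0#}. gen (iso_class s))"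

definition curly_bracket :: "labelled_free_graph \<Rightarrow> chain" where
  "curly_bracket \<H> =
     (\<Sum>s\<in>#{#s \<in># smoothings (oriented_vertices \<H>) \<H>.
         \<not> (\<exists>y. equivclp omega2_related (iso_class s) y \<and> has_isolated_edge y)#}. gen (iso_class s))"

end

theory Submission
  imports Defs "HOL-Library.Function_Algebras" "HOL-Library.Product_Plus"
begin

text \<open>
  A framed graph with adjacency matrix \<open>A\<close> is replaced by the space
  \<open>lagrangian\<close> of all vectors that assign to every vertex \<open>j\<close> a pair
  \<open>z j = (x j, y j)\<close> over \<open>Z\<^sub>2\<close> with \<open>y = A x\<close>. It
  is isotropic for the standard symplectic form. At every vertex there are three nonzero values,
  \<open>a = (1, 0)\<close>, \<open>b = (0, 1)\<close> and \<open>c = (1, 1)\<close>; for a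
  crossing of a curve they would be its two smoothings and the straight transit. The moves
  defining free framed graphs only interchange \<open>a\<close> and \<open>b\<close> at some
  vertices, and conversely the space up to such interchanges determines the free framed graph
  (\<open>free_equiv_iff_lagrangian\<close>). Since \<open>c\<close> is fixed by them, every
  notion expressed by the space and \<open>c\<close> alone is automatically well defined. The
  corank of \<open>A + E\<close> is of this kind, because it measures the vectors with values in
  \<open>{0, c}\<close> (\<open>card_straight_part\<close>), and so are both parities
  (\<open>even_vertices_even_set\<close>, \<open>oriented_vertices_even_set\<close>).

  Smoothing a vertex \<open>v\<close> in direction \<open>p\<close> keeps the vectors whose
  value at \<open>v\<close> is \<open>0\<close> or \<open>p\<close> and forgets that value. The
  smoothing of an isolated vertex that produces an isolated edge is the one whose direction
  \<open>p\<close>, put at \<open>v\<close> alone, already lies in the space. Both brackets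
  ignore graphs with an isolated edge, so a bracket is a sum over all states, that is all
  choices of directions at the even vertices, that are not followed by a nonzero vector
  supported on these vertices (\<open>state_sum\<close>, \<open>smoothings_state_sum\<close>).
  Neither representatives nor an order of the vertices occur in this sum. Instead of working
  modulo the relations, every generator is replaced by a canonical chain in its class
  (\<open>canonical\<close>), which turns congruences into equations.

  Invariance under the first move is immediate. For the second move the space contains
  \<open>a\<close> at two vertices \<open>x, y\<close> and \<open>0\<close> elsewhere. The
  vertices have equal parity. If they are not smoothed, every summand still contains this vector
  and the second move removes the pair from it. If they are smoothed, the states with
  \<open>aa\<close> are followed by it, those with \<open>ab\<close> and \<open>ba\<close>
  cancel modulo two, and those with \<open>bb\<close> give the sum of the smaller graph. The
  same argument works in any such space, except that the sum vanishes if \<open>b\<close> at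
  \<open>x, y\<close> is contained too, since the pair is then an isolated edge
  (\<open>state_sum_double_point\<close>).

  For the third move at \<open>u, v, w\<close> let \<open>R\<close> be the space of the graph
  without \<open>u\<close>. One side of the move is an extension \<open>triangle_ext u v w
  R\<close> of \<open>R\<close>; the other side is the same extension of \<open>R\<close> with
  \<open>a\<close> and \<open>b\<close> interchanged at \<open>v\<close> and \<open>w\<close>.
  The move keeps the parity of \<open>u\<close>, exchanges those of \<open>v\<close> and
  \<open>w\<close>, and an even number of the three vertices is odd
  (\<open>even_set_triangle\<close>, \<open>triangle_parity_knot\<close>,
  \<open>triangle_parity_link\<close>). If \<open>u\<close> is even, its smoothing in direction
  \<open>b\<close> gives \<open>R\<close> itself and the one in direction \<open>a\<close> has a
  double point at \<open>v, w\<close>; both contributions are symmetric under the interchange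
  (\<open>state_sum_triangle_u\<close>). If \<open>v\<close> is the only even vertex, one of its
  smoothings has a double point at \<open>u, w\<close>, and the other one becomes a smoothing at
  \<open>w\<close> of the other side after permuting \<open>u, v, w\<close>
  (\<open>state_sum_triangle_v\<close>, \<open>triangle_ext_minor_relabel\<close>).
\<close>

section \<open>The Lagrangian space of a framed graph\<close>

lemma bit_add_self [simp]: "x + x = (0::bit)"
  by (cases x) simp_all

lemma bit_add_self_left [simp]: "x + (x + y) = (y::bit)"
  by (cases x; cases y) simp_all

declare add_bit_eq_xor [simp del] mult_bit_eq_and [simp del]

lemma bit_add_eq_0_iff [simp]: "x + y = (0::bit) \<longleftrightarrow> x = y"
  by (cases x; cases y) simp_all

type_synonym kvec = "nat \<Rightarrow> bit \<times> bit"

definition entry :: "framed_graph \<Rightarrow> nat \<Rightarrow> nat \<Rightarrow> bit" where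
  "entry G i j = (if i = j then framing G i else of_bool (adj G i j))"

lemma entry_sym: "entry G i j = entry G j i"
  by (auto simp: entry_def dest: adjD)

lemma entry_outside: "i \<notin> vertices G \<Longrightarrow> entry G i j = 0" "j \<notin> vertices G \<Longrightarrow> entry G i j = 0"
  by (auto simp: entry_def framing_outside dest: adjD)

lemma adj_entry: "adj G i j \<longleftrightarrow> i \<noteq> j \<and> entry G i j = 1"
  by (auto simp: entry_def dest: adjD)

lemma framing_entry: "framing G i = entry G i i"
  by (auto simp: entry_def)

lemma entry_eqI:
  assumes "vertices G = vertices H" "\<And>i j. entry G i j = entry H i j"
  shows "G = H"
  using assms by (intro framed_graph_eqI) (auto simp: adj_entry framing_entry)

lemma entry_mk_graph:
  assumes "finite V"
  shows "entry (mk_graph V P f) i j =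
    (if i \<in> V \<and> j \<in> V then if i = j then f i else of_bool (P i j \<or> P j i) else 0)"
  using assms by (auto simp: entry_def)

text \<open>
  The graph of the linear map \<open>A\<close>, with the two coordinates of a vertex kept
  together.
\<close>

definition lagrangian :: "framed_graph \<Rightarrow> kvec set" where
  "lagrangian G = {z. (\<forall>j. j \<notin> vertices G \<longrightarrow> z j = 0) \<and>
     (\<forall>i\<in>vertices G. snd (z i) = (\<Sum>j\<in>vertices G. entry G i j * fst (z j)))}"

text \<open>
  Interchanges the directions \<open>a\<close> and \<open>b\<close> at the vertices of
  \<open>S\<close>; the direction \<open>c\<close> stays.
\<close>

definition flip :: "nat set \<Rightarrow> kvec \<Rightarrow> kvec" where
  "flip S z = (\<lambda>j. if j \<in> S then prod.swap (z j) else z j)"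

lemma flip_apply: "flip S z j = (if j \<in> S then prod.swap (z j) else z j)"
  by (simp add: flip_def)

lemma flip_flip: "flip S (flip T z) = flip ((S - T) \<union> (T - S)) z"
  by (auto simp: flip_def fun_eq_iff)

lemma flip_self [simp]: "flip S (flip S z) = z"
  by (auto simp: flip_def fun_eq_iff)

lemma flip_empty [simp]: "flip {} z = z"
  by (auto simp: flip_def)

lemma flip_image_self [simp]: "flip S ` flip S ` L = L"
  by (simp add: image_image)

lemma flip_image_empty [simp]: "flip {} ` L = L"
  by simp

lemma flip_image_flip: "flip S ` flip T ` L = flip ((S - T) \<union> (T - S)) ` L"
  by (simp add: image_image flip_flip)

lemma in_flip_image: "z \<in> flip S ` L \<longleftrightarrow> flip S z \<in> L"
  by (metis flip_self image_iff)

lemma swap_eq_0 [simp]: "prod.swap p = 0 \<longleftrightarrow> p = 0" for p :: "bit \<times> bit"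
  by (cases p) (auto simp: zero_prod_def)

lemma flip_eq_0 [simp]: "flip S z j = 0 \<longleftrightarrow> z j = 0"
  by (auto simp: flip_def)

lemma flip_zero [simp]: "flip S 0 = 0"
  by (auto simp: flip_def fun_eq_iff zero_prod_def)

lemma flip_add: "flip S (z + w) = flip S z + flip S w"
  by (auto simp: flip_def fun_eq_iff prod_eq_iff)

lemma lagrangian_outside: "z \<in> lagrangian G \<Longrightarrow> j \<notin> vertices G \<Longrightarrow> z j = 0"
  by (auto simp: lagrangian_def)

lemma lagrangian_snd: "z \<in> lagrangian G \<Longrightarrow> snd (z i) = (\<Sum>j\<in>vertices G. entry G i j * fst (z j))"
  by (cases "i \<in> vertices G") (auto simp: lagrangian_def entry_outside)

lemma lagrangianI:
  assumes "\<And>j. j \<notin> vertices G \<Longrightarrow> z j = 0"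
    "\<And>i. i \<in> vertices G \<Longrightarrow> snd (z i) = (\<Sum>j\<in>vertices G. entry G i j * fst (z j))"
  shows "z \<in> lagrangian G"
  using assms by (auto simp: lagrangian_def)

lemma lagrangian_0 [simp]: "0 \<in> lagrangian G"
  by (auto simp: lagrangian_def)

lemma lagrangian_add: "z \<in> lagrangian G \<Longrightarrow> w \<in> lagrangian G \<Longrightarrow> z + w \<in> lagrangian G"
  by (auto simp: lagrangian_def distrib_left sum.distrib)

lemma lagrangian_fst_0:
  assumes "z \<in> lagrangian G" "\<And>j. fst (z j) = 0"
  shows "z = 0"
proof
  fix i
  show "z i = 0 i"
    using lagrangian_snd[OF assms(1), of i] assms(2) by (simp add: prod_eq_iff)
qed

lemma lagrangian_eqI:
  assumes "z \<in> lagrangian G" "w \<in> lagrangian G" "\<And>j. fst (z j) = fst (w j)"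
  shows "z = w"
proof
  fix i
  show "z i = w i"
    using lagrangian_snd[OF assms(1), of i] lagrangian_snd[OF assms(2), of i] assms(3) by (simp add: prod_eq_iff)
qed

definition vertex_row :: "framed_graph \<Rightarrow> nat \<Rightarrow> kvec" where
  "vertex_row G v = (\<lambda>i. (of_bool (i = v), entry G i v))"

lemma vertex_row_in_lagrangian:
  assumes "v \<in> vertices G"
  shows "vertex_row G v \<in> lagrangian G"
proof (rule lagrangianI)
  fix j assume "j \<notin> vertices G"
  then show "vertex_row G v j = 0" using assms by (auto simp: vertex_row_def entry_outside zero_prod_def)
next
  fix i assume "i \<in> vertices G"
  have "(\<Sum>j\<in>vertices G. entry G i j * fst (vertex_row G v j)) = (\<Sum>j\<in>vertices G. if j = v then entry G i v else 0)"
    by (rule sum.cong) (auto simp: vertex_row_def)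
  then show "snd (vertex_row G v i) = (\<Sum>j\<in>vertices G. entry G i j * fst (vertex_row G v j))"
    using assms by (simp add: vertex_row_def)
qed

lemma vertex_row_unique:
  assumes "z \<in> lagrangian G" "\<And>j. fst (z j) = of_bool (j = v)" "v \<in> vertices G"
  shows "z = vertex_row G v"
  by (rule lagrangian_eqI[OF assms(1) vertex_row_in_lagrangian[OF assms(3)]]) (simp add: assms(2) vertex_row_def)

lemma lagrangian_inject:
  assumes "vertices G = vertices H" "lagrangian G = lagrangian H"
  shows "G = H"
proof (rule entry_eqI[OF assms(1)])
  fix i j
  show "entry G i j = entry H i j"
  proof (cases "j \<in> vertices G")
    case True
    have "vertex_row G j = vertex_row H j"
      using vertex_row_in_lagrangian[OF True] assms True by (intro vertex_row_unique) (auto simp: vertex_row_def)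
    then show ?thesis by (auto simp: vertex_row_def fun_eq_iff)
  next
    case False
    then show ?thesis using assms(1) by (simp add: entry_outside)
  qed
qed

text \<open>
  The vertex set can be recovered from the space, so that two graphs with the same space up to
  \<open>flip\<close> have the same vertices.
\<close>

lemma support_lagrangian: "{v. \<exists>z\<in>flip F ` lagrangian G. z v \<noteq> 0} = vertices G"
proof (intro Set.set_eqI iffI)
  fix v assume "v \<in> {v. \<exists>z\<in>flip F ` lagrangian G. z v \<noteq> 0}"
  then show "v \<in> vertices G" by (auto dest: lagrangian_outside)
next
  fix v assume v: "v \<in> vertices G"
  have "flip F (vertex_row G v) v \<noteq> 0" by (simp only: flip_eq_0) (simp add: vertex_row_def zero_prod_def)
  with vertex_row_in_lagrangian[OF v] show "v \<in> {v. \<exists>z\<in>flip F ` lagrangian G. z v \<noteq> 0}" by blast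
qed

text \<open>
  The space is isotropic because \<open>A\<close> is symmetric.
\<close>

lemma lagrangian_isotropic:
  assumes "z \<in> lagrangian G" "w \<in> lagrangian G"
  shows "(\<Sum>j\<in>vertices G. fst (z j) * snd (w j)) = (\<Sum>j\<in>vertices G. snd (z j) * fst (w j))"
proof -
  let ?V = "vertices G"
  have "(\<Sum>j\<in>?V. fst (z j) * snd (w j)) = (\<Sum>j\<in>?V. \<Sum>k\<in>?V. fst (z j) * (entry G j k * fst (w k)))"
    by (simp add: lagrangian_snd[OF assms(2)] sum_distrib_left)
  also have "\<dots> = (\<Sum>k\<in>?V. \<Sum>j\<in>?V. fst (z j) * (entry G j k * fst (w k)))"
    by (rule sum.swap)
  also have "\<dots> = (\<Sum>k\<in>?V. (\<Sum>j\<in>?V. entry G k j * fst (z j)) * fst (w k))"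
    by (rule sum.cong) (auto simp: sum_distrib_left entry_sym mult_ac intro!: sum.cong)
  finally show ?thesis by (simp add: lagrangian_snd[OF assms(1)])
qed

lemma in_lagrangian_insert:
  assumes "vertices G = insert v W" "v \<notin> W"
  shows "z \<in> lagrangian G \<longleftrightarrow> (\<forall>j. j \<notin> insert v W \<longrightarrow> z j = 0) \<and>
    snd (z v) = entry G v v * fst (z v) + (\<Sum>j\<in>W. entry G v j * fst (z j)) \<and>
    (\<forall>i\<in>W. snd (z i) = entry G i v * fst (z v) + (\<Sum>j\<in>W. entry G i j * fst (z j)))"
proof -
  have "finite W" using assms finite_vertices[of G] by simp
  then show ?thesis using assms by (simp add: lagrangian_def)
qed

lemma in_lagrangian_insert2:
  assumes "vertices G = insert u (insert v W)" "v \<notin> W" "u \<notin> W" "u \<noteq> v"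
  shows "z \<in> lagrangian G \<longleftrightarrow> (\<forall>j. j \<notin> insert u (insert v W) \<longrightarrow> z j = 0) \<and>
    snd (z u) = entry G u u * fst (z u) + (entry G u v * fst (z v) + (\<Sum>j\<in>W. entry G u j * fst (z j))) \<and>
    snd (z v) = entry G v u * fst (z u) + (entry G v v * fst (z v) + (\<Sum>j\<in>W. entry G v j * fst (z j))) \<and>
    (\<forall>i\<in>W. snd (z i) = entry G i u * fst (z u) + (entry G i v * fst (z v) + (\<Sum>j\<in>W. entry G i j * fst (z j))))"
proof -
  have "finite W" using assms finite_vertices[of G] by simp
  then show ?thesis using assms by (simp add: lagrangian_def)
qed


section \<open>The moves on free framed graphs\<close>

text \<open>
  Exchanging the two coordinates of one vertex solves its equation for the other coordinate and
  substitutes the result into the remaining equations.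
\<close>

lemma bit_pivot1:
  fixes fv sv s :: bit
  shows "sv = fv + s \<and> (\<forall>i\<in>W. P i = c i * fv + (S i + c i * s)) \<longleftrightarrow>
    fv = sv + s \<and> (\<forall>i\<in>W. P i = c i * sv + S i)"
  by (cases fv; cases sv; cases s) (simp_all add: add_ac)

lemma bit_pivot2:
  fixes fu su fv sv tu tv :: bit
  shows "su = fv + tv \<and> sv = fu + tu \<and>
      (\<forall>i\<in>W. P i = c i * fu + (d i * fv + (S i + d i * tv + c i * tu))) \<longleftrightarrow>
    fu = sv + tu \<and> fv = su + tv \<and> (\<forall>i\<in>W. P i = d i * su + (c i * sv + S i))"
proof -
  have "su = fv + tv \<longleftrightarrow> fv = su + tv" "sv = fu + tu \<longleftrightarrow> fu = sv + tu"
    by (metis add.commute bit_add_self_left)+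
  moreover have "c i * fu + (d i * fv + (S i + d i * tv + c i * tu)) = d i * (fv + tv) + (c i * (fu + tu) + S i)" for i
    by (simp add: algebra_simps)
  ultimately show ?thesis by auto
qed

text \<open>
  The move is the principal pivot at the diagonal entry of \<open>v\<close>: the rank one
  correction of \<open>A\<close> is what remains after eliminating the coordinate of
  \<open>v\<close>.
\<close>

lemma lagrangian_omega4':
  assumes "omega4'_at v G G'"
  shows "lagrangian G' = flip {v} ` lagrangian G" "vertices G' = vertices G"
proof -
  from assms have v: "v \<in> vertices G" "framing G v = 1" and G': "G' = mk_graph (vertices G) (adj (local_compl G v))
       (\<lambda>x. if x \<in> nbhd G v then framing G x + 1 else framing G x)"
    by (auto simp: omega4'_at_def)
  show V: "vertices G' = vertices G" by (simp add: G')
  obtain W where W: "vertices G = insert v W" "v \<notin> W" using v by (meson mk_disjoint_insert)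
  have vv: "entry G v v = 1" using v by (simp add: entry_def)
  have a1: "entry G' v j = entry G v j" "entry G' j v = entry G j v" for j
    using v by (auto simp: G' entry_mk_graph local_compl_def nbhd_def entry_outside adj_entry framing_entry entry_sym dest: adjD)
  have a2: "entry G' i j = entry G i j + entry G i v * entry G v j" if "i \<in> W" "j \<in> W" for i j
  proof (cases "i = j")
    case True
    have iV: "i \<in> vertices G" "i \<noteq> v" using that W by auto
    show ?thesis unfolding True[symmetric]
      by (cases "entry G v i") (auto simp: iV iV(2)[symmetric] G' entry_mk_graph nbhd_def adj_entry framing_entry[of G] entry_sym[of G i v])
  next
    case False
    have iV: "i \<in> vertices G" "i \<noteq> v" "j \<in> vertices G" "j \<noteq> v" using that W by auto
    have "entry G' i j = of_bool ((entry G i j = 1) \<noteq> (entry G v i = 1 \<and> entry G v j = 1))"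
      using False iV by (auto simp: G' entry_mk_graph local_compl_def nbhd_def adj_entry[of G] entry_sym[of G j i])
    then show ?thesis unfolding entry_sym[of G i v]
      by (cases "entry G v i"; cases "entry G v j"; cases "entry G i j") simp_all
  qed
  show "lagrangian G' = flip {v} ` lagrangian G"
  proof (rule Set.set_eqI)
    fix z
    define z' where "z' = flip {v} z"
    have z': "z' v = prod.swap (z v)" "j \<noteq> v \<Longrightarrow> z' j = z j" for j by (auto simp: z'_def flip_def)
    have zW: "z' j = z j" if "j \<in> W" for j
      using W that by (intro z') auto
    have s0: "(\<Sum>j\<in>W. f j * fst (z' j)) = (\<Sum>j\<in>W. f j * fst (z j))" for f
      by (simp add: zW)
    have s1: "(\<Sum>j\<in>W. entry G' i j * fst (z j)) = (\<Sum>j\<in>W. entry G i j * fst (z j)) + entry G i v * (\<Sum>j\<in>W. entry G v j * fst (z j))" if "i \<in> W" for i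
      using that by (simp add: a2 sum.distrib sum_distrib_left algebra_simps)
    have "z \<in> lagrangian G' \<longleftrightarrow> (\<forall>j. j \<notin> insert v W \<longrightarrow> z j = 0) \<and>
      snd (z v) = fst (z v) + (\<Sum>j\<in>W. entry G v j * fst (z j)) \<and>
      (\<forall>i\<in>W. snd (z i) = entry G i v * fst (z v) + ((\<Sum>j\<in>W. entry G i j * fst (z j)) + entry G i v * (\<Sum>j\<in>W. entry G v j * fst (z j))))"
      using s1 by (simp add: in_lagrangian_insert[OF W(1)[folded V] W(2)] a1 vv)
    also have "\<dots> \<longleftrightarrow> (\<forall>j. j \<notin> insert v W \<longrightarrow> z j = 0) \<and>
      fst (z v) = snd (z v) + (\<Sum>j\<in>W. entry G v j * fst (z j)) \<and>
      (\<forall>i\<in>W. snd (z i) = entry G i v * snd (z v) + (\<Sum>j\<in>W. entry G i j * fst (z j)))"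
      by (rule conj_cong, rule refl, rule bit_pivot1)
    also have "\<dots> \<longleftrightarrow> z' \<in> lagrangian G"
    proof -
      have o: "(\<forall>j. j \<notin> insert v W \<longrightarrow> z' j = 0) \<longleftrightarrow> (\<forall>j. j \<notin> insert v W \<longrightarrow> z j = 0)"
        using z' by auto
      have "(\<forall>i\<in>W. snd (z' i) = entry G i v * fst (z' v) + (\<Sum>j\<in>W. entry G i j * fst (z' j))) \<longleftrightarrow>
        (\<forall>i\<in>W. snd (z i) = entry G i v * snd (z v) + (\<Sum>j\<in>W. entry G i j * fst (z j)))"
        unfolding s0 by (simp add: zW z')
      then show ?thesis unfolding in_lagrangian_insert[OF W] o s0 by (simp add: z' vv)
    qed
    finally show "z \<in> lagrangian G' \<longleftrightarrow> z \<in> flip {v} ` lagrangian G" by (simp add: in_flip_image z'_def)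
  qed
qed

text \<open>
  The move is the principal pivot at the block of \<open>u, v\<close>. Eliminating both
  coordinates interchanges the rows of \<open>u\<close> and \<open>v\<close>, which is why the
  move interchanges the two labels.
\<close>

lemma lagrangian_omega4:
  assumes "omega4_at u v G G'"
  shows "lagrangian G' = flip {u, v} ` lagrangian G" "vertices G' = vertices G"
proof -
  from assms have uv: "adj G u v" "framing G u = 0" "framing G v = 0" and G': "G' = swap_labels u v (pivot G u v)"
    by (auto simp: omega4_at_def)
  have uV: "u \<in> vertices G" "v \<in> vertices G" "u \<noteq> v" using adjD[OF uv(1)] by auto
  show V: "vertices G' = vertices G"
    using vertices_free_move assms unfolding free_move_def free_move_at_def by blast
  obtain W where W: "vertices G = insert u (insert v W)" "v \<notin> W" "u \<notin> W"
    using uV by (metis insert_iff mk_disjoint_insert)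
  have a: "entry G u u = 0" "entry G v v = 0" "entry G u v = 1" "entry G v u = 1"
    using uv by (auto simp: framing_entry adj_entry entry_sym)
  have fW: "finite W" using W finite_vertices[of G] by simp
  have tr: "transpose u v ` vertices G = vertices G" using uV by (auto simp: transpose_def image_iff)
  have am: "entry G' i j = entry (pivot G u v) (transpose u v i) (transpose u v j)" for i j
  proof -
    have *: "transpose u v x \<in> vertices G \<longleftrightarrow> x \<in> vertices G" for x using uV by (auto simp: transpose_def)
    have **: "vertices (pivot G u v) = vertices G" by (simp add: pivot_def)
    show ?thesis
    proof (cases "i \<in> vertices G \<and> j \<in> vertices G")
      case True
      have "transpose u v i = transpose u v j \<longleftrightarrow> i = j"
        by (metis transpose_involutory)
      moreover have "adj (pivot G u v) (transpose u v j) (transpose u v i) \<Longrightarrow>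
        adj (pivot G u v) (transpose u v i) (transpose u v j)" by (auto dest: adjD)
      ultimately show ?thesis using True unfolding G' swap_labels_def ** tr
        by (subst entry_mk_graph) (auto simp: entry_def)
    next
      case False
      then have "entry (pivot G u v) (transpose u v i) (transpose u v j) = 0"
        using * ** by (metis entry_outside)
      with False show ?thesis unfolding G' swap_labels_def ** tr
        by (subst entry_mk_graph) auto
    qed
  qed
  have p: "entry (pivot G u v) i j = (if i \<in> vertices G \<and> j \<in> vertices G then
     if i = j then framing G i else of_bool (adj G i j \<noteq> (pivot_toggles G u v i j \<or> pivot_toggles G u v j i)) else 0)" for i j
  proof -
    have "adj G j i = adj G i j" by (metis adjD)
    then show ?thesis unfolding pivot_def by (simp add: entry_mk_graph) (metis (full_types))
  qed
  have nt: "\<not> pivot_toggles G u v u j" "\<not> pivot_toggles G u v j u"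
    "\<not> pivot_toggles G u v v j" "\<not> pivot_toggles G u v j v" for j
    by (auto simp: pivot_toggles_def)
  have a1: "entry G' u j = entry G v j" "entry G' v j = entry G u j" "entry G' j u = entry G j v" "entry G' j v = entry G j u" if "j \<in> W" for j
  proof -
    have j: "j \<noteq> u" "j \<noteq> v" "u \<noteq> j" "v \<noteq> j" "j \<in> vertices G" using that W by auto
    have [simp]: "adj G j v = adj G v j" "adj G j u = adj G u j" by (auto dest: adjD)
    show "entry G' u j = entry G v j" "entry G' v j = entry G u j" "entry G' j u = entry G j v" "entry G' j v = entry G j u"
      unfolding am p using j uV by (simp_all add: transpose_def nt entry_def)
  qed
  have a3: "entry G' u v = 1" "entry G' v u = 1" "entry G' u u = 0" "entry G' v v = 0"
    unfolding am p using uv uV adjD[OF uv(1)] by (simp_all add: transpose_def nt)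
  have a2: "entry G' i j = entry G i j + entry G i u * entry G v j + entry G i v * entry G u j" if "i \<in> W" "j \<in> W" for i j
  proof -
    have *: "i \<noteq> u" "i \<noteq> v" "j \<noteq> u" "j \<noteq> v" using that W(2,3) by auto
    have V: "i \<in> vertices G" "j \<in> vertices G" using that W(1) by auto
    have tr: "transpose u v i = i" "transpose u v j = j" using * by (simp_all add: transpose_def)
    have "entry G' i j = entry (pivot G u v) i j" unfolding am tr ..
    also have "\<dots> = (if i = j then entry G i j else of_bool ((entry G i j = 1) \<noteq> (pivot_toggles G u v i j \<or> pivot_toggles G u v j i)))"
      unfolding p using V by (simp add: entry_def)
    finally have am': "entry G' i j = (if i = j then entry G i j else of_bool ((entry G i j = 1) \<noteq> (pivot_toggles G u v i j \<or> pivot_toggles G u v j i)))" .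
    have s: "entry G i u = entry G u i" "entry G i v = entry G v i" by (rule entry_sym)+
    have pt: "pivot_toggles G u v i j \<longleftrightarrow> entry G u i = 1 \<and> entry G v j = 1 \<and> (entry G v i \<noteq> 1 \<or> entry G u j \<noteq> 1)"
      "pivot_toggles G u v j i \<longleftrightarrow> entry G u j = 1 \<and> entry G v i = 1 \<and> (entry G v j \<noteq> 1 \<or> entry G u i \<noteq> 1)"
      unfolding pivot_toggles_def nbhd_def mem_Collect_eq adj_entry using * by auto
    show ?thesis
    proof (cases "i = j")
      case True
      then show ?thesis unfolding am' s by (simp add: mult.commute)
    next
      case False
      then show ?thesis unfolding am' s pt
        by (cases "entry G u i"; cases "entry G u j"; cases "entry G v i"; cases "entry G v j"; cases "entry G i j") simp_all
    qed
  qed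
  show "lagrangian G' = flip {u, v} ` lagrangian G"
  proof (rule Set.set_eqI)
    fix z
    define z' where "z' = flip {u, v} z"
    have z': "z' u = prod.swap (z u)" "z' v = prod.swap (z v)" "j \<noteq> u \<Longrightarrow> j \<noteq> v \<Longrightarrow> z' j = z j" for j by (auto simp: z'_def flip_def)
    have zW: "z' j = z j" if "j \<in> W" for j
      using W that by (intro z') auto
    have s0: "(\<Sum>j\<in>W. f j * fst (z' j)) = (\<Sum>j\<in>W. f j * fst (z j))" for f
      by (simp add: zW)
    let ?s = "\<lambda>i. \<Sum>j\<in>W. entry G i j * fst (z j)"
    have s1: "(\<Sum>j\<in>W. entry G' i j * fst (z j)) = ?s i + entry G i u * ?s v + entry G i v * ?s u" if "i \<in> W" for i
      using that by (simp add: a2 sum.distrib sum_distrib_left algebra_simps)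
    have s2: "(\<Sum>j\<in>W. entry G' u j * fst (z j)) = ?s v" "(\<Sum>j\<in>W. entry G' v j * fst (z j)) = ?s u"
      by (auto intro!: sum.cong simp: a1)
    have "z \<in> lagrangian G' \<longleftrightarrow> (\<forall>j. j \<notin> insert u (insert v W) \<longrightarrow> z j = 0) \<and>
      snd (z u) = fst (z v) + ?s v \<and> snd (z v) = fst (z u) + ?s u \<and>
      (\<forall>i\<in>W. snd (z i) = entry G i v * fst (z u) + (entry G i u * fst (z v) + (?s i + entry G i u * ?s v + entry G i v * ?s u)))"
      using s1 s2 a1 by (simp add: in_lagrangian_insert2[OF W(1)[folded V] W(2,3) uV(3)] a3)
    also have "\<dots> \<longleftrightarrow> (\<forall>j. j \<notin> insert u (insert v W) \<longrightarrow> z j = 0) \<and>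
      fst (z u) = snd (z v) + ?s u \<and> fst (z v) = snd (z u) + ?s v \<and>
      (\<forall>i\<in>W. snd (z i) = entry G i u * snd (z u) + (entry G i v * snd (z v) + ?s i))"
      by (rule conj_cong, rule refl, rule bit_pivot2)
    also have "\<dots> \<longleftrightarrow> z' \<in> lagrangian G"
    proof -
      have o: "(\<forall>j. j \<notin> insert u (insert v W) \<longrightarrow> z' j = 0) \<longleftrightarrow> (\<forall>j. j \<notin> insert u (insert v W) \<longrightarrow> z j = 0)"
        using z' by auto
      have "(\<forall>i\<in>W. snd (z' i) = entry G i u * fst (z' u) + (entry G i v * fst (z' v) + ?s i)) \<longleftrightarrow>
        (\<forall>i\<in>W. snd (z i) = entry G i u * snd (z u) + (entry G i v * snd (z v) + ?s i))"
        by (simp add: zW z')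
      then show ?thesis unfolding in_lagrangian_insert2[OF W uV(3)] o s0 by (simp add: z' a)
    qed
    finally show "z \<in> lagrangian G' \<longleftrightarrow> z \<in> flip {u, v} ` lagrangian G" by (simp add: in_flip_image z'_def)
  qed
qed


abbreviation free_equiv :: "framed_graph \<Rightarrow> framed_graph \<Rightarrow> bool" where
  "free_equiv \<equiv> equivclp free_move"

lemma omega4'_exists:
  assumes "entry G v v = 1"
  obtains H where "omega4'_at v G H" "lagrangian H = flip {v} ` lagrangian G" "vertices H = vertices G"
proof -
  have v: "v \<in> vertices G" using entry_outside[of v G v] assms by fastforce
  obtain H where H: "omega4'_at v G H" using assms v by (auto simp: omega4'_at_def framing_entry)
  show ?thesis by (rule that[OF H lagrangian_omega4'[OF H]])
qed

lemma omega4_exists: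
  assumes "entry G u v = 1" "u \<noteq> v" "entry G u u \<noteq> 1" "entry G v v \<noteq> 1"
  obtains H where "omega4_at u v G H" "lagrangian H = flip {u, v} ` lagrangian G" "vertices H = vertices G"
proof -
  obtain H where H: "omega4_at u v G H" using assms by (auto simp: omega4_at_def framing_entry adj_entry)
  show ?thesis by (rule that[OF H lagrangian_omega4[OF H]])
qed

lemma free_equiv_move: "free_move_at v G H \<Longrightarrow> free_equiv G H"
  unfolding free_move_def by (blast intro: r_into_equivclp)

lemma free_move_at_simps: "omega4_at v u G H \<Longrightarrow> free_move_at v G H" "omega4'_at v G H \<Longrightarrow> free_move_at v G H"
  by (auto simp: free_move_at_def)

lemma lagrangian_free_move_at:
  assumes "free_move_at v G H"
  obtains F where "lagrangian H = flip F ` lagrangian G" "v \<in> F" "F \<subseteq> vertices G" "vertices H = vertices G"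
  using assms unfolding free_move_at_def
proof
  assume "\<exists>u. omega4_at v u G H"
  then obtain u where u: "omega4_at v u G H" by blast
  then have "{v, u} \<subseteq> vertices G" by (auto simp: omega4_at_def dest: adjD)
  with lagrangian_omega4[OF u] that show thesis by blast
next
  assume v: "omega4'_at v G H"
  then have "{v} \<subseteq> vertices G" by (auto simp: omega4'_at_def)
  with lagrangian_omega4'[OF v] that show thesis by blast
qed

lemma lagrangian_free_equiv:
  assumes "free_equiv G H"
  shows "vertices H = vertices G \<and> (\<exists>F\<subseteq>vertices G. lagrangian H = flip F ` lagrangian G)"
  using assms
proof (induction rule: equivclp_induct)
  case base
  have "lagrangian G = flip {} ` lagrangian G" by simp
  then show ?case by blast
next
  case (step y z)
  then obtain F where F: "F \<subseteq> vertices G" "lagrangian y = flip F ` lagrangian G" and V: "vertices y = vertices G" by blast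
  have "\<exists>F'. lagrangian z = flip F' ` lagrangian y \<and> F' \<subseteq> vertices y \<and> vertices z = vertices y"
    using step(2)
  proof
    assume "free_move y z"
    then obtain v where "free_move_at v y z" by (auto simp: free_move_def)
    then obtain F' where "lagrangian z = flip F' ` lagrangian y" "F' \<subseteq> vertices y" "vertices z = vertices y"
      by (rule lagrangian_free_move_at)
    then show ?thesis by blast
  next
    assume "free_move z y"
    then obtain v where "free_move_at v z y" by (auto simp: free_move_def)
    then obtain F' where "lagrangian y = flip F' ` lagrangian z" "F' \<subseteq> vertices z" "vertices y = vertices z"
      by (rule lagrangian_free_move_at)
    then show ?thesis by (intro exI[of _ F']) simp
  qed
  then obtain F' where F': "lagrangian z = flip F' ` lagrangian y" "F' \<subseteq> vertices y" "vertices z = vertices y" by blast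
  have "lagrangian z = flip ((F' - F) \<union> (F - F')) ` lagrangian G" unfolding F' F flip_image_flip ..
  moreover have "(F' - F) \<union> (F - F') \<subseteq> vertices G" using F F' V by blast
  ultimately show ?case using F' V by blast
qed

text \<open>
  Any nonzero entry in row \<open>v\<close> allows a pivot that interchanges the directions at
  \<open>v\<close>. If the framing of \<open>k\<close> obstructs the pivot at \<open>v,
  k\<close>, a pivot at \<open>k\<close> first makes the framing of \<open>v\<close> equal to
  \<open>1\<close>.
\<close>

lemma free_equiv_flip_pair:
  assumes "entry G v k = 1"
  obtains H F where "free_equiv G H" "lagrangian H = flip F ` lagrangian G" "vertices H = vertices G" "v \<in> F" "F \<subseteq> {v, k}"
proof (cases "entry G v v = 1")
  case True
  then obtain H where H: "omega4'_at v G H" "lagrangian H = flip {v} ` lagrangian G" "vertices H = vertices G"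
    by (rule omega4'_exists)
  show ?thesis
    by (rule that[of H "{v}", OF free_equiv_move[OF free_move_at_simps(2)[OF H(1)]] H(2,3)]) auto
next
  case v0: False
  then have vk: "v \<noteq> k" using assms by auto
  show ?thesis
  proof (cases "entry G k k = 1")
    case False
    obtain H where H: "omega4_at v k G H" "lagrangian H = flip {v, k} ` lagrangian G" "vertices H = vertices G"
      by (rule omega4_exists[OF assms vk v0 False])
    show ?thesis
      by (rule that[of H "{v, k}", OF free_equiv_move[OF free_move_at_simps(1)[OF H(1)]] H(2,3)]) auto
  next
    case True
    then obtain G' where G': "omega4'_at k G G'" "lagrangian G' = flip {k} ` lagrangian G" "vertices G' = vertices G"
      by (rule omega4'_exists)
    have v: "v \<in> vertices G" using entry_outside(1)[of v G k] assms by fastforce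
    have k: "k \<in> vertices G" using entry_outside(2)[of k G v] assms by fastforce
    have "flip {k} (vertex_row G v + vertex_row G k) \<in> lagrangian G'"
      unfolding G' using vertex_row_in_lagrangian[OF v] vertex_row_in_lagrangian[OF k] by (blast intro: lagrangian_add)
    moreover have "fst (flip {k} (vertex_row G v + vertex_row G k) j) = of_bool (j = v)" for j
      using vk assms True by (auto simp: flip_def vertex_row_def entry_sym[of G k v])
    ultimately have "flip {k} (vertex_row G v + vertex_row G k) = vertex_row G' v"
      by (rule vertex_row_unique) (simp add: G' v)
    then have "entry G' v v = snd (flip {k} (vertex_row G v + vertex_row G k) v)"
      by (simp add: vertex_row_def)
    also have "\<dots> = 1" using vk assms v0 by (simp add: flip_def vertex_row_def)
    finally obtain H where H: "omega4'_at v G' H" "lagrangian H = flip {v} ` lagrangian G'" "vertices H = vertices G'"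
      by (rule omega4'_exists)
    have "free_equiv G H"
      by (rule equivclp_trans[OF free_equiv_move[OF free_move_at_simps(2)[OF G'(1)]] free_equiv_move[OF free_move_at_simps(2)[OF H(1)]]])
    moreover have "lagrangian H = flip {v, k} ` lagrangian G" using vk by (simp add: H G' flip_image_flip insert_commute insert_Diff_if)
    ultimately show ?thesis using that[of H "{v, k}"] H G' by auto
  qed
qed

text \<open>
  A basis exchange. A state in which \<open>W\<close> carries direction \<open>a\<close> and
  \<open>U\<close> carries direction \<open>b\<close>, and which no nonzero vector follows, can
  be turned by moves into one with direction \<open>b\<close> only. As long as \<open>W\<close>
  is nonempty, the row of some \<open>v \<in> W\<close> does not follow the state, and an entry
  witnessing this lies outside \<open>U\<close>, so that a pivot there shrinks \<open>W\<close>
  without disturbing \<open>U\<close>.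
\<close>

lemma representative_avoiding_state:
  assumes "W \<inter> U = {}" "finite W"
    and "\<And>z. z \<in> lagrangian G \<Longrightarrow> (\<And>j. z j \<noteq> 0 \<Longrightarrow> j \<in> W \<and> z j = (1, 0) \<or> j \<in> U \<and> z j = (0, 1)) \<Longrightarrow> z = 0"
    and "W \<subseteq> vertices G"
  shows "\<exists>H F. free_equiv G H \<and> lagrangian H = flip F ` lagrangian G \<and> vertices H = vertices G \<and> W \<subseteq> F \<and> F \<inter> U = {}"
  using assms
proof (induction "card W" arbitrary: W U G rule: less_induct)
  case less
  show ?case
  proof (cases "W = {}")
    case True
    then show ?thesis by (intro exI[of _ G] exI[of _ "{}"]) auto
  next
    case False
    then obtain v where v: "v \<in> W" by blast
    then have vV: "v \<in> vertices G" using less.prems(4) by blast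
    \<comment> \<open>Otherwise the row of \<open>v\<close> follows the state, although it is nonzero at \<open>v\<close>.\<close>
    have "\<exists>k. k \<notin> U \<and> entry G v k = 1"
    proof (rule ccontr)
      assume c: "\<not> ?thesis"
      have "vertex_row G v = 0"
      proof (rule less.prems(3)[OF vertex_row_in_lagrangian[OF vV]])
        fix j assume j: "vertex_row G v j \<noteq> 0"
        show "j \<in> W \<and> vertex_row G v j = (1, 0) \<or> j \<in> U \<and> vertex_row G v j = (0, 1)"
        proof (cases "j = v")
          case True
          then show ?thesis using c v less.prems(1) by (auto simp: vertex_row_def)
        next
          case False
          then show ?thesis using c j by (auto simp: vertex_row_def zero_prod_def entry_sym[of G j v])
        qed
      qed
      then have "vertex_row G v v = 0" by simp
      then show False by (simp add: vertex_row_def zero_prod_def)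
    qed
    then obtain k where k: "k \<notin> U" "entry G v k = 1" by blast
    obtain H F where H: "free_equiv G H" "lagrangian H = flip F ` lagrangian G" "vertices H = vertices G" and F: "v \<in> F" "F \<subseteq> {v, k}"
      by (rule free_equiv_flip_pair[OF k(2)])
    have FU: "F \<inter> U = {}" using F k v less.prems(1) by blast
    \<comment> \<open>The vertices of \<open>W\<close> that the pivot reaches now carry direction \<open>b\<close> and join \<open>U\<close>.\<close>
    have "\<exists>H' F'. free_equiv H H' \<and> lagrangian H' = flip F' ` lagrangian H \<and> vertices H' = vertices H \<and> W - F \<subseteq> F' \<and> F' \<inter> (U \<union> (W \<inter> F)) = {}"
    proof (rule less.hyps[of "W - F" "U \<union> W \<inter> F" H])
      show "card (W - F) < card W" using v F less.prems(2) by (intro psubset_card_mono) auto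
      show "(W - F) \<inter> (U \<union> W \<inter> F) = {}" using less.prems(1) by blast
      show "z = 0" if z: "z \<in> lagrangian H" and zj: "\<And>j. z j \<noteq> 0 \<Longrightarrow> j \<in> W - F \<and> z j = (1, 0) \<or> j \<in> U \<union> W \<inter> F \<and> z j = (0, 1)" for z
      proof -
      have "flip F z = 0"
      proof (rule less.prems(3))
        show "flip F z \<in> lagrangian G" using z H(2) by (simp add: in_flip_image)
        fix j assume "flip F z j \<noteq> 0"
        then have "z j \<noteq> 0" by simp
        from zj[OF this] show "j \<in> W \<and> flip F z j = (1, 0) \<or> j \<in> U \<and> flip F z j = (0, 1)"
          using FU by (auto simp: flip_def)
      qed
      then show "z = 0" by (metis flip_self flip_zero)
      qed
      show "finite (W - F)" using less.prems(2) by simp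
      show "W - F \<subseteq> vertices H" using less.prems(4) H(3) by auto
    qed
    then obtain H' F' where H': "free_equiv H H'" "lagrangian H' = flip F' ` lagrangian H" "vertices H' = vertices H"
      "W - F \<subseteq> F'" "F' \<inter> (U \<union> (W \<inter> F)) = {}" by blast
    show ?thesis
    proof (intro exI conjI)
      show "free_equiv G H'" using H(1) H'(1) by (rule equivclp_trans)
      show "lagrangian H' = flip ((F' - F) \<union> (F - F')) ` lagrangian G" by (simp add: H H' flip_image_flip)
      show "vertices H' = vertices G" using H H' by simp
      show "W \<subseteq> (F' - F) \<union> (F - F')" "((F' - F) \<union> (F - F')) \<inter> U = {}" using H'(4,5) FU by blast+
    qed
  qed
qed

text \<open>
  If the space of \<open>H\<close> arises from that of \<open>G\<close> by interchanging
  \<open>a\<close> and \<open>b\<close> on \<open>F\<close>, then no nonzero vector of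
  \<open>G\<close> has values \<open>a\<close> on \<open>F\<close> and \<open>b\<close>
  elsewhere, for it would have first coordinates zero in \<open>H\<close>. The basis exchange,
  applied to all vertices, then leads from \<open>G\<close> to \<open>H\<close>.
\<close>

theorem free_equiv_iff_lagrangian:
  "free_equiv G H \<longleftrightarrow> vertices H = vertices G \<and> (\<exists>F. lagrangian H = flip F ` lagrangian G)"
proof
  assume "free_equiv G H"
  then show "vertices H = vertices G \<and> (\<exists>F. lagrangian H = flip F ` lagrangian G)" using lagrangian_free_equiv by blast
next
  assume "vertices H = vertices G \<and> (\<exists>F. lagrangian H = flip F ` lagrangian G)"
  then obtain F where V: "vertices H = vertices G" and F: "lagrangian H = flip F ` lagrangian G" by blast
  have FV: "flip F' ` lagrangian G = flip (F' \<inter> vertices G) ` lagrangian G" for F'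
    by (intro image_cong refl) (auto simp: flip_def fun_eq_iff dest: lagrangian_outside)
  have "\<exists>H' F'. free_equiv G H' \<and> lagrangian H' = flip F' ` lagrangian G \<and> vertices H' = vertices G \<and> F \<inter> vertices G \<subseteq> F' \<and> F' \<inter> (vertices G - F) = {}"
  proof (rule representative_avoiding_state)
    fix z assume z: "z \<in> lagrangian G" and zj: "\<And>j. z j \<noteq> 0 \<Longrightarrow> j \<in> F \<inter> vertices G \<and> z j = (1, 0) \<or> j \<in> vertices G - F \<and> z j = (0, 1)"
    have "flip F z = 0"
    proof (rule lagrangian_fst_0)
      show "flip F z \<in> lagrangian H" using z F by simp
      fix j show "fst (flip F z j) = 0"
        using zj[of j] by (cases "z j = 0") (auto simp: flip_def)
    qed
    then show "z = 0" by (metis flip_self flip_zero)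
  qed auto
  then obtain H' F' where H': "free_equiv G H'" "lagrangian H' = flip F' ` lagrangian G" "vertices H' = vertices G"
    "F \<inter> vertices G \<subseteq> F'" "F' \<inter> (vertices G - F) = {}" by blast
  have "F \<inter> vertices G = F' \<inter> vertices G" using H'(4,5) by blast
  then have "lagrangian H' = lagrangian H" using F H'(2) FV[of F] FV[of F'] by simp
  then have "H' = H" using lagrangian_inject H'(3) V by metis
  with H'(1) show "free_equiv G H" by simp
qed


section \<open>Generators modulo the second move and isolated edges\<close>

lemma free_graph_of_eq_iff: "free_graph_of G = free_graph_of H \<longleftrightarrow> free_equiv G H"
  unfolding free_graph_of_def by (rule labelled_free_graph.abs_eq_iff)

lemma in_representatives: "H \<in> representatives (free_graph_of G) \<longleftrightarrow> free_equiv G H"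
  unfolding representatives_def mem_Collect_eq free_graph_of_eq_iff by (blast intro: equivclp_sym)

lemma free_graph_of_some_rep [simp]: "free_graph_of (some_rep \<G>) = \<G>"
  using representatives_nonempty[of \<G>] by (simp add: representatives_def)

text \<open>
  The generators that are zero modulo the relations for corank at least one.
\<close>

definition vanishing :: "free_graph \<Rightarrow> bool" where
  "vanishing x \<longleftrightarrow> (\<exists>y. equivclp omega2_related x y \<and> has_isolated_edge y)"

text \<open>
  A normal form modulo the relations. It depends only on the class of \<open>x\<close> under the
  second move, so that it takes equal values on both sides of every relation.
\<close>

definition canonical :: "free_graph \<Rightarrow> chain" where
  "canonical x = (if vanishing x then 0 else gen (SOME y. equivclp omega2_related x y))"

lemma canonical_cong:
  assumes "equivclp omega2_related x y"
  shows "canonical x = canonical y"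
proof -
  have "equivclp omega2_related x z \<longleftrightarrow> equivclp omega2_related y z" for z
    using assms by (meson equivclp_sym equivclp_trans)
  then have "equivclp omega2_related x = equivclp omega2_related y" by blast
  then show ?thesis unfolding canonical_def vanishing_def by (simp only:)
qed

lemma canonical_isolated_edge: "has_isolated_edge x \<Longrightarrow> canonical x = 0"
  unfolding canonical_def vanishing_def by (metis equivclp_refl)

lemma canonical_omega2:
  assumes "omega2 G H"
  shows "canonical (free_class G) = canonical (free_class H)"
proof -
  have "omega2_related (free_class G) (free_class H)"
    using assms unfolding omega2_related_def by blast
  then show ?thesis by (intro canonical_cong r_into_equivclp)
qed

text \<open>
  The spaces of free framed graphs with labelled vertices.
\<close>

definition graphic :: "nat set \<Rightarrow> kvec set \<Rightarrow> bool" where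
  "graphic V L \<longleftrightarrow> (\<exists>G F. vertices G = V \<and> L = flip F ` lagrangian G)"

text \<open>
  The canonical chain of the free framed graph that the space represents; the choice of a graph
  is irrelevant by \<open>class_chain_lagrangian\<close>.
\<close>

definition class_chain :: "kvec set \<Rightarrow> chain" where
  "class_chain L = canonical (free_class (SOME G. \<exists>F. L = flip F ` lagrangian G))"

lemma flip_lagrangian_eq_free_equiv:
  assumes "flip F ` lagrangian G = flip F' ` lagrangian H"
  shows "free_equiv G H"
proof -
  have "vertices H = vertices G"
    using support_lagrangian[of F G] support_lagrangian[of F' H] assms by simp
  moreover have "lagrangian H = flip F' ` flip F ` lagrangian G" by (simp add: assms)
  ultimately show ?thesis unfolding free_equiv_iff_lagrangian flip_image_flip by blast
qed

lemma class_chain_lagrangian: "class_chain (flip F ` lagrangian G) = canonical (free_class G)"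
proof -
  have "\<exists>F'. flip F ` lagrangian G = flip F' ` lagrangian (SOME H. \<exists>F'. flip F ` lagrangian G = flip F' ` lagrangian H)"
    by (rule someI[of "\<lambda>H. \<exists>F'. flip F ` lagrangian G = flip F' ` lagrangian H" G]) blast
  then have "free_equiv G (SOME H. \<exists>F'. flip F ` lagrangian G = flip F' ` lagrangian H)" by (blast intro: flip_lagrangian_eq_free_equiv)
  then show ?thesis unfolding class_chain_def free_class_def by (metis free_graph_of_eq_iff)
qed

lemma class_chain_flip: "class_chain (flip F ` L) = class_chain L"
proof -
  have "(\<exists>F'. flip F ` L = flip F' ` lagrangian G) \<longleftrightarrow> (\<exists>F'. L = flip F' ` lagrangian G)" for G
  proof
    assume "\<exists>F'. flip F ` L = flip F' ` lagrangian G"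
    then obtain F' where "flip F ` L = flip F' ` lagrangian G" by blast
    then have "L = flip F ` flip F' ` lagrangian G" by (metis flip_image_self)
    then show "\<exists>F'. L = flip F' ` lagrangian G" unfolding flip_image_flip by blast
  next
    assume "\<exists>F'. L = flip F' ` lagrangian G"
    then show "\<exists>F'. flip F ` L = flip F' ` lagrangian G" using flip_image_flip by blast
  qed
  then show ?thesis by (simp add: class_chain_def)
qed

lemma graphic_flip: "graphic V L \<Longrightarrow> graphic V (flip F ` L)"
  unfolding graphic_def using flip_image_flip by metis

lemma graphic_lagrangian [simp]: "graphic (vertices G) (lagrangian G)"
  unfolding graphic_def by (metis flip_image_empty)

lemma graphic_outside: "graphic V L \<Longrightarrow> z \<in> L \<Longrightarrow> j \<notin> V \<Longrightarrow> z j = 0"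
  by (auto simp: graphic_def dest: lagrangian_outside)

lemma graphic_add: "graphic V L \<Longrightarrow> z \<in> L \<Longrightarrow> w \<in> L \<Longrightarrow> z + w \<in> L"
  by (auto simp: graphic_def flip_add[symmetric] intro: lagrangian_add)

lemma graphic_0: "graphic V L \<Longrightarrow> 0 \<in> L"
  unfolding graphic_def by (metis flip_zero imageI lagrangian_0)


section \<open>State sums\<close>

definition erase :: "nat set \<Rightarrow> kvec \<Rightarrow> kvec" where
  "erase S z = (\<lambda>j. if j \<in> S then 0 else z j)"

text \<open>
  A state is encoded by the set \<open>T\<close> of the vertices smoothed in direction
  \<open>b\<close>.
\<close>

definition state_dir :: "nat set \<Rightarrow> nat \<Rightarrow> bit \<times> bit" where
  "state_dir T v = (if v \<in> T then (0, 1) else (1, 0))"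

definition compatible :: "nat set \<Rightarrow> nat set \<Rightarrow> kvec \<Rightarrow> bool" where
  "compatible S T z \<longleftrightarrow> (\<forall>v\<in>S. z v = 0 \<or> z v = state_dir T v)"

definition minor :: "nat set \<Rightarrow> nat set \<Rightarrow> kvec set \<Rightarrow> kvec set" where
  "minor S T L = erase S ` {z \<in> L. compatible S T z}"

text \<open>
  No nonzero vector supported on \<open>S\<close> follows the state. In terms of successive
  smoothings: none of them splits off a circle, that is, produces an isolated edge.
\<close>

definition circle_free :: "nat set \<Rightarrow> nat set \<Rightarrow> kvec set \<Rightarrow> bool" where
  "circle_free S T L \<longleftrightarrow> (\<forall>z\<in>L. compatible S T z \<longrightarrow> erase S z = 0 \<longrightarrow> z = 0)"

definition state_sum :: "kvec set \<Rightarrow> nat set \<Rightarrow> chain" where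
  "state_sum L S = (\<Sum>T\<in>Pow S. if circle_free S T L then class_chain (minor S T L) else 0)"

lemma in_minor: "w \<in> minor S T L \<longleftrightarrow> (\<exists>z\<in>L. compatible S T z \<and> w = erase S z)"
  by (auto simp: minor_def)

lemma compatible_flip: "compatible S T (flip F z) \<longleftrightarrow> compatible S ((T - F) \<union> (F - T)) z"
proof -
  have "flip F z v = 0 \<or> flip F z v = state_dir T v \<longleftrightarrow> z v = 0 \<or> z v = state_dir ((T - F) \<union> (F - T)) v" for v
    by (cases "z v") (auto simp: flip_def state_dir_def zero_prod_def)
  then show ?thesis by (simp add: compatible_def)
qed

lemma erase_flip: "erase S (flip F z) = flip F (erase S z)"
  by (auto simp: erase_def flip_def fun_eq_iff zero_prod_def)

lemma minor_flip: "minor S T (flip F ` L) = flip F ` minor S ((T - F) \<union> (F - T)) L"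
proof -
  have "{z \<in> flip F ` L. compatible S T z} = flip F ` {z \<in> L. compatible S ((T - F) \<union> (F - T)) z}"
    by (auto simp: compatible_flip)
  then show ?thesis by (simp add: minor_def image_image erase_flip)
qed

lemma circle_free_flip: "circle_free S T (flip F ` L) \<longleftrightarrow> circle_free S ((T - F) \<union> (F - T)) L"
proof -
  have "flip F z = 0 \<longleftrightarrow> z = 0" for z by (metis flip_self flip_zero)
  then show ?thesis by (auto simp: circle_free_def compatible_flip erase_flip)
qed

lemma compatible_cong: "T \<inter> S = T' \<inter> S \<Longrightarrow> compatible S T z = compatible S T' z"
  unfolding compatible_def state_dir_def by (intro ball_cong refl) (metis IntI IntD1)

lemma minor_cong: "T \<inter> S = T' \<inter> S \<Longrightarrow> minor S T L = minor S T' L"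
  using compatible_cong[of T S T'] by (simp add: minor_def)

lemma circle_free_cong: "T \<inter> S = T' \<inter> S \<Longrightarrow> circle_free S T L = circle_free S T' L"
  using compatible_cong[of T S T'] by (simp add: circle_free_def)

lemma state_sum_flip:
  assumes "finite S"
  shows "state_sum (flip F ` L) S = state_sum L S"
proof -
  define h where "h T = (T - F) \<union> ((F \<inter> S) - T)" for T
  have hh: "h (h T) = T" "h T \<subseteq> S" if "T \<subseteq> S" for T using that by (auto simp: h_def)
  have "state_sum (flip F ` L) S = (\<Sum>T\<in>Pow S. if circle_free S (h T) L then class_chain (minor S (h T) L) else 0)"
    unfolding state_sum_def
  proof (rule sum.cong[OF refl])
    fix T assume "T \<in> Pow S"
    then have "((T - F) \<union> (F - T)) \<inter> S = h T \<inter> S" by (auto simp: h_def)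
    from circle_free_cong[OF this] minor_cong[OF this]
    show "(if circle_free S T (flip F ` L) then class_chain (minor S T (flip F ` L)) else 0) =
      (if circle_free S (h T) L then class_chain (minor S (h T) L) else 0)"
      by (simp add: circle_free_flip minor_flip class_chain_flip)
  qed
  also have "\<dots> = state_sum L S" unfolding state_sum_def
    by (rule sum.reindex_bij_witness[of _ h h]) (use hh in auto)
  finally show ?thesis .
qed

lemma erase_0 [simp]: "erase S 0 = 0"
  by (auto simp: erase_def)

lemma erase_erase: "erase S (erase S' z) = erase (S \<union> S') z"
  by (auto simp: erase_def)

lemma erase_eq_0_iff: "erase S z = 0 \<longleftrightarrow> (\<forall>j. j \<notin> S \<longrightarrow> z j = 0)"
  by (auto simp: erase_def fun_eq_iff)

lemma compatible_Un: "compatible (S \<union> S') T z \<longleftrightarrow> compatible S T z \<and> compatible S' T z"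
  by (auto simp: compatible_def)

lemma compatible_erase: "S \<inter> S' = {} \<Longrightarrow> compatible S T (erase S' z) \<longleftrightarrow> compatible S T z"
  by (auto simp: compatible_def erase_def)

lemma minor_Un:
  assumes "S \<inter> S' = {}"
  shows "minor S T (minor S' T L) = minor (S \<union> S') T L"
proof -
  have "{w \<in> erase S' ` {z \<in> L. compatible S' T z}. compatible S T w} = erase S' ` {z \<in> L. compatible (S \<union> S') T z}"
    using compatible_erase[OF assms] by (auto simp: compatible_Un)
  then show ?thesis by (simp add: minor_def image_image erase_erase)
qed

text \<open>
  Following a state on a union can be tested in two steps; this makes state sums independent of
  any order of the vertices.
\<close>

lemma circle_free_Un:
  assumes "S \<inter> S' = {}"
  shows "circle_free (S \<union> S') T L \<longleftrightarrow> circle_free S' T L \<and> circle_free S T (minor S' T L)"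
proof (intro iffI conjI)
  assume n: "circle_free (S \<union> S') T L"
  show "circle_free S' T L" unfolding circle_free_def
  proof (intro ballI impI)
    fix z assume z: "z \<in> L" "compatible S' T z" "erase S' z = 0"
    then have "compatible S T z" using assms by (auto simp: compatible_def erase_eq_0_iff)
    with z n show "z = 0" by (auto simp: circle_free_def compatible_Un erase_eq_0_iff)
  qed
  show "circle_free S T (minor S' T L)" unfolding circle_free_def
  proof (intro ballI impI)
    fix w assume w: "w \<in> minor S' T L" "compatible S T w" "erase S w = 0"
    then obtain z where z: "z \<in> L" "compatible S' T z" "w = erase S' z" by (auto simp: in_minor)
    with w n compatible_erase[OF assms] have "z = 0" by (auto simp: circle_free_def compatible_Un erase_erase)
    with z show "w = 0" by simp
  qed
next
  assume n: "circle_free S' T L \<and> circle_free S T (minor S' T L)"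
  show "circle_free (S \<union> S') T L" unfolding circle_free_def
  proof (intro ballI impI)
    fix z assume z: "z \<in> L" "compatible (S \<union> S') T z" "erase (S \<union> S') z = 0"
    then have "erase S' z \<in> minor S' T L" "compatible S T (erase S' z)" "erase S (erase S' z) = 0"
      using compatible_erase[OF assms] by (auto simp: in_minor compatible_Un erase_erase)
    with n have "erase S' z = 0" by (auto simp: circle_free_def)
    with z n show "z = 0" by (auto simp: circle_free_def compatible_Un)
  qed
qed

lemma state_sum_empty: "state_sum L {} = class_chain L"
proof -
  have "erase {} z = z" for z by (simp add: erase_def)
  then have "minor {} {} L = L" "circle_free {} {} L" by (auto simp: minor_def compatible_def circle_free_def)
  then show ?thesis by (simp add: state_sum_def)
qed

text \<open>
  Smoothing one vertex: the recursion that corresponds to \<open>smoothings_along\<close>.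
\<close>

lemma state_sum_insert:
  assumes "finite S" "v \<notin> S"
  shows "state_sum L (insert v S) = (if circle_free {v} {} L then state_sum (minor {v} {} L) S else 0) +
    (if circle_free {v} {v} L then state_sum (minor {v} {v} L) S else 0)"
proof -
  define t where "t T = (if circle_free (insert v S) T L then class_chain (minor (insert v S) T L) else 0)" for T
  have t: "t T = (if circle_free {v} T L then if circle_free S T (minor {v} T L) then class_chain (minor S T (minor {v} T L)) else 0 else 0)" for T
    using assms minor_Un[of S "{v}" T L] circle_free_Un[of S "{v}" T L] by (auto simp: t_def)
  have "state_sum L (insert v S) = (\<Sum>T\<in>Pow S. t T) + (\<Sum>T\<in>insert v ` Pow S. t T)"
    unfolding state_sum_def Pow_insert t_def[symmetric] by (rule sum.union_disjoint) (use assms in auto)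
  also have "(\<Sum>T\<in>insert v ` Pow S. t T) = (\<Sum>T\<in>Pow S. t (insert v T))"
    by (rule sum.reindex_cong[of "insert v"]) (use assms in \<open>auto simp: inj_on_def\<close>)
  also have "\<dots> = (if circle_free {v} {v} L then state_sum (minor {v} {v} L) S else 0)"
  proof -
    have "t (insert v T) = (if circle_free {v} {v} L then if circle_free S T (minor {v} {v} L) then class_chain (minor S T (minor {v} {v} L)) else 0 else 0)"
      if "T \<in> Pow S" for T
    proof -
      have e: "insert v T \<inter> {v} = {v} \<inter> {v}" "insert v T \<inter> S = T \<inter> S" using that assms by auto
      show ?thesis unfolding t circle_free_cong[OF e(1)] minor_cong[OF e(1)] circle_free_cong[OF e(2)] minor_cong[OF e(2)] ..
    qed
    then show ?thesis by (simp add: state_sum_def)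
  qed
  also have "(\<Sum>T\<in>Pow S. t T) = (if circle_free {v} {} L then state_sum (minor {v} {} L) S else 0)"
  proof -
    have "t T = (if circle_free {v} {} L then if circle_free S T (minor {v} {} L) then class_chain (minor S T (minor {v} {} L)) else 0 else 0)"
      if "T \<in> Pow S" for T
    proof -
      have e: "T \<inter> {v} = {} \<inter> {v}" using that assms by auto
      show ?thesis unfolding t circle_free_cong[OF e(1)] minor_cong[OF e(1)] ..
    qed
    then show ?thesis by (simp add: state_sum_def)
  qed
  finally show ?thesis .
qed

lemma entry_delete:
  "entry (delete_vertices S G) i j = (if i \<in> S \<or> j \<in> S then 0 else entry G i j)"
proof -
  have "adj G i j \<or> adj G j i \<longleftrightarrow> adj G i j" by (auto dest: adjD)
  then show ?thesis unfolding delete_vertices_def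
    by (simp add: entry_mk_graph) (auto simp: entry_def framing_outside dest: adjD)
qed

lemma vertices_delete [simp]: "vertices (delete_vertices S G) = vertices G - S"
  by (simp add: delete_vertices_def)

text \<open>
  Smoothing in direction \<open>b\<close> is deletion: first coordinates are required to vanish
  on \<open>S\<close>, and the equations of the vertices in \<open>S\<close> merely determine
  the forgotten second coordinates.
\<close>

lemma minor_lagrangian:
  assumes "S \<subseteq> vertices G"
  shows "minor S S (lagrangian G) = lagrangian (delete_vertices S G)"
proof (intro Set.set_eqI iffI)
  fix w assume "w \<in> minor S S (lagrangian G)"
  then obtain z where z: "z \<in> lagrangian G" "compatible S S z" and w: "w = erase S z" by (auto simp: in_minor)
  have f: "fst (z j) = 0" if "j \<in> S" for j using z(2) that by (auto simp: compatible_def state_dir_def)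
  show "w \<in> lagrangian (delete_vertices S G)"
  proof (rule lagrangianI)
    fix j assume "j \<notin> vertices (delete_vertices S G)"
    then show "w j = 0" using lagrangian_outside[OF z(1)] by (auto simp: w erase_def)
  next
    fix i assume i: "i \<in> vertices (delete_vertices S G)"
    have "snd (w i) = (\<Sum>j\<in>vertices G. entry G i j * fst (z j))"
      using i lagrangian_snd[OF z(1)] by (simp add: w erase_def)
    also have "\<dots> = (\<Sum>j\<in>vertices G - S. entry G i j * fst (z j))"
      by (rule sum.mono_neutral_right) (auto simp: f)
    also have "\<dots> = (\<Sum>j\<in>vertices G - S. entry (delete_vertices S G) i j * fst (w j))"
      using i by (intro sum.cong) (auto simp: entry_delete w erase_def)
    finally show "snd (w i) = (\<Sum>j\<in>vertices (delete_vertices S G). entry (delete_vertices S G) i j * fst (w j))" by simp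
  qed
next
  fix w assume w: "w \<in> lagrangian (delete_vertices S G)"
  have w0: "w j = 0" if "j \<in> S" for j using lagrangian_outside[OF w] that by simp
  define z where "z = (\<lambda>i. if i \<in> S then (0, \<Sum>j\<in>vertices G. entry G i j * fst (w j)) else w i)"
  have fz: "fst (z j) = fst (w j)" for j by (auto simp: z_def w0)
  have "z \<in> lagrangian G"
  proof (rule lagrangianI)
    fix j assume "j \<notin> vertices G"
    then show "z j = 0" using assms lagrangian_outside[OF w] by (auto simp: z_def)
  next
    fix i assume i: "i \<in> vertices G"
    show "snd (z i) = (\<Sum>j\<in>vertices G. entry G i j * fst (z j))"
    proof (cases "i \<in> S")
      case True
      then show ?thesis unfolding fz by (simp add: z_def)
    next
      case False
      have "snd (z i) = (\<Sum>j\<in>vertices G - S. entry (delete_vertices S G) i j * fst (w j))"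
        using False lagrangian_snd[OF w, of i] by (simp add: z_def)
      also have "\<dots> = (\<Sum>j\<in>vertices G - S. entry G i j * fst (w j))"
        using False by (intro sum.cong) (auto simp: entry_delete)
      also have "\<dots> = (\<Sum>j\<in>vertices G. entry G i j * fst (w j))"
        by (rule sum.mono_neutral_left) (auto simp: w0)
      finally show ?thesis unfolding fz .
    qed
  qed
  moreover have "compatible S S z"
    unfolding compatible_def state_dir_def by (auto simp: z_def zero_prod_def)
  moreover have "w = erase S z" using w0 by (auto simp: erase_def z_def)
  ultimately show "w \<in> minor S S (lagrangian G)" by (auto simp: in_minor)
qed

lemma minor_flip_in:
  assumes "v \<in> F"
  shows "minor {v} {v} (flip F ` L) = flip F ` minor {v} {} L"
    "minor {v} {} (flip F ` L) = flip F ` minor {v} {v} L"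
    "circle_free {v} {v} (flip F ` L) = circle_free {v} {} L"
    "circle_free {v} {} (flip F ` L) = circle_free {v} {v} L"
proof -
  have e: "(({v} - F) \<union> (F - {v})) \<inter> {v} = {} \<inter> {v}" "(({} - F) \<union> (F - {})) \<inter> {v} = {v} \<inter> {v}" using assms by auto
  show "minor {v} {v} (flip F ` L) = flip F ` minor {v} {} L"
    "minor {v} {} (flip F ` L) = flip F ` minor {v} {v} L"
    unfolding minor_flip using minor_cong[OF e(1)] minor_cong[OF e(2)] by simp_all
  show "circle_free {v} {v} (flip F ` L) = circle_free {v} {} L"
    "circle_free {v} {} (flip F ` L) = circle_free {v} {v} L"
    unfolding circle_free_flip using circle_free_cong[OF e(1)] circle_free_cong[OF e(2)] by simp_all
qed

text \<open>
  At an isolated vertex of framing \<open>0\<close> both smoothings are the deletion.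
\<close>

lemma minor_lagrangian_isolated:
  assumes "v \<in> vertices G" "vertex_row G v = 0(v := (1, 0))"
  shows "minor {v} {} (lagrangian G) = minor {v} {v} (lagrangian G)"
proof -
  have s: "snd (z v) = 0" if "z \<in> lagrangian G" for z
  proof -
    have "entry G v j = 0" for j using fun_cong[OF assms(2), of j]
      by (auto simp: vertex_row_def zero_prod_def entry_sym[of G v j] split: if_splits)
    then show ?thesis using lagrangian_snd[OF that] by simp
  qed
  have r: "0(v := (1, 0)) \<in> lagrangian G" using vertex_row_in_lagrangian[OF assms(1)] assms(2) by simp
  have *: "erase {v} (z + 0(v := (1,0))) = erase {v} z" for z by (auto simp: erase_def fun_eq_iff)
  have cases1: "z v = 0 \<or> z v = (1, 0)" if "z \<in> lagrangian G" for z
    using s[OF that] by (cases "z v"; cases "fst (z v)") (auto simp: zero_prod_def)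
  show ?thesis
  proof (intro Set.set_eqI iffI)
    fix w assume "w \<in> minor {v} {} (lagrangian G)"
    then obtain z where z: "z \<in> lagrangian G" "w = erase {v} z" by (auto simp: in_minor)
    from cases1[OF z(1)] show "w \<in> minor {v} {v} (lagrangian G)"
    proof
      assume "z v = 0"
      then show ?thesis using z by (auto simp: in_minor compatible_def)
    next
      assume "z v = (1, 0)"
      then have "(z + 0(v := (1,0))) v = 0" by (simp add: zero_prod_def)
      then have "compatible {v} {v} (z + 0(v := (1,0)))" by (simp add: compatible_def)
      moreover have "z + 0(v := (1,0)) \<in> lagrangian G" using z(1) r by (rule lagrangian_add)
      ultimately show ?thesis unfolding in_minor using z(2) *[of z] by metis
    qed
  next
    fix w assume "w \<in> minor {v} {v} (lagrangian G)"
    then obtain z where z: "z \<in> lagrangian G" "w = erase {v} z" by (auto simp: in_minor)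
    with cases1[OF z(1)] show "w \<in> minor {v} {} (lagrangian G)" by (auto simp: in_minor compatible_def state_dir_def)
  qed
qed

lemma vertex_row_isolated_iff: "vertex_row G v = 0(v := (1, 0)) \<longleftrightarrow> (\<forall>k. entry G v k = 0)"
proof -
  have "vertex_row G v = 0(v := (1, 0)) \<longleftrightarrow> (\<forall>k. entry G k v = 0)"
    by (auto simp: vertex_row_def fun_eq_iff zero_prod_def split: if_splits)
  then show ?thesis by (simp add: entry_sym)
qed

text \<open>
  Direction \<open>b\<close> is deletion. Direction \<open>a\<close> becomes direction
  \<open>b\<close> after a pivot at \<open>v\<close>, and if \<open>v\<close> is isolated both
  directions give the same space.
\<close>

lemma graphic_minor1:
  assumes "graphic V L" "v \<in> V"
  shows "graphic (V - {v}) (minor {v} T L)"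
proof -
  have lagc: "graphic (vertices G - {v}) (minor {v} {} (lagrangian G)) \<and> graphic (vertices G - {v}) (minor {v} {v} (lagrangian G))"
    if v: "v \<in> vertices G" for G
  proof
    show g: "graphic (vertices G - {v}) (minor {v} {v} (lagrangian G))"
      using minor_lagrangian[of "{v}" G] v graphic_lagrangian[of "delete_vertices {v} G"] by simp
    show "graphic (vertices G - {v}) (minor {v} {} (lagrangian G))"
    proof (cases "\<exists>k. entry G v k = 1")
      case False
      then have "vertex_row G v = 0(v := (1, 0))" by (simp add: vertex_row_isolated_iff)
      with g minor_lagrangian_isolated[OF v] show ?thesis by simp
    next
      case True
      then obtain k where k: "entry G v k = 1" by blast
      obtain H F where H: "lagrangian H = flip F ` lagrangian G" "vertices H = vertices G" "v \<in> F"
        by (rule free_equiv_flip_pair[OF k]) blast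
      have "lagrangian (delete_vertices {v} H) = flip F ` minor {v} {} (lagrangian G)"
        using minor_lagrangian[of "{v}" H] v H minor_flip_in(1)[OF H(3)] by simp
      then have "minor {v} {} (lagrangian G) = flip F ` lagrangian (delete_vertices {v} H)" by simp
      then show ?thesis unfolding graphic_def using H(2) by (metis vertices_delete)
    qed
  qed
  obtain G F where G: "vertices G = V" "L = flip F ` lagrangian G" using assms by (auto simp: graphic_def)
  obtain T' where T': "T' = {} \<or> T' = {v}" "minor {v} ((T - F) \<union> (F - T)) (lagrangian G) = minor {v} T' (lagrangian G)"
  proof (cases "v \<in> (T - F) \<union> (F - T)")
    case True
    then show thesis using minor_cong[of "(T - F) \<union> (F - T)" "{v}" "{v}"] that by auto
  next
    case False
    then show thesis using minor_cong[of "(T - F) \<union> (F - T)" "{v}" "{}"] that by auto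
  qed
  have "graphic (V - {v}) (flip F ` minor {v} T' (lagrangian G))"
    using lagc[of G] G(1) assms(2) T'(1) graphic_flip by blast
  then show ?thesis using G T'(2) by (simp add: minor_flip)
qed

lemma graphic_minor:
  assumes "graphic V L" "S \<subseteq> V" "finite S"
  shows "graphic (V - S) (minor S T L)"
  using assms(3,2)
proof (induction S rule: finite_induct)
  case empty
  have "minor {} T L = L" by (auto simp: minor_def compatible_def erase_def)
  then show ?case using assms(1) by simp
next
  case (insert v S)
  then have "graphic (V - S - {v}) (minor {v} T (minor S T L))"
    by (intro graphic_minor1) auto
  moreover have "V - S - {v} = V - insert v S" by auto
  ultimately show ?case using minor_Un[of "{v}" S T L] insert by simp
qed


definition two_point :: "nat \<Rightarrow> bit \<times> bit \<Rightarrow> nat \<Rightarrow> bit \<times> bit \<Rightarrow> kvec" where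
  "two_point x p y q = (\<lambda>j. if j = x then p else if j = y then q else 0)"

lemma flip_two_point: "x \<noteq> y \<Longrightarrow> flip F (two_point x p y q) =
   two_point x (if x \<in> F then prod.swap p else p) y (if y \<in> F then prod.swap q else q)"
  by (rule ext) (simp add: flip_def two_point_def)

lemma two_point_commute: "x \<noteq> y \<Longrightarrow> two_point x p y q = two_point y q x p"
  by (rule ext) (simp add: two_point_def)

lemma two_point_outside: "two_point x p y q \<in> lagrangian G \<Longrightarrow> x \<noteq> y \<Longrightarrow> p \<noteq> 0 \<Longrightarrow> q \<noteq> 0 \<Longrightarrow> x \<in> vertices G \<and> y \<in> vertices G"
  using lagrangian_outside[of "two_point x p y q" G x] lagrangian_outside[of "two_point x p y q" G y] by (auto simp: two_point_def)


section \<open>Double points\<close>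

text \<open>
  The two vectors are the rows of \<open>y\<close> and \<open>x\<close>.
\<close>

lemma leaf_pair_isolated_edge:
  assumes xy: "x \<noteq> y" "two_point x (0, 1) y (1, 0) \<in> lagrangian G" "two_point x (1, 0) y (0, 1) \<in> lagrangian G"
  shows "has_isolated_edge (free_class G)"
proof -
  have V: "x \<in> vertices G" "y \<in> vertices G"
    using two_point_outside[OF xy(2,1)] by (simp_all add: zero_prod_def)
  have "two_point x (0, 1) y (1, 0) = vertex_row G y"
    by (rule vertex_row_unique[OF xy(2) _ V(2)]) (simp add: xy(1) two_point_def)
  then have "snd (vertex_row G y i) = of_bool (i = x)" for i
    by (simp add: two_point_def flip: \<open>two_point x (0, 1) y (1, 0) = vertex_row G y\<close>)
  moreover have "two_point x (1, 0) y (0, 1) = vertex_row G x"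
    by (rule vertex_row_unique[OF xy(3) _ V(1)]) (simp add: xy(1) two_point_def)
  then have "snd (vertex_row G x i) = of_bool (i = y)" for i
    using xy(1) by (simp add: two_point_def flip: \<open>two_point x (1, 0) y (0, 1) = vertex_row G x\<close>)
  ultimately have r: "entry G i y = of_bool (i = x)" "entry G i x = of_bool (i = y)" for i
    by (simp_all add: vertex_row_def)
  have "framing G x = 0" "framing G y = 0" using r xy(1) by (simp_all add: framing_entry)
  moreover have "adj G x i \<longleftrightarrow> i = y" "adj G y i \<longleftrightarrow> i = x" for i
    unfolding adj_entry entry_sym[of G x] entry_sym[of G y] r using xy(1) by auto
  ultimately show ?thesis
    unfolding has_isolated_edge_def nbhd_def by blast
qed

lemma two_point_nonzero: "p \<noteq> 0 \<Longrightarrow> two_point x p y q \<noteq> 0"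
  by (auto simp: two_point_def fun_eq_iff)

text \<open>
  In the coordinates of a representing graph, the two vectors cannot both have the same
  direction at \<open>x\<close> and \<open>y\<close>, for a nonzero vector has a nonzero first
  coordinate. So they are the rows of an isolated edge.
\<close>

lemma class_chain_isolated_edge:
  assumes "graphic V N" "x \<noteq> y" "two_point x (1, 0) y (1, 0) \<in> N" "two_point x (0, 1) y (0, 1) \<in> N"
  shows "class_chain N = 0"
proof -
  obtain G F where G: "vertices G = V" "N = flip F ` lagrangian G" using assms by (auto simp: graphic_def)
  have a: "flip F (two_point x (1, 0) y (1, 0)) \<in> lagrangian G" and b: "flip F (two_point x (0, 1) y (0, 1)) \<in> lagrangian G"
    using assms G(2) by (simp_all add: in_flip_image)
  have mixed: "class_chain N = 0" if "x \<noteq> y" "two_point x (0, 1) y (1, 0) \<in> lagrangian G" "two_point x (1, 0) y (0, 1) \<in> lagrangian G" for x y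
    unfolding G(2) class_chain_lagrangian by (rule canonical_isolated_edge[OF leaf_pair_isolated_edge[OF that]])
  have pure: "two_point x (0, 1) y (0, 1) \<notin> lagrangian G"
  proof
    assume "two_point x (0, 1) y (0, 1) \<in> lagrangian G"
    then have "two_point x (0, 1) y (0, 1) = 0" by (rule lagrangian_fst_0) (simp add: two_point_def)
    moreover have "two_point x (0, 1) y (0, 1) \<noteq> 0" by (rule two_point_nonzero) (simp add: zero_prod_def)
    ultimately show False by blast
  qed
  consider "x \<in> F" "y \<in> F" | "x \<in> F" "y \<notin> F" | "x \<notin> F" "y \<in> F" | "x \<notin> F" "y \<notin> F" by blast
  then show ?thesis
  proof cases
    case 1 then show ?thesis using a pure by (simp add: flip_two_point[OF assms(2)])
  next
    case 2 then show ?thesis using a b mixed[of x y] assms(2) by (simp add: flip_two_point[OF assms(2)])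
  next
    case 3 then show ?thesis using a b mixed[of x y] assms(2) by (simp add: flip_two_point[OF assms(2)])
  next
    case 4 then show ?thesis using b pure by (simp add: flip_two_point[OF assms(2)])
  qed
qed

lemma supported_in_minor:
  assumes "z \<in> N" "\<And>v. v \<in> S \<Longrightarrow> z v = 0"
  shows "z \<in> minor S T N"
proof -
  have "erase S z = z" "compatible S T z" using assms(2) by (auto simp: erase_def compatible_def)
  with assms(1) show ?thesis unfolding in_minor by metis
qed

lemma state_sum_isolated_edge:
  assumes "graphic V N" "x \<noteq> y" "S \<subseteq> V" "finite S" "x \<notin> S" "y \<notin> S"
    "two_point x (1, 0) y (1, 0) \<in> N" "two_point x (0, 1) y (0, 1) \<in> N"
  shows "state_sum N S = 0"
  unfolding state_sum_def
proof (rule sum.neutral, rule ballI)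
  fix T
  have 0: "two_point x p y q v = 0" if "v \<in> S" for p q v using that assms(5,6) by (auto simp: two_point_def)
  have "class_chain (minor S T N) = 0"
    by (rule class_chain_isolated_edge[OF graphic_minor[OF assms(1,3,4)] assms(2)
        supported_in_minor[OF assms(7) 0] supported_in_minor[OF assms(8) 0]])
  then show "(if circle_free S T N then class_chain (minor S T N) else 0) = 0" by simp
qed

lemma graphic_two_point_in:
  assumes "graphic V N" "two_point x p y q \<in> N" "x \<noteq> y" "p \<noteq> 0" "q \<noteq> 0"
  shows "x \<in> V" "y \<in> V"
  using graphic_outside[OF assms(1,2), of x] graphic_outside[OF assms(1,2), of y] assms(3-)
  by (auto simp: two_point_def)

text \<open>
  Orthogonality to the vector with value \<open>a\<close> at \<open>x\<close> and
  \<open>y\<close>.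
\<close>

lemma graphic_orth:
  assumes "graphic V N" "x \<noteq> y" "two_point x (1, 0) y (1, 0) \<in> N" "z \<in> N"
  shows "snd (z x) = snd (z y)"
proof -
  obtain G F where G: "vertices G = V" "N = flip F ` lagrangian G" using assms by (auto simp: graphic_def)
  define w :: kvec where "w = two_point x (1, 0) y (1, 0)"
  have V: "x \<in> V" "y \<in> V" using graphic_two_point_in[OF assms(1,3,2)] by (simp_all add: zero_prod_def)
  have fin: "finite V" using G by auto
  have "flip F w \<in> lagrangian G" "flip F z \<in> lagrangian G" using assms G(2) by (simp_all add: in_flip_image w_def)
  from lagrangian_isotropic[OF this]
  have "(\<Sum>j\<in>V. fst (flip F w j) * snd (flip F z j) + snd (flip F w j) * fst (flip F z j)) = 0"
    by (simp add: G sum.distrib)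
  also have "(\<Sum>j\<in>V. fst (flip F w j) * snd (flip F z j) + snd (flip F w j) * fst (flip F z j)) =
    (\<Sum>j\<in>V. (if j = x then snd (z x) else 0) + (if j = y then snd (z y) else 0))"
    using assms(2) by (intro sum.cong) (simp_all add: flip_def w_def two_point_def)
  also have "\<dots> = snd (z x) + snd (z y)" using V fin by (simp add: sum.distrib)
  finally show ?thesis by simp
qed

lemma omega2_delete:
  assumes "x \<noteq> y" "x \<in> vertices H" "y \<in> vertices H" "\<And>i. entry H x i = entry H y i"
  shows "omega2 H (delete_vertices {x, y} H)"
proof -
  have e: "entry H x x = entry H y x" "entry H y y = entry H x y" "entry H y x = entry H x y"
    using assms(4)[of x] assms(4)[of y] entry_sym[of H x y] by simp_all
  have "\<not> adj H x y \<and> framing H x = 0 \<and> framing H y = 0 \<or> adj H x y \<and> framing H x = 1 \<and> framing H y = 1"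
    using assms(1) unfolding adj_entry framing_entry e by (cases "entry H x y") simp_all
  moreover have "\<forall>t\<in>vertices H - {x, y}. adj H x t \<longleftrightarrow> adj H y t"
    using assms(4) by (auto simp: adj_entry)
  ultimately show ?thesis unfolding omega2_def using assms(1-3) by blast
qed

lemma bit_pair_cases:
  fixes p :: "bit \<times> bit"
  obtains "p = (0, 0)" | "p = (1, 0)" | "p = (0, 1)" | "p = (1, 1)"
  by (cases p; cases "fst p"; cases "snd p") auto

text \<open>
  If \<open>b\<close> at \<open>x, y\<close> is not in the space, then by orthogonality no
  nonzero vector supported on \<open>x, y\<close> has directions \<open>b\<close> there. So some
  representing graph has direction \<open>a\<close> as first coordinates at both vertices. In it
  the rows of \<open>x\<close> and \<open>y\<close> are equal, which is the situation of the
  second move.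
\<close>

lemma class_chain_double_point:
  assumes "graphic V N" "x \<noteq> y" "two_point x (1, 0) y (1, 0) \<in> N" "two_point x (0, 1) y (0, 1) \<notin> N"
  shows "class_chain N = class_chain (minor {x, y} {x, y} N)"
proof -
  obtain G F where G: "vertices G = V" "N = flip F ` lagrangian G" using assms by (auto simp: graphic_def)
  have V: "x \<in> V" "y \<in> V" using graphic_two_point_in[OF assms(1,3,2)] by (simp_all add: zero_prod_def)
  let ?W = "{x, y} \<inter> F" and ?U = "{x, y} - F"
  have "\<exists>H F'. free_equiv G H \<and> lagrangian H = flip F' ` lagrangian G \<and> vertices H = vertices G \<and> ?W \<subseteq> F' \<and> F' \<inter> ?U = {}"
  proof (rule representative_avoiding_state)
    show "z = 0" if z: "z \<in> lagrangian G" and zj: "\<And>j. z j \<noteq> 0 \<Longrightarrow> j \<in> ?W \<and> z j = (1, 0) \<or> j \<in> ?U \<and> z j = (0, 1)" for z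
    proof -
      have fN: "flip F z \<in> N" using z G(2) by simp
      have f: "flip F z j = 0 \<or> j \<in> {x, y} \<and> flip F z j = (0, 1)" for j
      proof (cases "z j = 0")
        case False
        from zj[OF False] show ?thesis by (auto simp: flip_def)
      qed simp
      have gen: "p = 0 \<or> p = (0, 1) \<Longrightarrow> q = 0 \<or> q = (0, 1) \<Longrightarrow> snd p = snd q \<Longrightarrow> p = 0 \<and> q = 0 \<or> p = (0, 1) \<and> q = (0, 1)"
        for p q :: "bit \<times> bit" by auto
      have s: "snd (flip F z x) = snd (flip F z y)" by (rule graphic_orth[OF assms(1-3) fN])
      have "flip F z = two_point x (flip F z x) y (flip F z y)"
      proof
        fix j show "flip F z j = two_point x (flip F z x) y (flip F z y) j"
          using f[of j] by (auto simp: two_point_def)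
      qed
      moreover have "flip F z x = 0 \<and> flip F z y = 0 \<or> flip F z x = (0, 1) \<and> flip F z y = (0, 1)"
        using gen[of "flip F z x" "flip F z y"] f[of x] f[of y] s by blast
      ultimately have "flip F z = two_point x 0 y 0"
        using fN assms(4) by metis
      also have "\<dots> = 0" by (rule ext) (simp add: two_point_def)
      finally show "z = 0" by (metis flip_self flip_zero)
    qed
    show "?W \<subseteq> vertices G" using V G(1) by auto
  qed auto
  then obtain H F' where H: "free_equiv G H" "lagrangian H = flip F' ` lagrangian G" "vertices H = V" "?W \<subseteq> F'" "F' \<inter> ?U = {}"
    using G(1) by blast
  define D where "D = (F - F') \<union> (F' - F)"
  have D: "x \<notin> D" "y \<notin> D" using H(4,5) by (auto simp: D_def)
  have "lagrangian G = flip F' ` lagrangian H" by (simp add: H(2))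
  then have NH: "N = flip D ` lagrangian H" unfolding G(2) D_def by (simp add: flip_image_flip)
  have r: "two_point x (1, 0) y (1, 0) \<in> lagrangian H"
    using assms(3) D by (simp add: NH in_flip_image flip_two_point[OF assms(2)])
  \<comment> \<open>Orthogonality of the rows of \<open>H\<close> to the double point vector.\<close>
  have eq: "entry H x i = entry H y i" for i
  proof (cases "i \<in> V")
    case True
    have "snd (vertex_row H i x) = snd (vertex_row H i y)"
      by (rule graphic_orth[OF graphic_lagrangian assms(2) r vertex_row_in_lagrangian]) (use True H(3) in simp)
    then show ?thesis by (simp add: vertex_row_def)
  next
    case False
    then show ?thesis using H(3) by (simp add: entry_outside)
  qed
  have m: "minor {x, y} {x, y} N = flip D ` lagrangian (delete_vertices {x, y} H)"
  proof -
    have "(({x, y} - D) \<union> (D - {x, y})) \<inter> {x, y} = {x, y} \<inter> {x, y}" using D by auto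
    from minor_cong[OF this] show ?thesis
      unfolding NH minor_flip using minor_lagrangian[of "{x, y}" H] V H(3) by simp
  qed
  have "omega2 H (delete_vertices {x, y} H)"
    by (rule omega2_delete) (use assms(2) V H(3) eq in auto)
  from canonical_omega2[OF this] show ?thesis unfolding m class_chain_lagrangian unfolding NH class_chain_lagrangian .
qed

lemma eq_second_coordinate:
  fixes p q :: "bit \<times> bit"
  shows "p = 0 \<or> p = (0, 1) \<Longrightarrow> q = 0 \<or> q = (0, 1) \<Longrightarrow> snd p = snd q \<Longrightarrow> p = 0 \<and> q = 0 \<or> p = (0, 1) \<and> q = (0, 1)"
  by auto

lemma kvec_add_self [simp]: "z + z = (0 :: kvec)"
  by (rule ext) (simp add: prod_eq_iff)

lemma kvec_add_self2 [simp]: "z + w + w = (z :: kvec)"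
  by (simp add: add.assoc)

lemma erase_add: "erase S (z + w) = erase S z + erase S w"
  by (rule ext) (simp add: erase_def)

lemma erase_id: "(\<And>v. v \<in> S \<Longrightarrow> z v = 0) \<Longrightarrow> erase S z = z"
  by (rule ext) (simp add: erase_def)

lemma erase_two_point: "erase {x, y} (two_point x p y q) = 0"
  by (rule ext) (simp add: erase_def two_point_def)

lemma two_point_simps [simp]: "two_point x p y q x = p" "x \<noteq> y \<Longrightarrow> two_point x p y q y = q"
  "j \<noteq> x \<Longrightarrow> j \<noteq> y \<Longrightarrow> two_point x p y q j = 0"
  by (simp_all add: two_point_def)

lemma two_point_eqI:
  assumes "x \<noteq> y" "erase {x, y} z = 0" "z x = p" "z y = q"
  shows "z = two_point x p y q"
proof
  fix j show "z j = two_point x p y q j" using assms by (auto simp: erase_eq_0_iff two_point_def)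
qed

lemma two_point_0 [simp]: "two_point x 0 y 0 = 0"
  by (rule ext) (simp add: two_point_def)

lemma pair_nonzero [simp]: "(1 :: bit, 0 :: bit) \<noteq> 0" "(0 :: bit, 1 :: bit) \<noteq> 0" "(1 :: bit, 1 :: bit) \<noteq> 0"
  by (simp_all add: zero_prod_def)

text \<open>
  By orthogonality a vector with values in \<open>{0, b}\<close> at \<open>x\<close> and
  \<open>y\<close> has the same value at both.
\<close>

lemma in_double_point_minor:
  assumes N: "graphic V N" and xy: "x \<noteq> y" and a: "two_point x (1, 0) y (1, 0) \<in> N"
  shows "w \<in> minor {x, y} {x, y} N \<longleftrightarrow> w x = 0 \<and> w y = 0 \<and> (w \<in> N \<or> w + two_point x (0, 1) y (0, 1) \<in> N)"
    (is "_ \<longleftrightarrow> _ \<and> _ \<and> (_ \<or> w + ?b \<in> N)")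
proof
  assume "w \<in> minor {x, y} {x, y} N"
  then obtain z where z: "z \<in> N" "compatible {x, y} {x, y} z" "w = erase {x, y} z" by (auto simp: in_minor)
  then have w0: "w x = 0" "w y = 0" by (simp_all add: erase_def)
  have "z x = 0 \<or> z x = (0, 1)" "z y = 0 \<or> z y = (0, 1)" using z(2) by (simp_all add: compatible_def state_dir_def)
  then have "z x = 0 \<and> z y = 0 \<or> z x = (0, 1) \<and> z y = (0, 1)"
    using graphic_orth[OF N xy a z(1)] by (rule eq_second_coordinate)
  then have "w = z \<or> w + ?b = z"
  proof
    assume "z x = 0 \<and> z y = 0"
    then have "w = z" using z(3) erase_id[of "{x, y}" z] by auto
    then show ?thesis ..
  next
    assume zz: "z x = (0, 1) \<and> z y = (0, 1)"
    have "w + ?b = z"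
    proof
      fix j show "(w + ?b) j = z j" using zz xy by (simp add: z(3) erase_def two_point_def)
    qed
    then show ?thesis ..
  qed
  with z(1) w0 show "w x = 0 \<and> w y = 0 \<and> (w \<in> N \<or> w + ?b \<in> N)" by metis
next
  assume w: "w x = 0 \<and> w y = 0 \<and> (w \<in> N \<or> w + ?b \<in> N)"
  then have "erase {x, y} w = w" by (intro erase_id) auto
  moreover from this have "erase {x, y} (w + ?b) = w" by (simp add: erase_add erase_two_point)
  moreover have "compatible {x, y} {x, y} w" "compatible {x, y} {x, y} (w + ?b)"
    using w xy by (simp_all add: compatible_def state_dir_def)
  ultimately show "w \<in> minor {x, y} {x, y} N" using w unfolding in_minor by metis
qed

lemma minor_commute:
  assumes "S \<inter> S' = {}"
  shows "minor S T (minor S' T' L) = minor S' T' (minor S T L)"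
proof -
  define U where "U = (T \<inter> S) \<union> (T' \<inter> S')"
  have "U \<inter> S = T \<inter> S" "U \<inter> S' = T' \<inter> S'" using assms by (auto simp: U_def)
  then have e: "minor S T L = minor S U L" "minor S' T' L = minor S' U L" for L
    using minor_cong by metis+
  show ?thesis unfolding e using minor_Un[OF assms] minor_Un[of S' S] assms by (simp add: Un_commute Int_commute)
qed

text \<open>
  Summand by summand. The space of a state can acquire \<open>b\<close> at \<open>x, y\<close>
  although it is not contained in the original space; this happens exactly when the same state
  of the reduced space is followed by a nonzero vector, so that both sides are zero.
\<close>

lemma state_sum_double_point_outside:
  assumes N: "graphic V N" and "x \<noteq> y" and a: "two_point x (1, 0) y (1, 0) \<in> N"
    and S: "S \<subseteq> V" "finite S" and xyS: "x \<notin> S" "y \<notin> S"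
  shows "state_sum N S = (if two_point x (0, 1) y (0, 1) \<in> N then 0 else state_sum (minor {x, y} {x, y} N) S)"
proof (cases "two_point x (0, 1) y (0, 1) \<in> N")
  case True
  then show ?thesis using state_sum_isolated_edge[OF N assms(2) S xyS a] by simp
next
  case bN: False
  define b where "b = two_point x (0, 1) y (0, 1)"
  define M where "M = minor {x, y} {x, y} N"
  have M: "w \<in> M \<longleftrightarrow> w x = 0 \<and> w y = 0 \<and> (w \<in> N \<or> w + b \<in> N)" for w
    unfolding M_def b_def by (rule in_double_point_minor[OF N assms(2) a])
  have vS: "two_point x p y q v = 0" if "v \<in> S" for v p q using that xyS by (auto simp: two_point_def)
  have tb: "compatible S T (w + b) = compatible S T w" for w T using vS by (simp add: compatible_def b_def)
  have ob: "erase S b = b" unfolding b_def by (rule erase_id) (rule vS)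
  have supp: "w x = 0" "w y = 0" if "erase S w = 0" for w using that xyS by (auto simp: erase_eq_0_iff)
  have "(if circle_free S T N then class_chain (minor S T N) else 0) = (if circle_free S T M then class_chain (minor S T M) else 0)" for T
  proof (cases "circle_free S T N")
    case False
    then obtain z where z: "z \<in> N" "compatible S T z" "erase S z = 0" "z \<noteq> 0" by (auto simp: circle_free_def)
    then have "z \<in> M" using supp M by blast
    with z have "\<not> circle_free S T M" by (auto simp: circle_free_def)
    with False show ?thesis by simp
  next
    case True
    have gN: "graphic (V - S) (minor S T N)" by (rule graphic_minor[OF N S])
    have aN: "two_point x (1,0) y (1,0) \<in> minor S T N" by (rule supported_in_minor[OF a vS])
    have bmin: "b \<in> minor S T N \<longleftrightarrow> \<not> circle_free S T M"
    proof
      assume "b \<in> minor S T N"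
      then obtain z where z: "z \<in> N" "compatible S T z" "b = erase S z" by (auto simp: in_minor)
      have zb: "z + b \<noteq> 0"
      proof
        assume "z + b = 0"
        then have "z + b + b = b" by simp
        with z(1) bN show False by (simp add: b_def)
      qed
      have o: "erase S (z + b) = 0" by (simp add: erase_add ob flip: z(3))
      have "z + b + b = z" by simp
      then have "z + b \<in> M" using M[of "z + b"] supp[OF o] z(1) by simp
      with zb o tb z(2) show "\<not> circle_free S T M" unfolding circle_free_def by blast
    next
      assume "\<not> circle_free S T M"
      then obtain w where w: "w \<in> M" "compatible S T w" "erase S w = 0" "w \<noteq> 0" by (auto simp: circle_free_def)
      then have "w \<notin> N" using True unfolding circle_free_def by blast
      then have wb: "w + b \<in> N" using w(1) M by blast
      have "erase S (w + b) = b" by (simp add: erase_add ob w(3))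
      with wb w(2) tb show "b \<in> minor S T N" unfolding in_minor by metis
    qed
    show ?thesis
    proof (cases "b \<in> minor S T N")
      case True
      have "class_chain (minor S T N) = 0"
        by (rule class_chain_isolated_edge[OF gN assms(2) aN]) (use True in \<open>simp add: b_def\<close>)
      then show ?thesis using bmin True by simp
    next
      case False
      have "{x, y} \<inter> S = {}" using xyS by auto
      then have "minor {x, y} {x, y} (minor S T N) = minor S T M"
        unfolding M_def by (rule minor_commute)
      moreover have "class_chain (minor S T N) = class_chain (minor {x, y} {x, y} (minor S T N))"
        by (rule class_chain_double_point[OF gN assms(2) aN]) (use False in \<open>simp add: b_def\<close>)
      ultimately show ?thesis using False bmin True by simp
    qed
  qed
  then show ?thesis using bN unfolding state_sum_def M_def[symmetric] by simp
qed

lemma state_sum_insert2: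
  assumes "finite S" "x \<notin> S" "y \<notin> S" "x \<noteq> y"
  shows "state_sum N (insert x (insert y S)) =
    (\<Sum>T\<in>{{}, {y}, {x}, {x, y}}. if circle_free {x, y} T N then state_sum (minor {x, y} T N) S else 0)"
proof -
  define t where "t U = (if circle_free {x, y} U N then state_sum (minor {x, y} U N) S else 0)" for U
  have t: "(if circle_free {x} U N then if circle_free {y} U' (minor {x} U N) then state_sum (minor {y} U' (minor {x} U N)) S else 0 else 0) = t (U \<union> U')"
    if "U \<subseteq> {x}" "U' \<subseteq> {y}" for U U'
  proof -
    let ?U = "U \<union> U'"
    have i: "?U \<inter> {y} = U' \<inter> {y}" "?U \<inter> {x} = U \<inter> {x}" using that assms(4) by auto
    have "{y} \<inter> {x} = {}" using assms(4) by simp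
    from minor_Un[OF this, of ?U N] circle_free_Un[OF this, of ?U N]
    have "minor {y} ?U (minor {x} ?U N) = minor {x, y} ?U N"
      "circle_free {x, y} ?U N \<longleftrightarrow> circle_free {x} ?U N \<and> circle_free {y} ?U (minor {x} ?U N)"
      by (simp_all add: insert_commute)
    then have "minor {y} U' (minor {x} U N) = minor {x, y} ?U N"
      "circle_free {x, y} ?U N \<longleftrightarrow> circle_free {x} U N \<and> circle_free {y} U' (minor {x} U N)"
      by (simp_all only: minor_cong[OF i(1)] minor_cong[OF i(2)] circle_free_cong[OF i(1)] circle_free_cong[OF i(2)])
    then show ?thesis by (simp add: t_def)
  qed
  have f: "finite (insert y S)" "x \<notin> insert y S" using assms by auto
  have "state_sum N (insert x (insert y S)) = (t ({} \<union> {}) + t ({} \<union> {y})) + (t ({x} \<union> {}) + t ({x} \<union> {y}))"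
    unfolding state_sum_insert[OF f] state_sum_insert[OF assms(1,3)]
    by (subst t[symmetric], simp, simp)+ simp
  also have "\<dots> = (\<Sum>T\<in>{{}, {y}, {x}, {x, y}}. t T)"
  proof -
    have "{} \<noteq> {y}" "{} \<noteq> {x}" "{} \<noteq> {x, y}" "{y} \<noteq> {x}" "{y} \<noteq> {x, y}" "{x} \<noteq> {x, y}" using assms(4) by auto
    then show ?thesis by (simp add: add.assoc insert_commute)
  qed
  finally show ?thesis by (simp add: t_def)
qed

lemma chain_add_self [simp]: "c + c = (0 :: chain)"
  by (rule poly_mapping_eqI) (simp add: lookup_add)

text \<open>
  Adding the vector with value \<open>a\<close> at \<open>x, y\<close> moves a value
  \<open>a\<close> from one of the two vertices to the other, and orthogonality excludes the
  value \<open>b\<close>. So the two mixed states give the same space.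
\<close>

lemma double_point_mixed:
  assumes N: "graphic V N" and xy: "x \<noteq> y" and a: "two_point x (1, 0) y (1, 0) \<in> N"
    and uv: "u = x \<and> v = y \<or> u = y \<and> v = x"
  shows "minor {x, y} {u} N \<subseteq> minor {x, y} {v} N" "circle_free {x, y} {v} N \<Longrightarrow> circle_free {x, y} {u} N"
proof -
  define A where "A = two_point x (1,0) y (1,0)"
  have A: "A x = (1,0)" "A y = (1,0)" "erase {x, y} A = 0" using xy by (simp_all add: A_def erase_two_point)
  have key: "\<exists>z'\<in>N. compatible {x, y} {v} z' \<and> erase {x, y} z' = erase {x, y} z \<and> (z \<noteq> 0 \<longrightarrow> z' \<noteq> 0)"
    if z: "z \<in> N" "compatible {x, y} {u} z" for z
  proof -
    have "z u = 0 \<or> z u = (0, 1)" "z v = 0 \<or> z v = (1, 0)"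
      using z(2) uv xy by (auto simp: compatible_def state_dir_def)
    moreover have "snd (z u) = snd (z v)" using graphic_orth[OF N xy a z(1)] uv by auto
    ultimately have uz: "z u = 0" "z v = 0 \<or> z v = (1, 0)" by auto
    show ?thesis
    proof (cases "z v = 0")
      case True
      then have "compatible {x, y} {v} z" using uz(1) uv by (auto simp: compatible_def)
      with z show ?thesis by blast
    next
      case False
      then have zv: "z v = (1, 0)" using uz by simp
      have Auv: "A u = (1, 0)" "A v = (1, 0)" using A uv by auto
      have zA: "(z + A) u = (1, 0)" "(z + A) v = 0" using zv uz Auv by (simp_all add: zero_prod_def)
      then have "compatible {x, y} {v} (z + A)" using uv xy by (auto simp: compatible_def state_dir_def)
      moreover have "z + A \<noteq> 0" using zA(1) by (metis pair_nonzero(1) zero_fun_apply)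
      moreover have "z + A \<in> N" using graphic_add[OF N z(1) a] by (simp add: A_def)
      moreover have "erase {x, y} (z + A) = erase {x, y} z" by (simp add: erase_add A(3))
      ultimately show ?thesis by blast
    qed
  qed
  show "minor {x, y} {u} N \<subseteq> minor {x, y} {v} N"
  proof
    fix w assume "w \<in> minor {x, y} {u} N"
    then obtain z where "z \<in> N" "compatible {x, y} {u} z" "w = erase {x, y} z" by (auto simp: in_minor)
    with key show "w \<in> minor {x, y} {v} N" unfolding in_minor by metis
  qed
  show "circle_free {x, y} {u} N" if n: "circle_free {x, y} {v} N" unfolding circle_free_def
  proof (intro ballI impI)
    fix z assume "z \<in> N" "compatible {x, y} {u} z" "erase {x, y} z = 0"
    with key n show "z = 0" unfolding circle_free_def by metis
  qed
qed

text \<open>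
  Of the four states at \<open>x, y\<close>, the one with \<open>aa\<close> is followed by the
  given vector, the mixed ones cancel modulo two, and the one with \<open>bb\<close> remains.
\<close>

lemma state_sum_double_point_inside:
  assumes N: "graphic V N" and xy: "x \<noteq> y" and a: "two_point x (1, 0) y (1, 0) \<in> N"
    and S: "finite S" "x \<notin> S" "y \<notin> S"
  shows "state_sum N (insert x (insert y S)) = (if two_point x (0, 1) y (0, 1) \<in> N then 0 else state_sum (minor {x, y} {x, y} N) S)"
proof -
  define b where "b = two_point x (0, 1) y (0, 1)"
  have "compatible {x, y} {} (two_point x (1,0) y (1,0))"
    using xy by (simp add: compatible_def state_dir_def)
  moreover have "two_point x (1,0) y (1,0) \<noteq> 0" by (rule two_point_nonzero) simp
  ultimately have "\<not> circle_free {x, y} {} N" using a erase_two_point unfolding circle_free_def by blast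
  moreover have "minor {x, y} {x} N = minor {x, y} {y} N" "circle_free {x, y} {x} N \<longleftrightarrow> circle_free {x, y} {y} N"
    using double_point_mixed[OF N xy a] by blast+
  moreover have "circle_free {x, y} {x, y} N \<longleftrightarrow> b \<notin> N"
  proof
    assume n: "circle_free {x, y} {x, y} N"
    have "compatible {x, y} {x, y} b" "erase {x, y} b = 0"
      using xy by (simp_all add: b_def compatible_def state_dir_def erase_two_point)
    moreover have "b \<noteq> 0" unfolding b_def by (rule two_point_nonzero) simp
    ultimately show "b \<notin> N" using n unfolding circle_free_def by blast
  next
    assume bN: "b \<notin> N"
    show "circle_free {x, y} {x, y} N" unfolding circle_free_def
    proof (intro ballI impI)
      fix z assume z: "z \<in> N" "compatible {x, y} {x, y} z" "erase {x, y} z = 0"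
      have "z x = 0 \<or> z x = (0, 1)" "z y = 0 \<or> z y = (0, 1)" using z(2) by (simp_all add: compatible_def state_dir_def)
      then have "z x = 0 \<and> z y = 0 \<or> z x = (0, 1) \<and> z y = (0, 1)"
        using graphic_orth[OF N xy a z(1)] by (rule eq_second_coordinate)
      moreover have "z = two_point x (z x) y (z y)" by (rule two_point_eqI[OF xy z(3)]) simp_all
      ultimately have "z = two_point x 0 y 0" using z(1) bN unfolding b_def by metis
      then show "z = 0" by simp
    qed
  qed
  moreover have "{} \<noteq> {y}" "{} \<noteq> {x}" "{} \<noteq> {x, y}" "{y} \<noteq> {x}" "{y} \<noteq> {x, y}" "{x} \<noteq> {x, y}" using xy by auto
  ultimately show ?thesis unfolding state_sum_insert2[OF S xy] by (simp add: b_def add.assoc[symmetric])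
qed

lemma state_sum_double_point:
  assumes N: "graphic V N" and "x \<noteq> y" and a: "two_point x (1, 0) y (1, 0) \<in> N"
    and S: "S \<subseteq> V" "finite S" and xy: "x \<in> S \<longleftrightarrow> y \<in> S"
  shows "state_sum N S = (if two_point x (0, 1) y (0, 1) \<in> N then 0 else state_sum (minor {x, y} {x, y} N) (S - {x, y}))"
proof (cases "x \<in> S")
  case True
  have "S = insert x (insert y (S - {x, y}))" using True xy by auto
  then show ?thesis using state_sum_double_point_inside[OF N assms(2) a, of "S - {x, y}"] S(2) by simp
next
  case False
  then show ?thesis using state_sum_double_point_outside[OF N assms(2) a S] xy by simp
qed


section \<open>Smoothings as a state sum\<close>

lemma circle_free_delete: "circle_free S S (lagrangian G)"
  unfolding circle_free_def
proof (intro ballI impI)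
  fix z assume z: "z \<in> lagrangian G" "compatible S S z" "erase S z = 0"
  have "fst (z j) = 0" for j
    using z(2,3) by (cases "j \<in> S") (auto simp: compatible_def state_dir_def erase_eq_0_iff)
  with z(1) show "z = 0" by (rule lagrangian_fst_0)
qed

definition smoothing_sum :: "nat list \<Rightarrow> labelled_free_graph \<Rightarrow> chain" where
  "smoothing_sum vs \<G> = (\<Sum>s\<in>#smoothings_along vs \<G>. canonical (iso_class s))"

lemma smoothing_sum_Cons: "smoothing_sum (v # vs) \<G> = (\<Sum>\<K>\<in>#smoothings_at v \<G>. smoothing_sum vs \<K>)"
proof -
  have "(\<Sum>s\<in>#(\<Sum>\<K>\<in>#A. smoothings_along vs \<K>). canonical (iso_class s)) = (\<Sum>\<K>\<in>#A. smoothing_sum vs \<K>)" for A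
    by (induction A) (simp_all add: smoothing_sum_def)
  then show ?thesis by (simp add: smoothing_sum_def)
qed

text \<open>
  A move at \<open>v\<close> exists in some representative: if \<open>v\<close> has framing
  \<open>0\<close> and its neighbour \<open>k\<close> has framing \<open>1\<close>, a move at
  \<open>k\<close> provides framing \<open>1\<close> at \<open>v\<close>.
\<close>

lemma smoothings_at_nonisolated:
  assumes "H \<in> representatives \<G>" "framing H v = 1 \<or> nbhd H v \<noteq> {}"
  obtains H1 H2 where "H1 \<in> representatives \<G>" "H2 \<in> representatives \<G>" "free_move_at v H1 H2"
    "smoothings_at v \<G> = {#free_graph_of (delete_vertices {v} H1), free_graph_of (delete_vertices {v} H2)#}"
proof -
  let ?P = "\<lambda>(H1, H2). H1 \<in> representatives \<G> \<and> H2 \<in> representatives \<G> \<and> free_move_at v H1 H2"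
  have ext: "H' \<in> representatives \<G>" if "H \<in> representatives \<G>" "free_equiv H H'" for H H'
    using that unfolding representatives_def mem_Collect_eq by (metis free_graph_of_eq_iff)
  have "\<exists>p. ?P p"
  proof -
    obtain k where k: "entry H v k = 1"
      using assms(2) by (auto simp: framing_entry nbhd_def adj_entry)
    show ?thesis
    proof (cases "entry H v v = 1")
      case True
      then obtain H' where "omega4'_at v H H'" by (rule omega4'_exists)
      then have "free_move_at v H H'" by (rule free_move_at_simps)
      then have "?P (H, H')" using assms(1) ext free_equiv_move by blast
      then show ?thesis by blast
    next
      case v0: False
      then have vk: "v \<noteq> k" using k by auto
      show ?thesis
      proof (cases "entry H k k = 1")
        case False
        obtain H' where "omega4_at v k H H'" by (rule omega4_exists[OF k vk v0 False])
        then have "free_move_at v H H'" by (rule free_move_at_simps)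
        then have "?P (H, H')" using assms(1) ext free_equiv_move by blast
        then show ?thesis by blast
      next
        case True
        then obtain H' where H': "omega4'_at k H H'" by (rule omega4'_exists)
        have "entry H' v v = 1"
        proof -
          have "v \<in> vertices H" using entry_outside(1)[of v H k] k by fastforce
          moreover have "v \<in> nbhd H k" using k vk by (simp add: nbhd_def adj_entry entry_sym[of H k v])
          ultimately have "framing H' v = framing H v + 1" using H' by (auto simp: omega4'_at_def)
          then show ?thesis using v0 by (simp add: framing_entry)
        qed
        then obtain H'' where "omega4'_at v H' H''" by (rule omega4'_exists)
        then have m: "free_move_at v H' H''" by (rule free_move_at_simps)
        have "H' \<in> representatives \<G>" using ext[OF assms(1)] H' free_move_at_simps(2) free_equiv_move by blast
        then have "?P (H', H'')" using m ext free_equiv_move by blast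
        then show ?thesis by blast
      qed
    qed
  qed
  then have "?P (SOME p. ?P p)" by (rule someI_ex)
  moreover obtain H1 H2 where H: "(SOME p. ?P p) = (H1, H2)" by (cases "SOME p. ?P p")
  ultimately have P: "H1 \<in> representatives \<G>" "H2 \<in> representatives \<G>" "free_move_at v H1 H2" by simp_all
  have "smoothings_at v \<G> = {#free_graph_of (delete_vertices {v} H1), free_graph_of (delete_vertices {v} H2)#}"
    unfolding smoothings_at_def using assms H by auto
  with P that show thesis by blast
qed

text \<open>
  The move interchanges the two directions at \<open>v\<close>, so deleting \<open>v\<close>
  before and after it yields the two smoothings.
\<close>

lemma state_sum_move:
  assumes H: "free_move_at v H1 H2" and S: "S \<subseteq> vertices H1 - {v}"
  shows "state_sum (lagrangian H1) (insert v S) = state_sum (lagrangian (delete_vertices {v} H1)) S + state_sum (lagrangian (delete_vertices {v} H2)) S"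
proof -
  obtain F where F: "lagrangian H2 = flip F ` lagrangian H1" "v \<in> F" "F \<subseteq> vertices H1" "vertices H2 = vertices H1"
    by (rule lagrangian_free_move_at[OF H])
  have fS: "finite S" using S finite_subset[OF _ finite_vertices] by blast
  have v: "v \<in> vertices H1" using F by blast
  have "circle_free {v} {} (lagrangian H1)"
    using circle_free_delete[of "{v}" H2] unfolding F(1) minor_flip_in(3)[OF F(2)] .
  moreover have "minor {v} {v} (lagrangian H1) = lagrangian (delete_vertices {v} H1)"
    using v by (intro minor_lagrangian) simp
  moreover have "state_sum (minor {v} {} (lagrangian H1)) S = state_sum (lagrangian (delete_vertices {v} H2)) S"
  proof -
    have "lagrangian (delete_vertices {v} H2) = flip F ` minor {v} {} (lagrangian H1)"
      using minor_lagrangian[of "{v}" H2] v F(4) unfolding F(1) minor_flip_in(1)[OF F(2)] by simp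
    then show ?thesis using state_sum_flip[OF fS] by simp
  qed
  ultimately show ?thesis using S fS circle_free_delete[of "{v}" H1]
    by (subst state_sum_insert) (auto simp: add.commute)
qed

lemma state_sum_isolated:
  assumes "v \<in> vertices H" "\<And>k. entry H v k = 0" and S: "S \<subseteq> vertices H - {v}"
  shows "state_sum (lagrangian H) (insert v S) = state_sum (lagrangian (delete_vertices {v} H)) S"
proof -
  have fS: "finite S" using S finite_subset[OF _ finite_vertices] by blast
  have r: "vertex_row H v = 0(v := (1, 0))" using assms(2) by (simp add: vertex_row_isolated_iff)
  have "\<not> circle_free {v} {} (lagrangian H)"
  proof
    assume n: "circle_free {v} {} (lagrangian H)"
    have "compatible {v} {} (vertex_row H v)" "erase {v} (vertex_row H v) = 0"
      by (simp_all add: r compatible_def state_dir_def erase_eq_0_iff)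
    then have "vertex_row H v = 0" using n vertex_row_in_lagrangian[OF assms(1)] unfolding circle_free_def by blast
    then have "vertex_row H v v = 0" by simp
    then show False by (simp add: vertex_row_def zero_prod_def)
  qed
  moreover have "minor {v} {v} (lagrangian H) = lagrangian (delete_vertices {v} H)"
    using assms(1) by (intro minor_lagrangian) simp
  ultimately show ?thesis using S fS circle_free_delete[of "{v}" H] by (subst state_sum_insert) auto
qed

text \<open>
  The second smoothing of an isolated vertex contributes nothing, whatever happens at the other
  vertices, because the isolated edge persists.
\<close>

lemma state_sum_attach_leaf:
  assumes "v \<in> vertices H" "\<And>k. entry H v k = 0" "u \<notin> vertices H" "S \<subseteq> vertices H - {v}"
  shows "state_sum (lagrangian (attach_leaf v u H)) S = 0"
proof -
  let ?H = "attach_leaf v u H"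
  have uv: "v \<noteq> u" using assms by auto
  have V: "vertices ?H = insert u (vertices H)" by (simp add: attach_leaf_def)
  have fS: "finite S" using assms(4) finite_subset[OF _ finite_vertices] by blast
  have nv: "\<not> adj H v k" "\<not> adj H k v" "\<not> adj H u k" "\<not> adj H k u" for k
    using assms(2)[of k] assms(3) by (auto simp: adj_entry entry_sym[of H k v] entry_outside)
  have fr: "framing H v = 0" "framing H u = 0" using assms(2)[of v] assms(3) by (auto simp: framing_entry entry_outside)
  have am: "entry ?H i v = of_bool (i = u)" "entry ?H i u = of_bool (i = v)" for i
    using assms(1) uv nv fr by (auto simp: attach_leaf_def entry_mk_graph)
  have "vertex_row ?H v = two_point v (1, 0) u (0, 1)" "vertex_row ?H u = two_point v (0, 1) u (1, 0)"
    using uv by (auto simp: vertex_row_def am two_point_def fun_eq_iff zero_prod_def)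
  moreover have "vertex_row ?H v \<in> lagrangian ?H" "vertex_row ?H u \<in> lagrangian ?H" using assms(1) V by (auto intro: vertex_row_in_lagrangian)
  ultimately have "two_point v (1, 0) u (1, 0) \<in> flip {u} ` lagrangian ?H" "two_point v (0, 1) u (0, 1) \<in> flip {u} ` lagrangian ?H"
    using uv by (simp_all add: in_flip_image flip_two_point)
  then have "state_sum (flip {u} ` lagrangian ?H) S = 0"
    using assms(3,4) uv V fS by (intro state_sum_isolated_edge[OF graphic_flip[OF graphic_lagrangian] uv]) auto
  then show ?thesis by (simp add: state_sum_flip[OF fS])
qed

text \<open>
  By induction on the list; the choices made in \<open>smoothings_at\<close> do not matter
  because the right-hand side is invariant under \<open>flip\<close>.
\<close>

lemma smoothings_state_sum:
  assumes "distinct vs" "set vs \<subseteq> vertices G"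
  shows "smoothing_sum vs (free_graph_of G) = state_sum (lagrangian G) (set vs)"
  using assms
proof (induction vs arbitrary: G)
  case Nil
  have "class_chain (lagrangian G) = canonical (free_class G)" using class_chain_lagrangian[of "{}" G] by simp
  then show ?case by (simp add: state_sum_empty smoothing_sum_def free_class_def)
next
  case (Cons v vs)
  have S: "set vs \<subseteq> vertices G - {v}" and v: "v \<in> vertices G" and d: "distinct vs" using Cons.prems by auto
  have rep_invariant: "state_sum (lagrangian H) (set (v # vs)) = state_sum (lagrangian G) (set (v # vs))" "vertices H = vertices G"
    if "H \<in> representatives (free_graph_of G)" for H
  proof -
    from that have "free_equiv G H" by (simp add: in_representatives)
    then obtain F where "lagrangian H = flip F ` lagrangian G" "vertices H = vertices G" unfolding free_equiv_iff_lagrangian by blast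
    then show "state_sum (lagrangian H) (set (v # vs)) = state_sum (lagrangian G) (set (v # vs))" "vertices H = vertices G"
      by (simp_all add: state_sum_flip)
  qed
  show ?case
  proof (cases "\<exists>H\<in>representatives (free_graph_of G). framing H v = 1 \<or> nbhd H v \<noteq> {}")
    case True
    then obtain H where "H \<in> representatives (free_graph_of G)" "framing H v = 1 \<or> nbhd H v \<noteq> {}" by blast
    then obtain H1 H2 where H: "H1 \<in> representatives (free_graph_of G)" "H2 \<in> representatives (free_graph_of G)"
      "free_move_at v H1 H2" and sm: "smoothings_at v (free_graph_of G) =
        {#free_graph_of (delete_vertices {v} H1), free_graph_of (delete_vertices {v} H2)#}"
      by (rule smoothings_at_nonisolated)
    have "smoothing_sum (v # vs) (free_graph_of G) =
      state_sum (lagrangian (delete_vertices {v} H1)) (set vs) + state_sum (lagrangian (delete_vertices {v} H2)) (set vs)"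
      unfolding smoothing_sum_Cons sm using Cons.IH[OF d] S rep_invariant(2)[OF H(1)] rep_invariant(2)[OF H(2)] by simp
    also have "\<dots> = state_sum (lagrangian H1) (set (v # vs))"
      using state_sum_move[OF H(3)] S rep_invariant(2)[OF H(1)] by simp
    finally show ?thesis using rep_invariant(1)[OF H(1)] by simp
  next
    case False
    define H where "H = some_rep (free_graph_of G)"
    define u where "u = (SOME u. u \<notin> vertices H)"
    have Hr: "H \<in> representatives (free_graph_of G)" unfolding H_def by (rule representatives_nonempty)
    have u: "u \<notin> vertices H" unfolding u_def
      by (rule someI_ex) (rule ex_new_if_finite[OF infinite_UNIV_nat finite_vertices])
    have V: "vertices H = vertices G" by (rule rep_invariant(2)[OF Hr])
    have "framing H v \<noteq> 1" "nbhd H v = {}" using False Hr by blast+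
    then have iso: "entry H v k = 0" for k by (auto simp: entry_def nbhd_def)
    have sm: "smoothings_at v (free_graph_of G) =
      {#free_graph_of (delete_vertices {v} H), free_graph_of (attach_leaf v u H)#}"
      unfolding smoothings_at_def using False by (simp add: H_def u_def Let_def)
    have Vl: "vertices (attach_leaf v u H) = insert u (vertices H)" by (simp add: attach_leaf_def)
    have "smoothing_sum (v # vs) (free_graph_of G) =
      state_sum (lagrangian (delete_vertices {v} H)) (set vs) + state_sum (lagrangian (attach_leaf v u H)) (set vs)"
      unfolding smoothing_sum_Cons sm using Cons.IH[OF d, of "delete_vertices {v} H"] Cons.IH[OF d, of "attach_leaf v u H"] S V Vl
      by auto
    also have "\<dots> = state_sum (lagrangian (delete_vertices {v} H)) (set vs)"
      using state_sum_attach_leaf[of v H u "set vs"] v V iso u S by simp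
    also have "\<dots> = state_sum (lagrangian H) (set (v # vs))"
      using state_sum_isolated[of v H "set vs"] v V iso S by simp
    finally show ?thesis using rep_invariant(1)[OF Hr] by simp
  qed
qed


section \<open>Isomorphisms\<close>

lemma free_class_eqI_iso:
  assumes "graph_iso G H"
  shows "free_class G = free_class H"
proof -
  have "G \<in> representatives (free_graph_of G)" "H \<in> representatives (free_graph_of H)"
    by (simp_all add: representatives_def)
  then show ?thesis unfolding free_class_def iso_class_def free_graph.abs_eq_iff
    using assms by (blast intro: r_into_equivclp)
qed

definition relabel :: "(nat \<Rightarrow> nat) \<Rightarrow> kvec set \<Rightarrow> kvec set" where
  "relabel \<pi> L = (\<lambda>z. z \<circ> \<pi>) ` L"

definition relabel_graph :: "(nat \<Rightarrow> nat) \<Rightarrow> framed_graph \<Rightarrow> framed_graph" where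
  "relabel_graph \<pi> G = mk_graph (\<pi> -` vertices G) (\<lambda>x y. adj G (\<pi> x) (\<pi> y)) (\<lambda>x. framing G (\<pi> x))"

lemma relabel_graph:
  assumes "bij \<pi>"
  shows "vertices (relabel_graph \<pi> G) = \<pi> -` vertices G" "entry (relabel_graph \<pi> G) i j = entry G (\<pi> i) (\<pi> j)"
    "adj (relabel_graph \<pi> G) i j \<longleftrightarrow> adj G (\<pi> i) (\<pi> j)" "framing (relabel_graph \<pi> G) i = framing G (\<pi> i)"
proof -
  have f: "finite (\<pi> -` vertices G)" using assms by (simp add: bij_is_inj finite_vimageI)
  have i: "\<pi> x = \<pi> y \<longleftrightarrow> x = y" for x y using assms by (metis bij_pointE)
  show "vertices (relabel_graph \<pi> G) = \<pi> -` vertices G" by (simp add: relabel_graph_def f)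
  show a: "adj (relabel_graph \<pi> G) i j \<longleftrightarrow> adj G (\<pi> i) (\<pi> j)" for i j
    by (auto simp: relabel_graph_def f dest: adjD)
  show b: "framing (relabel_graph \<pi> G) i = framing G (\<pi> i)" for i
    by (simp add: relabel_graph_def f framing_outside)
  show "entry (relabel_graph \<pi> G) i j = entry G (\<pi> i) (\<pi> j)" by (simp add: entry_def a b i)
qed

lemma lagrangian_relabel_graph:
  assumes "bij \<pi>"
  shows "lagrangian (relabel_graph \<pi> G) = relabel \<pi> (lagrangian G)"
proof -
  have bb: "bij_betw \<pi> (\<pi> -` vertices G) (vertices G)"
    using assms by (auto simp: bij_betw_def bij_def inj_on_def surj_def image_iff)
  have key: "w \<in> lagrangian (relabel_graph \<pi> G) \<longleftrightarrow> z \<in> lagrangian G" if w: "w = z \<circ> \<pi>" for w z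
  proof -
    have s: "(\<Sum>j\<in>\<pi> -` vertices G. entry G (\<pi> i) (\<pi> j) * fst (z (\<pi> j))) = (\<Sum>j\<in>vertices G. entry G (\<pi> i) j * fst (z j))" for i
      by (rule sum.reindex_bij_betw[OF bb])
    have sur: "(\<forall>j. P (\<pi> j)) \<longleftrightarrow> (\<forall>j. P j)" for P using assms by (metis bij_pointE)
    show ?thesis unfolding lagrangian_def mem_Collect_eq relabel_graph[OF assms] w
      using sur[of "\<lambda>j. j \<notin> vertices G \<longrightarrow> z j = 0"] sur[of "\<lambda>i. i \<in> vertices G \<longrightarrow> snd (z i) = (\<Sum>j\<in>vertices G. entry G i j * fst (z j))"]
      by (simp add: s Ball_def)
  qed
  show ?thesis
  proof (intro Set.set_eqI iffI)
    fix w assume w: "w \<in> lagrangian (relabel_graph \<pi> G)"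
    have e: "w = (w \<circ> inv_into UNIV \<pi>) \<circ> \<pi>" using assms by (simp add: fun_eq_iff bij_is_inj)
    with key[OF e] w show "w \<in> relabel \<pi> (lagrangian G)" unfolding relabel_def by blast
  next
    fix w assume "w \<in> relabel \<pi> (lagrangian G)"
    then show "w \<in> lagrangian (relabel_graph \<pi> G)" using key by (auto simp: relabel_def)
  qed
qed

lemma relabel_flip: "relabel \<pi> (flip F ` L) = flip (\<pi> -` F) ` relabel \<pi> L"
proof -
  have "flip F z \<circ> \<pi> = flip (\<pi> -` F) (z \<circ> \<pi>)" for z by (auto simp: flip_def)
  then show ?thesis by (simp add: relabel_def image_image)
qed

lemma graph_iso_relabel_graph: "bij \<pi> \<Longrightarrow> graph_iso (relabel_graph \<pi> G) G"
  unfolding graph_iso_def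
  by (rule exI[of _ \<pi>]) (auto simp: relabel_graph bij_betw_def bij_def inj_on_def surj_def image_iff)

lemma class_chain_relabel:
  assumes "bij \<pi>" "graphic V L"
  shows "class_chain (relabel \<pi> L) = class_chain L"
proof -
  obtain G F where G: "L = flip F ` lagrangian G" using assms by (auto simp: graphic_def)
  have "class_chain (relabel \<pi> L) = canonical (free_class (relabel_graph \<pi> G))"
    unfolding G relabel_flip lagrangian_relabel_graph[OF assms(1), symmetric] by (rule class_chain_lagrangian)
  also have "\<dots> = canonical (free_class G)" using free_class_eqI_iso[OF graph_iso_relabel_graph[OF assms(1)]] by simp
  finally show ?thesis by (simp add: G class_chain_lagrangian)
qed

lemma state_sum_relabel:
  assumes \<pi>: "bij \<pi>" and L: "graphic V L" "S \<subseteq> V" "finite S"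
  shows "state_sum (relabel \<pi> L) (\<pi> -` S) = state_sum L S"
proof -
  have sur: "(\<forall>j. P (\<pi> j)) \<longleftrightarrow> (\<forall>j. P j)" for P using \<pi> by (metis bij_pointE)
  have t: "compatible (\<pi> -` S) (\<pi> -` T) (z \<circ> \<pi>) \<longleftrightarrow> compatible S T z" for T z
    using sur[of "\<lambda>v. v \<in> S \<longrightarrow> z v = 0 \<or> z v = state_dir T v"] by (simp add: compatible_def Ball_def state_dir_def)
  have o: "erase (\<pi> -` S) (z \<circ> \<pi>) = erase S z \<circ> \<pi>" for z by (auto simp: erase_def)
  have z: "z \<circ> \<pi> = 0 \<longleftrightarrow> z = 0" for z :: kvec using sur[of "\<lambda>j. z j = 0"] by (simp add: fun_eq_iff)
  have m: "minor (\<pi> -` S) (\<pi> -` T) (relabel \<pi> L) = relabel \<pi> (minor S T L)" for T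
  proof -
    have "{z \<in> relabel \<pi> L. compatible (\<pi> -` S) (\<pi> -` T) z} = (\<lambda>z. z \<circ> \<pi>) ` {z \<in> L. compatible S T z}"
      using t by (auto simp: relabel_def)
    then show ?thesis by (simp add: minor_def relabel_def image_image o)
  qed
  have n: "circle_free (\<pi> -` S) (\<pi> -` T) (relabel \<pi> L) \<longleftrightarrow> circle_free S T L" for T
    by (simp add: circle_free_def relabel_def t o z)
  have e: "\<pi> -` \<pi> ` T = T" "\<pi> ` \<pi> -` T = T" for T
    using \<pi> by (simp_all add: bij_is_inj bij_is_surj inj_vimage_image_eq surj_image_vimage_eq)
  have "state_sum (relabel \<pi> L) (\<pi> -` S) = (\<Sum>T\<in>Pow S. if circle_free (\<pi> -` S) (\<pi> -` T) (relabel \<pi> L) then class_chain (minor (\<pi> -` S) (\<pi> -` T) (relabel \<pi> L)) else 0)"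
    unfolding state_sum_def by (rule sum.reindex_bij_witness[of _ "\<lambda>T. \<pi> -` T" "\<lambda>T. \<pi> ` T"]) (use e \<pi> in \<open>auto simp: bij_is_surj\<close>)
  also have "\<dots> = state_sum L S" unfolding state_sum_def n m
    by (intro sum.cong refl) (simp add: class_chain_relabel[OF \<pi> graphic_minor[OF L]])
  finally show ?thesis .
qed

lemma bij_extension:
  fixes p :: "nat \<Rightarrow> nat"
  assumes "finite A" "bij_betw p A B"
  obtains \<pi> where "bij \<pi>" "\<And>x. x \<in> A \<Longrightarrow> \<pi> x = p x"
proof -
  have fB: "finite B" and c: "card A = card B" using assms bij_betw_finite bij_betw_same_card by blast+
  have "card (B - A) = card (A - B)"
    using c assms(1) fB by (metis card_Diff_subset_Int Int_commute finite_Int)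
  then obtain q where q: "bij_betw q (B - A) (A - B)"
    using assms(1) fB by (metis finite_Diff finite_same_card_bij)
  define r where "r x = (if x \<in> A then p x else if x \<in> B then q x else x)" for x
  have 1: "bij_betw r A B" using assms(2) by (rule bij_betw_cong[THEN iffD1, rotated]) (simp add: r_def)
  have 2: "bij_betw r (B - A) (A - B)" using q by (rule bij_betw_cong[THEN iffD1, rotated]) (simp add: r_def)
  have 3: "bij_betw r (- (A \<union> B)) (- (A \<union> B))"
    using bij_betw_id[of "- (A \<union> B)"] by (rule bij_betw_cong[THEN iffD1, rotated]) (auto simp: r_def)
  have "bij_betw r (A \<union> (B - A)) (B \<union> (A - B))" by (rule bij_betw_combine[OF 1 2]) auto
  then have "bij_betw r (A \<union> (B - A) \<union> - (A \<union> B)) (B \<union> (A - B) \<union> - (A \<union> B))"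
    by (rule bij_betw_combine[OF _ 3]) auto
  moreover have "A \<union> (B - A) \<union> - (A \<union> B) = UNIV" "B \<union> (A - B) \<union> - (A \<union> B) = UNIV" by auto
  ultimately have "bij r" by simp
  then show thesis using that[of r] by (simp add: r_def)
qed

lemma graph_iso_obtain:
  assumes "graph_iso G H"
  obtains \<pi> where "bij \<pi>" "G = relabel_graph \<pi> H"
proof -
  obtain p where p: "bij_betw p (vertices G) (vertices H)" "\<forall>x\<in>vertices G. framing H (p x) = framing G x"
    "\<forall>x\<in>vertices G. \<forall>y\<in>vertices G. adj H (p x) (p y) \<longleftrightarrow> adj G x y"
    using assms unfolding graph_iso_def by blast
  obtain \<pi> where \<pi>: "bij \<pi>" "\<And>x. x \<in> vertices G \<Longrightarrow> \<pi> x = p x" by (rule bij_extension[OF finite_vertices p(1)]) blast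
  have im: "\<pi> ` vertices G = vertices H" using p(1) \<pi>(2) by (auto simp: bij_betw_def)
  have V: "\<pi> -` vertices H = vertices G"
    unfolding im[symmetric] using \<pi>(1) by (simp add: bij_is_inj inj_vimage_image_eq)
  have out: "x \<notin> vertices G \<Longrightarrow> \<pi> x \<notin> vertices H" for x using V by blast
  have "G = relabel_graph \<pi> H"
  proof (rule framed_graph_eqI)
    show "vertices G = vertices (relabel_graph \<pi> H)" by (simp add: relabel_graph[OF \<pi>(1)] V)
    show "adj G x y = adj (relabel_graph \<pi> H) x y" for x y
    proof (cases "x \<in> vertices G \<and> y \<in> vertices G")
      case True then show ?thesis using p(3) \<pi>(2) by (simp add: relabel_graph[OF \<pi>(1)])
    next
      case False then show ?thesis using out adjD unfolding relabel_graph(3)[OF \<pi>(1)] by blast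
    qed
    show "framing G x = framing (relabel_graph \<pi> H) x" for x
      using p(2) \<pi>(2) out by (cases "x \<in> vertices G") (simp_all add: relabel_graph[OF \<pi>(1)] framing_outside)
  qed
  with \<pi>(1) that show thesis by blast
qed


section \<open>Parity\<close>

text \<open>
  Away from \<open>v\<close> only the straight transit \<open>c\<close> is used.
\<close>

definition straight_off :: "nat \<Rightarrow> kvec \<Rightarrow> bool" where
  "straight_off v z \<longleftrightarrow> (\<forall>j. j \<noteq> v \<longrightarrow> fst (z j) = snd (z j))"

definition straight :: "kvec \<Rightarrow> bool" where
  "straight z \<longleftrightarrow> (\<forall>j. fst (z j) = snd (z j))"

lemma straight_iff: "straight z \<longleftrightarrow> straight_off v z \<and> fst (z v) = snd (z v)"
  by (auto simp: straight_def straight_off_def)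

text \<open>
  In corank one a single nonzero vector has all values in \<open>{0, c}\<close>; its support
  consists of the odd vertices.
\<close>

definition even_link :: "nat set \<Rightarrow> kvec set \<Rightarrow> nat set" where
  "even_link V L = {v \<in> V. \<forall>z\<in>L. straight z \<longrightarrow> z v = 0}"

text \<open>
  In corank zero \<open>m\<close> is unique, and its first coordinates outside \<open>v\<close>
  are the off-diagonal entries in the row of \<open>v\<close> in the inverse of \<open>A +
  E\<close>. So their sum is the degree of \<open>v\<close> modulo two.
\<close>

definition even_knot :: "nat set \<Rightarrow> kvec set \<Rightarrow> nat set" where
  "even_knot V L = {v \<in> V. \<exists>m\<in>L. straight_off v m \<and> fst (m v) \<noteq> snd (m v) \<and> (\<Sum>j\<in>V - {v}. fst (m j)) = 0}"

text \<open>
  Every vector that is relevant for the parity of \<open>v\<close> in \<open>N\<close> has a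
  counterpart for \<open>v'\<close> in \<open>M\<close>. This covers both parities at once, so
  that each move needs to be examined only once.
\<close>

definition parity_transfer :: "nat set \<Rightarrow> kvec set \<Rightarrow> nat \<Rightarrow> nat set \<Rightarrow> kvec set \<Rightarrow> nat \<Rightarrow> bool" where
  "parity_transfer V N v V' M v' \<longleftrightarrow> (\<forall>z\<in>N. straight_off v z \<longrightarrow> (\<exists>w\<in>M. straight_off v' w \<and>
     (fst (z v) = snd (z v) \<longrightarrow> w v' = z v) \<and> (fst (z v) \<noteq> snd (z v) \<longrightarrow> fst (w v') \<noteq> snd (w v')) \<and>
     (\<Sum>j\<in>V' - {v'}. fst (w j)) = (\<Sum>j\<in>V - {v}. fst (z j))))"

lemma parity_transferI:
  assumes "\<And>z. z \<in> N \<Longrightarrow> straight_off v z \<Longrightarrow> \<exists>w\<in>M. straight_off v' w \<and>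
     (fst (z v) = snd (z v) \<longrightarrow> w v' = z v) \<and> (fst (z v) \<noteq> snd (z v) \<longrightarrow> fst (w v') \<noteq> snd (w v')) \<and>
     (\<Sum>j\<in>V' - {v'}. fst (w j)) = (\<Sum>j\<in>V - {v}. fst (z j))"
  shows "parity_transfer V N v V' M v'"
  using assms unfolding parity_transfer_def by blast

lemma parity_transfer_even_knot:
  assumes "parity_transfer V N v V' M v'" "v' \<in> V'" "v \<in> even_knot V N"
  shows "v' \<in> even_knot V' M"
proof -
  obtain m where m: "m \<in> N" "straight_off v m" "fst (m v) \<noteq> snd (m v)" "(\<Sum>j\<in>V - {v}. fst (m j)) = 0"
    using assms(3) by (auto simp: even_knot_def)
  then obtain w where "w \<in> M" "straight_off v' w" "fst (w v') \<noteq> snd (w v')" "(\<Sum>j\<in>V' - {v'}. fst (w j)) = 0"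
    using assms(1) unfolding parity_transfer_def by metis
  then show ?thesis using assms(2) unfolding even_knot_def by blast
qed

lemma parity_transfer_even_link:
  assumes "parity_transfer V N v V' M v'" "v \<in> V" "v' \<in> even_link V' M"
  shows "v \<in> even_link V N"
proof -
  have "z v = 0" if z: "z \<in> N" "straight z" for z
  proof -
    have c: "straight_off v z" "fst (z v) = snd (z v)" using z(2) straight_iff[of z v] by auto
    then obtain w where w: "w \<in> M" "straight_off v' w" "w v' = z v"
      using assms(1) z(1) unfolding parity_transfer_def by blast
    then have "straight w" using c straight_iff[of w v'] by simp
    with w assms(3) show ?thesis by (auto simp: even_link_def)
  qed
  with assms(2) show ?thesis by (auto simp: even_link_def)
qed

definition even_set :: "bool \<Rightarrow> nat set \<Rightarrow> kvec set \<Rightarrow> nat set" where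
  "even_set knot V L = (if knot then even_knot V L else even_link V L)"

lemma even_set_subset: "even_set knot V L \<subseteq> V"
  by (auto simp: even_set_def even_knot_def even_link_def)

lemma parity_transfer_even_set:
  assumes "parity_transfer V N v V' M v'" "parity_transfer V' M v' V N v" "v \<in> V" "v' \<in> V'"
  shows "v \<in> even_set knot V N \<longleftrightarrow> v' \<in> even_set knot V' M"
  using parity_transfer_even_knot[OF assms(1,4)] parity_transfer_even_knot[OF assms(2,3)] parity_transfer_even_link[OF assms(1,3)] parity_transfer_even_link[OF assms(2,4)]
  by (auto simp: even_set_def)

text \<open>
  Its size is a power of two whose exponent is the corank, see
  \<open>card_straight_part\<close>.
\<close>

definition straight_part :: "kvec set \<Rightarrow> kvec set" where
  "straight_part L = {z \<in> L. straight z}"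


lemma parity_transfer_flip: "parity_transfer V N v V (flip F ` N) v"
proof (rule parity_transferI)
  fix z assume z: "z \<in> N" "straight_off v z"
  have e: "flip F z j = z j" if "fst (z j) = snd (z j)" for j
    using that by (auto simp: flip_def prod_eq_iff)
  have "(\<Sum>j\<in>V - {v}. fst (flip F z j)) = (\<Sum>j\<in>V - {v}. fst (z j))"
    using z(2) e by (intro sum.cong) (auto simp: straight_off_def)
  moreover have "straight_off v (flip F z)" using z(2) by (simp add: straight_off_def flip_def)
  ultimately show "\<exists>w\<in>flip F ` N. straight_off v w \<and>
     (fst (z v) = snd (z v) \<longrightarrow> w v = z v) \<and> (fst (z v) \<noteq> snd (z v) \<longrightarrow> fst (w v) \<noteq> snd (w v)) \<and>
     (\<Sum>j\<in>V - {v}. fst (w j)) = (\<Sum>j\<in>V - {v}. fst (z j))"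
    using z(1) e[of v] by (intro bexI[of _ "flip F z"]) (simp_all add: flip_apply)
qed

lemma even_set_flip: "even_set knot V (flip F ` L) = even_set knot V L"
proof (rule Set.set_eqI)
  fix v
  have "parity_transfer V (flip F ` L) v V L v" using parity_transfer_flip[of V "flip F ` L" v F] by simp
  with parity_transfer_even_set[OF parity_transfer_flip this] even_set_subset show "v \<in> even_set knot V (flip F ` L) \<longleftrightarrow> v \<in> even_set knot V L" by blast
qed

lemma swap_eq_self_iff: "prod.swap p = p \<longleftrightarrow> fst p = snd p"
  by (cases p) auto

lemma straight_flip: "straight z \<Longrightarrow> flip F z = z"
  by (rule ext) (simp add: straight_def flip_def swap_eq_self_iff)

lemma straight_part_flip: "straight_part (flip F ` L) = straight_part L"
proof (rule Set.set_eqI)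
  fix z show "z \<in> straight_part (flip F ` L) \<longleftrightarrow> z \<in> straight_part L"
    by (cases "straight z") (simp_all add: straight_part_def in_flip_image straight_flip)
qed

lemma bij_inv_nat:
  assumes "bij (\<pi> :: nat \<Rightarrow> nat)"
  obtains \<rho> where "bij \<rho>" "\<And>x. \<pi> (\<rho> x) = x" "\<And>x. \<rho> (\<pi> x) = x"
proof
  show "bij (inv_into UNIV \<pi>)" by (rule bij_imp_bij_inv[OF assms])
  show "\<pi> (inv_into UNIV \<pi> x) = x" for x by (rule surj_f_inv_f[OF bij_is_surj[OF assms]])
  show "inv_into UNIV \<pi> (\<pi> x) = x" for x by (rule inv_f_f[OF bij_is_inj[OF assms]])
qed

lemma parity_transfer_relabel:
  assumes "bij \<pi>"
  shows "parity_transfer V N (\<pi> v) (\<pi> -` V) (relabel \<pi> N) v"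
proof (rule parity_transferI)
  fix z assume z: "z \<in> N" "straight_off (\<pi> v) z"
  obtain \<rho> where \<rho>: "\<And>x. \<pi> (\<rho> x) = x" "\<And>x. \<rho> (\<pi> x) = x" using bij_inv_nat[OF assms] by blast
  have i: "\<pi> x = \<pi> y \<longleftrightarrow> x = y" for x y using \<rho>(2) by metis
  have "bij_betw \<pi> (\<pi> -` V - {v}) (V - {\<pi> v})"
    by (rule bij_betw_byWitness[where f' = \<rho>]) (use \<rho> i in auto)
  then have "(\<Sum>j\<in>\<pi> -` V - {v}. fst ((z \<circ> \<pi>) j)) = (\<Sum>j\<in>V - {\<pi> v}. fst (z j))"
    by (simp add: sum.reindex_bij_betw[of \<pi> _ _ "\<lambda>j. fst (z j)"])
  moreover have "straight_off v (z \<circ> \<pi>)" using z(2) i by (simp add: straight_off_def)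
  ultimately show "\<exists>w\<in>relabel \<pi> N. straight_off v w \<and>
     (fst (z (\<pi> v)) = snd (z (\<pi> v)) \<longrightarrow> w v = z (\<pi> v)) \<and> (fst (z (\<pi> v)) \<noteq> snd (z (\<pi> v)) \<longrightarrow> fst (w v) \<noteq> snd (w v)) \<and>
     (\<Sum>j\<in>\<pi> -` V - {v}. fst (w j)) = (\<Sum>j\<in>V - {\<pi> v}. fst (z j))"
    using z(1) unfolding relabel_def by (intro bexI[of _ "z \<circ> \<pi>"]) auto
qed

lemma even_set_relabel:
  assumes "bij \<pi>"
  shows "even_set knot (\<pi> -` V) (relabel \<pi> N) = \<pi> -` even_set knot V N"
proof (rule Set.set_eqI)
  fix v
  obtain \<rho> where \<rho>: "bij \<rho>" "\<And>x. \<pi> (\<rho> x) = x" "\<And>x. \<rho> (\<pi> x) = x" using bij_inv_nat[OF assms] by blast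
  have "relabel \<rho> (relabel \<pi> N) = N" using \<rho>(2) by (simp add: relabel_def image_image o_def)
  moreover have "\<rho> -` \<pi> -` V = V" using \<rho>(2) by (simp add: vimage_def)
  ultimately have "parity_transfer (\<pi> -` V) (relabel \<pi> N) v V N (\<pi> v)"
    using parity_transfer_relabel[OF \<rho>(1), of "\<pi> -` V" "relabel \<pi> N" "\<pi> v"] by (simp add: \<rho>(3))
  from parity_transfer_even_set[OF parity_transfer_relabel[OF assms] this]
  show "v \<in> even_set knot (\<pi> -` V) (relabel \<pi> N) \<longleftrightarrow> v \<in> \<pi> -` even_set knot V N"
    using even_set_subset[of knot V N] even_set_subset[of knot "\<pi> -` V" "relabel \<pi> N"] by auto
qed

lemma card_straight_part_relabel:
  assumes "bij \<pi>"
  shows "card (straight_part (relabel \<pi> L)) = card (straight_part L)"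
proof -
  have sur: "(\<forall>j. P (\<pi> j)) \<longleftrightarrow> (\<forall>j. P j)" for P using assms by (metis bij_pointE)
  have "straight (z \<circ> \<pi>) \<longleftrightarrow> straight z" for z
    using sur[of "\<lambda>j. fst (z j) = snd (z j)"] by (simp add: straight_def)
  then have "straight_part (relabel \<pi> L) = (\<lambda>z. z \<circ> \<pi>) ` straight_part L" by (auto simp: straight_part_def relabel_def)
  moreover have "inj (\<lambda>z :: kvec. z \<circ> \<pi>)" using assms by (intro injI) (metis bij_is_surj fun_eq_iff comp_apply surjD)
  ultimately show ?thesis by (metis card_image inj_on_subset subset_UNIV)
qed


section \<open>The first move\<close>

text \<open>
  The space splits off the direction \<open>a\<close> at an isolated vertex of framing
  \<open>0\<close>.
\<close>

lemma in_lagrangian_isolated: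
  assumes v: "v \<in> vertices G" and iso: "\<And>k. entry G v k = 0"
  shows "z \<in> lagrangian G \<longleftrightarrow> snd (z v) = 0 \<and> erase {v} z \<in> lagrangian (delete_vertices {v} G)"
proof -
  have iso': "entry G k v = 0" for k using iso[of k] by (simp add: entry_sym)
  have V: "vertices G = insert v (vertices G - {v})" using v by auto
  have "(\<Sum>j\<in>vertices G - {v}. entry (delete_vertices {v} G) i j * fst (erase {v} z j)) =
    (\<Sum>j\<in>vertices G - {v}. entry G i j * fst (z j))" if "i \<noteq> v" for i
    using that by (intro sum.cong) (auto simp: entry_delete erase_def)
  moreover have "(j \<notin> vertices G - {v} \<longrightarrow> erase {v} z j = 0) \<longleftrightarrow> (j \<notin> vertices G \<longrightarrow> z j = 0)" for j
    using v by (cases "j = v") (simp_all add: erase_def)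
  ultimately have "erase {v} z \<in> lagrangian (delete_vertices {v} G) \<longleftrightarrow> (\<forall>j. j \<notin> vertices G \<longrightarrow> z j = 0) \<and>
    (\<forall>i\<in>vertices G - {v}. snd (z i) = (\<Sum>j\<in>vertices G - {v}. entry G i j * fst (z j)))"
    by (simp add: lagrangian_def) (simp add: erase_def)
  then show ?thesis by (subst in_lagrangian_insert[OF V]) (use v in \<open>auto simp: iso iso'\<close>)
qed

lemma
  assumes v: "v \<in> vertices G" and iso: "\<And>k. entry G v k = 0"
  shows even_set_isolated: "even_set knot (vertices G) (lagrangian G) = insert v (even_set knot (vertices G - {v}) (lagrangian (delete_vertices {v} G)))"
    and straight_part_isolated: "straight_part (lagrangian G) = straight_part (lagrangian (delete_vertices {v} G))"
proof -
  let ?L = "lagrangian G" and ?L' = "lagrangian (delete_vertices {v} G)"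
  note L = in_lagrangian_isolated[OF v iso]
  have 1: "z \<in> ?L \<and> erase {v} z = z" if "z \<in> ?L'" for z
  proof -
    have "z v = 0" using lagrangian_outside[OF that, of v] by simp
    moreover from this have "erase {v} z = z" by (intro erase_id) simp
    ultimately show ?thesis using that L[of z] by simp
  qed
  have 2: "z v = 0 \<and> z \<in> ?L'" if "z \<in> ?L" "fst (z v) = snd (z v)" for z
  proof -
    have zv: "z v = 0" using that L[of z] by (simp add: prod_eq_iff)
    moreover from this have "erase {v} z = z" by (intro erase_id) simp
    ultimately show ?thesis using that L[of z] by simp
  qed
  show "straight_part ?L = straight_part ?L'" using 1 2 by (auto simp: straight_part_def straight_def)
  have "v \<in> even_set knot (vertices G) ?L"
  proof (cases knot)
    case True
    have r: "vertex_row G v = 0(v := (1, 0))" using iso by (simp add: vertex_row_isolated_iff)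
    have "straight_off v (vertex_row G v)" "fst (vertex_row G v v) \<noteq> snd (vertex_row G v v)" by (simp_all add: r straight_off_def)
    moreover have "(\<Sum>j\<in>vertices G - {v}. fst (vertex_row G v j)) = 0" by (intro sum.neutral) (simp add: r)
    ultimately show ?thesis using True v vertex_row_in_lagrangian[OF v] unfolding even_set_def even_knot_def by auto
  next
    case False
    then show ?thesis using v 2 by (auto simp: even_set_def even_link_def straight_def)
  qed
  moreover have "u \<in> even_set knot (vertices G) ?L \<longleftrightarrow> u \<in> even_set knot (vertices G - {v}) ?L'" if u: "u \<in> vertices G - {v}" for u
  proof -
    have s: "(\<Sum>j\<in>vertices G - {u}. fst (z j)) = (\<Sum>j\<in>vertices G - {v} - {u}. fst (z j))" if "z v = 0" for z :: kvec
      using that by (intro sum.mono_neutral_right) auto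
    have "parity_transfer (vertices G) ?L u (vertices G - {v}) ?L' u"
    proof (rule parity_transferI)
      fix z assume z: "z \<in> ?L" "straight_off u z"
      then have "z v = 0 \<and> z \<in> ?L'" using u 2 by (auto simp: straight_off_def)
      with z s show "\<exists>w\<in>?L'. straight_off u w \<and>
         (fst (z u) = snd (z u) \<longrightarrow> w u = z u) \<and> (fst (z u) \<noteq> snd (z u) \<longrightarrow> fst (w u) \<noteq> snd (w u)) \<and>
         (\<Sum>j\<in>vertices G - {v} - {u}. fst (w j)) = (\<Sum>j\<in>vertices G - {u}. fst (z j))"
        by (intro bexI[of _ z]) auto
    qed
    moreover have "parity_transfer (vertices G - {v}) ?L' u (vertices G) ?L u"
    proof (rule parity_transferI)
      fix z assume z: "z \<in> ?L'" "straight_off u z"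
      then have "z v = 0" "z \<in> ?L" using 1[OF z(1)] lagrangian_outside[OF z(1), of v] by simp_all
      with z s show "\<exists>w\<in>?L. straight_off u w \<and>
         (fst (z u) = snd (z u) \<longrightarrow> w u = z u) \<and> (fst (z u) \<noteq> snd (z u) \<longrightarrow> fst (w u) \<noteq> snd (w u)) \<and>
         (\<Sum>j\<in>vertices G - {u}. fst (w j)) = (\<Sum>j\<in>vertices G - {v} - {u}. fst (z j))"
        by (intro bexI[of _ z]) auto
    qed
    ultimately show ?thesis using u by (intro parity_transfer_even_set) auto
  qed
  ultimately show "even_set knot (vertices G) ?L = insert v (even_set knot (vertices G - {v}) ?L')"
    using even_set_subset[of knot "vertices G" ?L] even_set_subset[of knot "vertices G - {v}" ?L'] by blast
qed

lemma state_sum_omega1: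
  assumes "omega1 G H"
  shows "state_sum (lagrangian G) (even_set knot (vertices G) (lagrangian G)) = state_sum (lagrangian H) (even_set knot (vertices H) (lagrangian H))"
    "straight_part (lagrangian G) = straight_part (lagrangian H)"
proof -
  obtain v where v: "v \<in> vertices G" "nbhd G v = {}" "framing G v = 0" "H = delete_vertices {v} G"
    using assms by (auto simp: omega1_def)
  have iso: "entry G v k = 0" for k using v by (auto simp: entry_def nbhd_def)
  show "straight_part (lagrangian G) = straight_part (lagrangian H)" using straight_part_isolated[OF v(1) iso] v(4) by simp
  show "state_sum (lagrangian G) (even_set knot (vertices G) (lagrangian G)) = state_sum (lagrangian H) (even_set knot (vertices H) (lagrangian H))"
    unfolding even_set_isolated[OF v(1) iso] v(4) vertices_delete
    by (rule state_sum_isolated[OF v(1) iso even_set_subset])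
qed


lemma diag_cases:
  fixes p :: "bit \<times> bit"
  shows "fst p = snd p \<Longrightarrow> p = 0 \<or> p = (1, 1)"
  by (cases p; cases "fst p") (auto simp: zero_prod_def)


section \<open>The second move\<close>

text \<open>
  With equal rows of \<open>x\<close> and \<open>y\<close> the space has a double point there. A
  vector that is straight at \<open>x\<close> and \<open>y\<close> has equal values at both by
  orthogonality, so erasing them changes neither sums of coordinates nor the other values;
  adding the double point vector matches the vectors for \<open>x\<close> with those for
  \<open>y\<close>.
\<close>

lemma state_sum_omega2:
  assumes "omega2 G H"
  shows "state_sum (lagrangian G) (even_set knot (vertices G) (lagrangian G)) = state_sum (lagrangian H) (even_set knot (vertices H) (lagrangian H))"
    "card (straight_part (lagrangian G)) = card (straight_part (lagrangian H))"
proof -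
  obtain x y where V: "x \<in> vertices G" "y \<in> vertices G" "x \<noteq> y" and H: "H = delete_vertices {x, y} G" and
    c: "\<not> adj G x y \<and> framing G x = 0 \<and> framing G y = 0 \<or> adj G x y \<and> framing G x = 1 \<and> framing G y = 1"
    "\<forall>t\<in>vertices G - {x, y}. adj G x t \<longleftrightarrow> adj G y t"
    using assms unfolding omega2_def by blast
  have eq: "entry G i x = entry G i y" for i
  proof -
    have xy: "entry G x x = entry G x y" "entry G y y = entry G x y"
      using c(1) V(3) unfolding entry_def by auto
    consider "i = x" | "i = y" | "i \<in> vertices G - {x, y}" | "i \<notin> vertices G" by blast
    then have "entry G x i = entry G y i"
    proof cases
      case 1 then show ?thesis using xy(1) entry_sym[of G x y] by simp
    next
      case 2 then show ?thesis using xy(2) by simp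
    next
      case 3 then show ?thesis using c(2) by (simp add: entry_def)
    next
      case 4 then show ?thesis by (simp add: entry_outside)
    qed
    then show ?thesis by (simp only: entry_sym[of G i])
  qed
  let ?N = "lagrangian G" and ?b = "two_point x (0, 1) y (0, 1)" and ?a = "two_point x (1, 0) y (1, 0)" and ?c = "two_point x (1, 1) y (1, 1)"
  have ab: "?a = ?b + ?c" "?a + ?b = ?c" by (simp_all add: two_point_def fun_eq_iff zero_prod_def)
  have "vertex_row G x + vertex_row G y = ?a"
    using V(3) by (auto simp: vertex_row_def eq two_point_def fun_eq_iff zero_prod_def)
  then have a: "?a \<in> ?N" using lagrangian_add[OF vertex_row_in_lagrangian[OF V(1)] vertex_row_in_lagrangian[OF V(2)]] by simp
  have b: "?b \<notin> ?N"
  proof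
    assume "?b \<in> ?N"
    then have "?b = 0" by (rule lagrangian_fst_0) (simp add: two_point_def)
    moreover have "?b \<noteq> 0" by (rule two_point_nonzero) simp
    ultimately show False by simp
  qed
  have M: "minor {x, y} {x, y} ?N = lagrangian H" unfolding H using V by (intro minor_lagrangian) simp
  have inM: "w \<in> lagrangian H \<longleftrightarrow> w x = 0 \<and> w y = 0 \<and> (w \<in> ?N \<or> w + ?b \<in> ?N)" for w
    unfolding M[symmetric] by (rule in_double_point_minor[OF graphic_lagrangian V(3) a])
  have orth: "snd (z x) = snd (z y)" if "z \<in> ?N" for z by (rule graphic_orth[OF graphic_lagrangian V(3) a that])
  have VH: "vertices H = vertices G - {x, y}" by (simp add: H)
  \<comment> \<open>Straight at \<open>x\<close> and \<open>y\<close>, hence equal there, a vector restricts to the smaller graph.\<close>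
  have down: "erase {x, y} z \<in> lagrangian H \<and> z x = z y \<and> fst (z x) = fst (z y)"
    if z: "z \<in> ?N" "fst (z x) = snd (z x)" "fst (z y) = snd (z y)" for z
  proof -
    have e: "z x = z y" using orth[OF z(1)] z by (simp add: prod_eq_iff)
    have o: "erase {x, y} z x = 0" "erase {x, y} z y = 0" by (simp_all add: erase_def)
    show ?thesis
    proof (cases "fst (z x) = 0")
      case True
      then have "z x = 0" "z y = 0" using z e by (simp_all add: prod_eq_iff)
      then have "erase {x, y} z = z" by (intro erase_id) auto
      with z(1) show ?thesis using inM o e by auto
    next
      case False
      then have "z x = (1, 1)" "z y = (1, 1)" using z e by (simp_all add: prod_eq_iff)
      then have "erase {x, y} z + ?b = z + ?a"
        using V(3) by (auto simp: erase_def fun_eq_iff two_point_def)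
      then show ?thesis using inM[of "erase {x, y} z"] o e lagrangian_add[OF z(1) a] by simp
    qed
  qed
  \<comment> \<open>Conversely a vector of the smaller graph lifts with value \<open>0\<close> or \<open>c\<close> at both vertices.\<close>
  have up: "\<exists>z\<in>?N. erase {x, y} z = w \<and> z x = z y \<and> fst (z x) = snd (z x)" if w: "w \<in> lagrangian H" for w
  proof -
    have w0: "w x = 0" "w y = 0" using w inM by auto
    have o: "erase {x, y} w = w" by (rule erase_id) (use w0 in auto)
    from w inM have "w \<in> ?N \<or> w + ?b \<in> ?N" by blast
    then show ?thesis
    proof
      assume "w \<in> ?N"
      then show ?thesis using w0 o by (intro bexI[of _ w]) auto
    next
      assume "w + ?b \<in> ?N"
      from lagrangian_add[OF this a] have m: "w + ?c \<in> ?N"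
        using ab(2) by (simp add: add.assoc add.commute[of ?b])
      have "erase {x, y} (w + ?c) = w" by (simp add: erase_add erase_two_point o)
      moreover have "(w + ?c) x = (1, 1)" "(w + ?c) y = (1, 1)" using w0 V(3) by (simp_all add: zero_prod_def)
      ultimately show ?thesis using m by (intro bexI[of _ "w + ?c"]) auto
    qed
  qed
  have sum2: "(\<Sum>j\<in>vertices G - {u}. fst (z j)) = (\<Sum>j\<in>vertices H - {u}. fst (erase {x, y} z j))"
    if "u \<in> vertices H" "fst (z x) = fst (z y)" for z u
  proof -
    have e: "vertices G - {u} = insert x (insert y (vertices H - {u}))" using V that(1) by (auto simp: VH)
    have "(\<Sum>j\<in>vertices H - {u}. fst (erase {x, y} z j)) = (\<Sum>j\<in>vertices H - {u}. fst (z j))"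
      by (intro sum.cong) (auto simp: VH erase_def)
    then show ?thesis unfolding e using V(3) that(2) by (simp add: VH add.assoc[symmetric])
  qed
  \<comment> \<open>Erasing is injective on straight vectors, because \<open>c\<close> at \<open>x, y\<close> is not in the space: together with \<open>a\<close> it would give \<open>b\<close>.\<close>
  show "card (straight_part ?N) = card (straight_part (lagrangian H))"
  proof -
    have "inj_on (erase {x, y}) (straight_part ?N)"
    proof (rule inj_onI)
      fix z w assume zw: "z \<in> straight_part ?N" "w \<in> straight_part ?N" "erase {x, y} z = erase {x, y} w"
      then have d: "z + w \<in> ?N" "fst ((z + w) j) = snd ((z + w) j)" for j
        by (auto simp: straight_part_def straight_def intro: lagrangian_add)
      have o: "erase {x, y} (z + w) = 0" by (simp add: erase_add zw(3))
      have exy: "(z + w) x = (z + w) y" using down[OF d(1)] d(2) by blast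
      have "z + w = two_point x ((z + w) x) y ((z + w) x)" by (rule two_point_eqI[OF V(3) o]) (simp_all only: exy)
      moreover have "(z + w) x = 0 \<or> (z + w) x = (1, 1)"
        using d(2)[of x] by (rule diag_cases)
      moreover have "?c \<notin> ?N"
      proof
        assume "?c \<in> ?N"
        from lagrangian_add[OF this a] have "?b \<in> ?N" unfolding ab(1) by (simp add: add.commute[of ?b] add.assoc[symmetric])
        with b show False ..
      qed
      ultimately have "z + w = two_point x 0 y 0" using d(1) by metis
      then have "z + w + w = w" by simp
      then show "z = w" by simp
    qed
    moreover have "erase {x, y} ` straight_part ?N = straight_part (lagrangian H)"
    proof (intro Set.set_eqI iffI)
      fix w assume "w \<in> erase {x, y} ` straight_part ?N"
      then obtain z where "z \<in> ?N" "straight z" "w = erase {x, y} z" by (auto simp: straight_part_def)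
      then show "w \<in> straight_part (lagrangian H)" using down[of z] by (auto simp: straight_part_def straight_def erase_def)
    next
      fix w assume w: "w \<in> straight_part (lagrangian H)"
      then obtain z where z: "z \<in> ?N" "erase {x, y} z = w" "z x = z y" "fst (z x) = snd (z x)"
        using up[of w] by (auto simp: straight_part_def)
      have "fst (z j) = snd (z j)" for j
      proof (cases "j \<in> {x, y}")
        case False
        then have "z j = w j" by (simp add: erase_def flip: z(2))
        then show ?thesis using w by (simp add: straight_part_def straight_def)
      qed (use z(3,4) in auto)
      then have "z \<in> straight_part ?N" using z(1) by (simp add: straight_part_def straight_def)
      with z(2) show "w \<in> erase {x, y} ` straight_part ?N" by blast
    qed
    ultimately show ?thesis by (metis card_image)
  qed
  have evH: "u \<in> even_set knot (vertices G) ?N \<longleftrightarrow> u \<in> even_set knot (vertices H) (lagrangian H)" if u: "u \<in> vertices H" for u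
  proof -
    have uxy: "u \<noteq> x" "u \<noteq> y" "u \<in> vertices G" using u by (auto simp: VH)
    have "parity_transfer (vertices G) ?N u (vertices H) (lagrangian H) u"
    proof (rule parity_transferI)
      fix z assume z: "z \<in> ?N" "straight_off u z"
      have zxy: "fst (z x) = snd (z x)" "fst (z y) = snd (z y)" using z(2) uxy by (auto simp: straight_off_def)
      note d = down[OF z(1) zxy]
      have "straight_off u (erase {x, y} z)" using z(2) by (simp add: straight_off_def erase_def)
      moreover have "erase {x, y} z u = z u" using uxy by (simp add: erase_def)
      moreover note sum2[OF u, of z]
      ultimately show "\<exists>w\<in>lagrangian H. straight_off u w \<and>
         (fst (z u) = snd (z u) \<longrightarrow> w u = z u) \<and> (fst (z u) \<noteq> snd (z u) \<longrightarrow> fst (w u) \<noteq> snd (w u)) \<and>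
         (\<Sum>j\<in>vertices H - {u}. fst (w j)) = (\<Sum>j\<in>vertices G - {u}. fst (z j))"
        using d by (intro bexI[of _ "erase {x, y} z"]) simp_all
    qed
    moreover have "parity_transfer (vertices H) (lagrangian H) u (vertices G) ?N u"
    proof (rule parity_transferI)
      fix w assume w: "w \<in> lagrangian H" "straight_off u w"
      obtain z where z: "z \<in> ?N" "erase {x, y} z = w" "z x = z y" "fst (z x) = snd (z x)" using up[OF w(1)] by blast
      have zw: "z j = w j" if "j \<notin> {x, y}" for j using that by (simp add: erase_def flip: z(2))
      have "straight_off u z" unfolding straight_off_def
      proof (intro allI impI)
        fix j assume j: "j \<noteq> u"
        show "fst (z j) = snd (z j)"
        proof (cases "j \<in> {x, y}")
          case False
          then show ?thesis using zw[OF False] w(2) j by (simp add: straight_off_def)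
        qed (use z(3,4) in auto)
      qed
      moreover have "z u = w u" using uxy by (intro zw) simp
      moreover have "(\<Sum>j\<in>vertices G - {u}. fst (z j)) = (\<Sum>j\<in>vertices H - {u}. fst (w j))"
        using sum2[OF u, of z] z(2,3) by simp
      ultimately show "\<exists>z\<in>?N. straight_off u z \<and>
         (fst (w u) = snd (w u) \<longrightarrow> z u = w u) \<and> (fst (w u) \<noteq> snd (w u) \<longrightarrow> fst (z u) \<noteq> snd (z u)) \<and>
         (\<Sum>j\<in>vertices G - {u}. fst (z j)) = (\<Sum>j\<in>vertices H - {u}. fst (w j))"
        using z(1) by (intro bexI[of _ z]) simp_all
    qed
    ultimately show ?thesis using u uxy by (intro parity_transfer_even_set) auto
  qed
  have corrxy: "parity_transfer (vertices G) ?N p (vertices G) ?N q" if pq: "p = x \<and> q = y \<or> p = y \<and> q = x" for p q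
  proof (rule parity_transferI)
    have ne: "p \<noteq> q" and pV: "p \<in> vertices G" "q \<in> vertices G" using pq V by auto
    fix z assume z: "z \<in> ?N" "straight_off p z"
    have s: "snd (z p) = snd (z q)" using orth[OF z(1)] pq by auto
    have q: "fst (z q) = snd (z q)" using z(2) ne by (simp add: straight_off_def)
    have S: "(\<Sum>j\<in>vertices G - {r}. f j) = f t + (\<Sum>j\<in>vertices G - {p, q}. f j)"
      if "r = p \<and> t = q \<or> r = q \<and> t = p" for r t and f :: "nat \<Rightarrow> bit"
    proof -
      have "vertices G - {r} = insert t (vertices G - {p, q})" using that pV ne by auto
      moreover have "t \<notin> vertices G - {p, q}" using that by auto
      ultimately show ?thesis by simp
    qed
    show "\<exists>w\<in>?N. straight_off q w \<and>
         (fst (z p) = snd (z p) \<longrightarrow> w q = z p) \<and> (fst (z p) \<noteq> snd (z p) \<longrightarrow> fst (w q) \<noteq> snd (w q)) \<and>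
         (\<Sum>j\<in>vertices G - {q}. fst (w j)) = (\<Sum>j\<in>vertices G - {p}. fst (z j))"
    proof (cases "fst (z p) = snd (z p)")
      case True
      then have e: "z p = z q" using s q by (simp add: prod_eq_iff)
      have "straight_off q z" using z(2) True unfolding straight_off_def by metis
      then show ?thesis using z(1) True e S[of p q "\<lambda>j. fst (z j)"] S[of q p "\<lambda>j. fst (z j)"]
        by (intro bexI[of _ z]) simp_all
    next
      case False
      define w where "w = z + ?a"
      have wp: "w p = (fst (z p) + 1, snd (z p))" "w q = (fst (z q) + 1, snd (z q))"
        using pq V(3) by (auto simp: w_def prod_eq_iff)
      have wo: "w j = z j" if "j \<notin> {p, q}" for j using that pq by (auto simp: w_def)
      have bit1: "s \<noteq> t \<Longrightarrow> s + 1 = t" for s t :: bit by (cases s; cases t) simp_all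
      have "straight_off q w" unfolding straight_off_def
      proof (intro allI impI)
        fix j assume j: "j \<noteq> q"
        show "fst (w j) = snd (w j)"
        proof (cases "j = p")
          case True
          then show ?thesis using wp bit1[OF False] by simp
        next
          case F: False
          then show ?thesis using wo[of j] z(2) j by (simp add: straight_off_def)
        qed
      qed
      moreover have "fst (w q) \<noteq> snd (w q)" using wp(2) q by (cases "snd (z q)") simp_all
      moreover have "(\<Sum>j\<in>vertices G - {p, q}. fst (w j)) = (\<Sum>j\<in>vertices G - {p, q}. fst (z j))"
        by (intro sum.cong) (auto simp: wo)
      moreover have "fst (w p) = fst (z q)" using wp(1) bit1[OF False] s q by simp
      moreover have "w \<in> ?N" unfolding w_def by (rule lagrangian_add[OF z(1) a])
      ultimately show ?thesis using False S[of p q "\<lambda>j. fst (z j)"] S[of q p "\<lambda>j. fst (w j)"]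
        by (intro bexI[of _ w]) simp_all
    qed
  qed
  have exy: "x \<in> even_set knot (vertices G) ?N \<longleftrightarrow> y \<in> even_set knot (vertices G) ?N"
    using V by (intro parity_transfer_even_set corrxy) auto
  have sub: "even_set knot (vertices G) ?N \<subseteq> vertices G" by (rule even_set_subset)
  have "even_set knot (vertices G) ?N - {x, y} = even_set knot (vertices H) (lagrangian H)"
    using evH sub even_set_subset[of knot "vertices H" "lagrangian H"] unfolding VH by blast
  moreover have "state_sum ?N (even_set knot (vertices G) ?N) = state_sum (lagrangian H) (even_set knot (vertices G) ?N - {x, y})"
    using state_sum_double_point[OF graphic_lagrangian V(3) a sub finite_subset[OF sub finite_vertices] exy] b by (simp add: M)
  ultimately show "state_sum ?N (even_set knot (vertices G) ?N) = state_sum (lagrangian H) (even_set knot (vertices H) (lagrangian H))" by simp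
qed


section \<open>The two sides of the third move\<close>

text \<open>
  With \<open>r v = (X, P)\<close> and \<open>r w = (Y, Q)\<close> the vector has the values
  \<open>(e, X + Y)\<close>, \<open>(X, P + e)\<close> and \<open>(Y, Q + e)\<close> at
  \<open>u, v, w\<close>: a new vertex \<open>u\<close> of framing \<open>0\<close>, adjacent to
  \<open>v\<close> and \<open>w\<close> only, is added to the graph.
\<close>

definition triangle_vec :: "nat \<Rightarrow> nat \<Rightarrow> nat \<Rightarrow> kvec \<Rightarrow> bit \<Rightarrow> kvec" where
  "triangle_vec u v w r e = (\<lambda>j. if j = u then (e, fst (r v) + fst (r w))
     else if j = v \<or> j = w then (fst (r j), snd (r j) + e) else r j)"

definition triangle_ext :: "nat \<Rightarrow> nat \<Rightarrow> nat \<Rightarrow> kvec set \<Rightarrow> kvec set" where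
  "triangle_ext u v w R = {triangle_vec u v w r e | r e. r \<in> R}"

lemma in_triangle_ext: "z \<in> triangle_ext u v w R \<longleftrightarrow> (\<exists>r\<in>R. \<exists>e. z = triangle_vec u v w r e)"
  by (auto simp: triangle_ext_def)

lemma triangle_ext_commute: "triangle_ext u v w R = triangle_ext u w v R"
proof -
  have "triangle_vec u v w r e = triangle_vec u w v r e" for r e by (auto simp: triangle_vec_def add.commute)
  then show ?thesis by (simp add: triangle_ext_def)
qed

lemma triangle_vec_simps:
  assumes "u \<noteq> v" "u \<noteq> w" "v \<noteq> w"
  shows "triangle_vec u v w r e u = (e, fst (r v) + fst (r w))" "triangle_vec u v w r e v = (fst (r v), snd (r v) + e)"
    "triangle_vec u v w r e w = (fst (r w), snd (r w) + e)"
    "j \<noteq> u \<Longrightarrow> j \<noteq> v \<Longrightarrow> j \<noteq> w \<Longrightarrow> triangle_vec u v w r e j = r j"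
  using assms by (simp_all add: triangle_vec_def)

lemma flip2_simps: "flip {v, w} r v = prod.swap (r v)" "flip {v, w} r w = prod.swap (r w)"
  "j \<noteq> v \<Longrightarrow> j \<noteq> w \<Longrightarrow> flip {v, w} r j = r j"
  by (simp_all add: flip_def)


text \<open>
  Inverse to \<open>triangle_vec\<close> on the left-hand side of the move.
\<close>

definition triangle_core :: "nat \<Rightarrow> nat \<Rightarrow> nat \<Rightarrow> kvec \<Rightarrow> kvec" where
  "triangle_core u v w z = (\<lambda>j. if j = u then 0 else if j = v \<or> j = w then (fst (z j), snd (z j) + fst (z u)) else z j)"

lemma in_triangle_ext_iff:
  assumes "u \<noteq> v" "u \<noteq> w" "v \<noteq> w" and R: "\<And>r. r \<in> R \<Longrightarrow> r u = 0"
  shows "z \<in> triangle_ext u v w R \<longleftrightarrow> snd (z u) = fst (z v) + fst (z w) \<and> triangle_core u v w z \<in> R"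
proof
  assume "z \<in> triangle_ext u v w R"
  then obtain r e where r: "r \<in> R" and z: "z = triangle_vec u v w r e" by (auto simp: in_triangle_ext)
  have "triangle_core u v w z = r"
    by (rule ext) (use assms(1-3) R[OF r] in \<open>simp add: triangle_core_def z triangle_vec_def prod_eq_iff\<close>)
  then show "snd (z u) = fst (z v) + fst (z w) \<and> triangle_core u v w z \<in> R"
    using assms(1-3) r by (simp add: z triangle_vec_def)
next
  assume a: "snd (z u) = fst (z v) + fst (z w) \<and> triangle_core u v w z \<in> R"
  have "z = triangle_vec u v w (triangle_core u v w z) (fst (z u))"
    by (rule HOL.ext) (use assms(1-3) a in \<open>simp add: triangle_core_def triangle_vec_def prod_eq_iff\<close>)
  with a show "z \<in> triangle_ext u v w R" by (auto simp: in_triangle_ext)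
qed


lemma lagrangian_omega3_before:
  assumes u: "u \<in> vertices G" "u \<noteq> v" "u \<noteq> w" "v \<noteq> w" and V: "v \<in> vertices G" "w \<in> vertices G"
    and vertex_row: "\<And>j. entry G u j = of_bool (j = v \<or> j = w)"
  shows "lagrangian G = triangle_ext u v w (lagrangian (delete_vertices {u} G))"
proof (rule Set.set_eqI)
  fix z
  define W where "W = vertices G - {u}"
  have VW: "vertices G = insert u W" "u \<notin> W" "finite W" using u(1) by (auto simp: W_def)
  have vw: "v \<in> W" "w \<in> W" using u V by (auto simp: W_def)
  let ?R = "lagrangian (delete_vertices {u} G)"
  have R0: "r u = 0" if "r \<in> ?R" for r using lagrangian_outside[OF that] by simp
  have s1: "(\<Sum>j\<in>W. of_bool (j = v \<or> j = w) * f j) = f v + f w" for f :: "nat \<Rightarrow> bit"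
  proof -
    have "(\<Sum>j\<in>W. of_bool (j = v \<or> j = w) * f j) = (\<Sum>j\<in>W. (if j = v then f v else 0) + (if j = w then f w else 0))"
      using u(4) by (intro sum.cong) auto
    then show ?thesis using vw VW(3) by (simp add: sum.distrib)
  qed
  have col: "entry G i u = of_bool (i = v \<or> i = w)" for i using vertex_row[of i] by (simp add: entry_sym)
  have ie: "z \<in> triangle_ext u v w ?R \<longleftrightarrow> snd (z u) = fst (z v) + fst (z w) \<and> triangle_core u v w z \<in> ?R" for z
    by (rule in_triangle_ext_iff[OF u(2-4)]) (rule R0)
  have c: "triangle_core u v w z \<in> ?R \<longleftrightarrow> (\<forall>j. j \<notin> insert u W \<longrightarrow> z j = 0) \<and>
    (\<forall>i\<in>W. snd (z i) = of_bool (i = v \<or> i = w) * fst (z u) + (\<Sum>j\<in>W. entry G i j * fst (z j)))"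
  proof -
    have "(j \<notin> W \<longrightarrow> triangle_core u v w z j = 0) \<longleftrightarrow> (j \<notin> insert u W \<longrightarrow> z j = 0)" for j
      using vw by (auto simp: triangle_core_def)
    moreover have "(\<Sum>j\<in>W. entry (delete_vertices {u} G) i j * fst (triangle_core u v w z j)) = (\<Sum>j\<in>W. entry G i j * fst (z j))"
      if "i \<in> W" for i
      using that VW(2) by (intro sum.cong) (auto simp: entry_delete triangle_core_def)
    moreover have "snd (triangle_core u v w z i) = t \<longleftrightarrow> snd (z i) = of_bool (i = v \<or> i = w) * fst (z u) + t" if "i \<in> W" for i t
    proof -
      have "s + e = t \<longleftrightarrow> s = e + t" for s e :: bit by (cases s; cases e; cases t) simp_all
      then show ?thesis using that VW(2) by (auto simp: triangle_core_def)
    qed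
    ultimately show ?thesis by (simp add: lagrangian_def W_def[symmetric])
  qed
  show "z \<in> lagrangian G \<longleftrightarrow> z \<in> triangle_ext u v w ?R"
    unfolding ie c in_lagrangian_insert[OF VW(1,2)] by (simp add: vertex_row col s1 u(2,3)) blast
qed

lemma conj_eq_swap: "(C \<Longrightarrow> s = t) \<Longrightarrow> A \<and> x = t \<and> C \<longleftrightarrow> A \<and> x = s \<and> C"
  by auto

text \<open>
  After the move the row of \<open>u\<close> is the sum of the rows of \<open>v\<close> and
  \<open>w\<close>. So adding the coordinate of \<open>u\<close> to those of \<open>v\<close>
  and \<open>w\<close> turns the other equations into those of the graph without
  \<open>u\<close>, and the equation of \<open>u\<close> says that its second coordinate is the
  sum of the second coordinates of \<open>v\<close> and \<open>w\<close>. This is the situation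
  before the move with the coordinates of \<open>v\<close> and \<open>w\<close> interchanged.
\<close>

lemma lagrangian_omega3_after:
  assumes u: "u \<in> vertices G" "u \<noteq> v" "u \<noteq> w" "v \<noteq> w" and V: "v \<in> vertices G" "w \<in> vertices G"
    and G': "vertices G' = vertices G" "entry G' u u = 0"
    and vertex_row: "\<And>j. j \<noteq> u \<Longrightarrow> entry G' u j = entry G v j + entry G w j"
    and rest: "\<And>i j. i \<noteq> u \<Longrightarrow> j \<noteq> u \<Longrightarrow> entry G' i j = entry G i j"
    and fr: "entry G v v = 0" "entry G w w = 0"
  shows "lagrangian G' = flip {v, w} ` triangle_ext u v w (flip {v, w} ` lagrangian (delete_vertices {u} G))"
proof (rule Set.set_eqI)
  fix z
  define W where "W = vertices G - {u}"
  have VW: "vertices G' = insert u W" "u \<notin> W" "finite W" using u(1) by (auto simp: W_def G')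
  have vw: "v \<in> W" "w \<in> W" using u V by (auto simp: W_def)
  let ?R = "lagrangian (delete_vertices {u} G)"
  have R0: "r u = 0" if "r \<in> flip {v, w} ` ?R" for r
    using that by (auto dest: lagrangian_outside)
  have s1: "(\<Sum>j\<in>W. f j * of_bool (j = v \<or> j = w)) = f v + f w" for f :: "nat \<Rightarrow> bit"
  proof -
    have "(\<Sum>j\<in>W. f j * of_bool (j = v \<or> j = w)) = (\<Sum>j\<in>W. (if j = v then f v else 0) + (if j = w then f w else 0))"
      using u(4) by (intro sum.cong) auto
    then show ?thesis using vw VW(3) by (simp add: sum.distrib)
  qed
  have col: "entry G' i u = entry G i v + entry G i w" if "i \<in> W" for i
  proof -
    have "i \<noteq> u" using that VW(2) by auto
    from vertex_row[OF this] show ?thesis by (simp only: entry_sym[of G' i u] entry_sym[of G i])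
  qed
  have ie: "z \<in> triangle_ext u v w (flip {v, w} ` ?R) \<longleftrightarrow> snd (z u) = fst (z v) + fst (z w) \<and> triangle_core u v w z \<in> flip {v, w} ` ?R" for z
    by (rule in_triangle_ext_iff[OF u(2-4)]) (rule R0)
  let ?z = "flip {v, w} (triangle_core u v w (flip {v, w} z))"
  have z: "?z j = (if j = u then 0 else if j = v \<or> j = w then (fst (z j) + fst (z u), snd (z j)) else z j)" for j
    using u by (auto simp: flip_def triangle_core_def zero_prod_def)
  let ?s = "\<lambda>i. \<Sum>j\<in>W. entry G i j * fst (z j)"
  have c: "triangle_core u v w (flip {v, w} z) \<in> flip {v, w} ` ?R \<longleftrightarrow> (\<forall>j. j \<notin> insert u W \<longrightarrow> z j = 0) \<and>
    (\<forall>i\<in>W. snd (z i) = (entry G i v + entry G i w) * fst (z u) + ?s i)"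
  proof -
    have "(j \<notin> W \<longrightarrow> ?z j = 0) \<longleftrightarrow> (j \<notin> insert u W \<longrightarrow> z j = 0)" for j
      using vw by (auto simp: z)
    moreover have "(\<Sum>j\<in>W. entry (delete_vertices {u} G) i j * fst (?z j)) = (entry G i v + entry G i w) * fst (z u) + ?s i"
      if i: "i \<in> W" for i
    proof -
      have "(\<Sum>j\<in>W. entry (delete_vertices {u} G) i j * fst (?z j)) =
        (\<Sum>j\<in>W. (entry G i j * fst (z u)) * of_bool (j = v \<or> j = w) + entry G i j * fst (z j))"
        using i VW(2) by (intro sum.cong) (auto simp: entry_delete z distrib_left add.commute)
      also have "\<dots> = (entry G i v + entry G i w) * fst (z u) + ?s i"
        unfolding sum.distrib s1 by (simp add: distrib_right)
      finally show ?thesis .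
    qed
    moreover have "snd (?z i) = snd (z i)" if "i \<in> W" for i using that VW(2) by (auto simp: z)
    ultimately show ?thesis unfolding in_flip_image by (simp add: lagrangian_def W_def[symmetric])
  qed
  have "z \<in> lagrangian G' \<longleftrightarrow> (\<forall>j. j \<notin> insert u W \<longrightarrow> z j = 0) \<and> snd (z u) = ?s v + ?s w \<and>
    (\<forall>i\<in>W. snd (z i) = (entry G i v + entry G i w) * fst (z u) + ?s i)"
  proof -
    have "(\<Sum>j\<in>W. entry G' u j * fst (z j)) = (\<Sum>j\<in>W. (entry G v j + entry G w j) * fst (z j))"
      using VW(2) by (intro sum.cong refl arg_cong2[of _ _ _ _ "(*)"] vertex_row) auto
    also have "\<dots> = ?s v + ?s w" by (simp only: distrib_right sum.distrib)
    finally have su: "(\<Sum>j\<in>W. entry G' u j * fst (z j)) = ?s v + ?s w" .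
    have si: "(\<Sum>j\<in>W. entry G' i j * fst (z j)) = ?s i" if "i \<in> W" for i
      using that VW(2) by (intro sum.cong refl arg_cong2[of _ _ _ _ "(*)"] rest) auto
    show ?thesis unfolding in_lagrangian_insert[OF VW(1,2)] su using si col by (simp add: G'(2))
  qed
  also have "\<dots> \<longleftrightarrow> (\<forall>j. j \<notin> insert u W \<longrightarrow> z j = 0) \<and> snd (z u) = snd (z v) + snd (z w) \<and>
    (\<forall>i\<in>W. snd (z i) = (entry G i v + entry G i w) * fst (z u) + ?s i)"
  proof -
    have "snd (z v) + snd (z w) = ?s v + ?s w"
      if a: "\<forall>i\<in>W. snd (z i) = (entry G i v + entry G i w) * fst (z u) + ?s i"
    proof -
      have "snd (z v) = entry G v w * fst (z u) + ?s v" "snd (z w) = entry G v w * fst (z u) + ?s w"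
        using a vw fr entry_sym[of G w v] by auto
      then show ?thesis by (simp only: add_ac bit_add_self_left)
    qed
    then show ?thesis by (rule conj_eq_swap)
  qed
  also have "\<dots> \<longleftrightarrow> z \<in> flip {v, w} ` triangle_ext u v w (flip {v, w} ` ?R)"
    unfolding in_flip_image[of z "{v, w}" "triangle_ext u v w (flip {v, w} ` ?R)"]
      ie c using u by (simp add: flip_apply) blast
  finally show "z \<in> lagrangian G' \<longleftrightarrow> z \<in> flip {v, w} ` triangle_ext u v w (flip {v, w} ` ?R)" .
qed


section \<open>Parity under the third move\<close>

lemma sum_minus_bit:
  fixes f :: "nat \<Rightarrow> bit"
  assumes "finite V" "t \<in> V"
  shows "(\<Sum>j\<in>V - {t}. f j) = (\<Sum>j\<in>V. f j) + f t"
  using sum.remove[OF assms, of f] by (simp add: add.commute)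

text \<open>
  The counterpart of \<open>triangle_vec u v w r e\<close> interchanges the coordinates of
  \<open>r\<close> at \<open>v\<close> and \<open>w\<close> and replaces \<open>e\<close> by
  \<open>e + X + Y + P + Q\<close>. This preserves the sum of all first coordinates and, for the
  vectors that matter, exchanges the values at \<open>v\<close> and \<open>w\<close>.
\<close>

lemma parity_transfer_triangle:
  assumes V: "finite V" "u \<in> V" "v \<in> V" "w \<in> V" and d: "u \<noteq> v" "u \<noteq> w" "v \<noteq> w" and t: "t \<in> V"
  shows "parity_transfer V (triangle_ext u v w R) t V (triangle_ext u v w (flip {v, w} ` R)) (transpose v w t)"
proof (rule parity_transferI)
  fix z assume z: "z \<in> triangle_ext u v w R" "straight_off t z"
  then obtain r e where r: "r \<in> R" and zr: "z = triangle_vec u v w r e" by (auto simp: in_triangle_ext)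
  obtain X P where rv: "r v = (X, P)" by (cases "r v")
  obtain Y Q where rw: "r w = (Y, Q)" by (cases "r w")
  define e' where "e' = e + X + Y + P + Q"
  define z' where "z' = triangle_vec u v w (flip {v, w} r) e'"
  have z_eq: "z u = (e, X + Y)" "z v = (X, P + e)" "z w = (Y, Q + e)"
    unfolding zr using triangle_vec_simps[OF d] by (simp_all add: rv rw)
  have z'_eq: "z' u = (e', P + Q)" "z' v = (P, X + e')" "z' w = (Q, Y + e')"
    unfolding z'_def using triangle_vec_simps[OF d] by (simp_all add: flip2_simps rv rw)
  have rest_eq: "z' j = z j" if "j \<noteq> u" "j \<noteq> v" "j \<noteq> w" for j
    unfolding z'_def zr using triangle_vec_simps(4)[OF d that] that by (simp add: flip2_simps)
  have tV: "transpose v w t \<in> V" using V t by (auto simp: transpose_def)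
  have S: "(\<Sum>j\<in>V. f j) = (\<Sum>j\<in>V - {u, v, w}. f j) + (f u + (f v + f w))" for f :: "nat \<Rightarrow> bit"
  proof -
    have "V = insert u (insert v (insert w (V - {u, v, w})))" using V by auto
    then have "sum f V = sum f (insert u (insert v (insert w (V - {u, v, w}))))" by (rule arg_cong)
    also have "\<dots> = f u + (f v + (f w + sum f (V - {u, v, w})))"
      using d V(1) by simp
    finally show ?thesis by (simp only: add_ac)
  qed
  have rest: "(\<Sum>j\<in>V - {u, v, w}. fst (z' j)) = (\<Sum>j\<in>V - {u, v, w}. fst (z j))"
    by (intro sum.cong) (auto simp: rest_eq)
  have "(\<Sum>j\<in>V. fst (z' j)) = (\<Sum>j\<in>V. fst (z j))"
    unfolding S rest z_eq z'_eq e'_def fst_conv by (simp only: add_ac bit_add_self_left bit_add_self add_0_right)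
  moreover have key: "straight_off (transpose v w t) z' \<and> fst (z' (transpose v w t)) = fst (z t) \<and>
     (snd (z' (transpose v w t)) = snd (z t))"
  proof -
    have c: "fst (z j) = snd (z j)" if "j \<noteq> t" for j using z(2) that by (simp add: straight_off_def)
    have c': "straight_off s z'" if "\<And>j. j \<noteq> s \<Longrightarrow> j \<in> {u, v, w} \<Longrightarrow> fst (z' j) = snd (z' j)"
       "\<And>j. j \<notin> {u, v, w} \<Longrightarrow> j \<noteq> s \<Longrightarrow> j \<noteq> t" for s
      unfolding straight_off_def
    proof (intro allI impI)
      fix j assume j: "j \<noteq> s"
      show "fst (z' j) = snd (z' j)"
        using that(1)[OF j] that(2)[OF _ j] rest_eq[of j] c[of j] by (cases "j \<in> {u, v, w}") auto
    qed
    have cu: "e = X + Y" if "t \<noteq> u" using c[of u] that by (simp add: z_eq)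
    have cv: "X = P + e" if "t \<noteq> v" using c[of v] that by (simp add: z_eq)
    have cw: "Y = Q + e" if "t \<noteq> w" using c[of w] that by (simp add: z_eq)
    \<comment> \<open>Straightness at the vertices other than \<open>t\<close> gives at least two of the three relations above.\<close>
    consider "t = u" | "t = v" | "t = w" | "t \<notin> {u, v, w}" by blast
    then show ?thesis
    proof cases
      case 1
      then have tt: "transpose v w t = u" using d by (simp add: transpose_def)
      have b: "X = P + e" by (rule cv) (use 1 d in simp)
      have b2: "Y = Q + e" by (rule cw) (use 1 d in simp)
      have "fst (z' v) = snd (z' v)" "fst (z' w) = snd (z' w)" "z' u = z u"
        unfolding z_eq z'_eq e'_def b b2 by (cases P; cases Q; cases e; simp)+
      with 1 show ?thesis unfolding tt by (intro conjI c') auto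
    next
      case 2
      then have tt: "transpose v w t = w" using d by (simp add: transpose_def)
      have b: "Y = Q + e" by (rule cw) (use 2 d in simp)
      have b2: "e = X + Y" by (rule cu) (use 2 d in simp)
      have b': "Q = X" using b unfolding b2 by (cases Q; cases X; cases Y; simp)
      have "fst (z' u) = snd (z' u)" "fst (z' v) = snd (z' v)" "z' w = z v"
        unfolding z_eq z'_eq e'_def b2 b' by (cases P; cases Y; cases X; simp)+
      with 2 show ?thesis unfolding tt by (intro conjI c') auto
    next
      case 3
      then have tt: "transpose v w t = v" using d by (simp add: transpose_def)
      have b: "X = P + e" by (rule cv) (use 3 d in simp)
      have b2: "e = X + Y" by (rule cu) (use 3 d in simp)
      have b': "P = Y" using b unfolding b2 by (cases P; cases X; cases Y; simp)
      have "fst (z' u) = snd (z' u)" "fst (z' w) = snd (z' w)" "z' v = z w"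
        unfolding z_eq z'_eq e'_def b2 b' by (cases Q; cases Y; cases X; simp)+
      with 3 show ?thesis unfolding tt by (intro conjI c') auto
    next
      case 4
      then have tt: "transpose v w t = t" by (auto simp: transpose_def)
      have b: "X = P + e" by (rule cv) (use 4 in simp)
      have b1: "Y = Q + e" by (rule cw) (use 4 in simp)
      have b2: "e = X + Y" by (rule cu) (use 4 in simp)
      have b': "P = Y" "Q = X" using b b1 unfolding b2 by (cases P; cases Q; cases X; cases Y; simp)+
      have "fst (z' u) = snd (z' u)" "fst (z' v) = snd (z' v)" "fst (z' w) = snd (z' w)"
        unfolding z_eq z'_eq e'_def b2 b' by (cases Y; cases X; simp)+
      moreover have "z' t = z t" using 4 by (intro rest_eq) auto
      ultimately show ?thesis using 4 unfolding tt by (intro conjI c') auto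
    qed
  qed
  ultimately have "(\<Sum>j\<in>V - {transpose v w t}. fst (z' j)) = (\<Sum>j\<in>V - {t}. fst (z j))"
    by (simp add: sum_minus_bit[OF V(1) tV] sum_minus_bit[OF V(1) t])
  moreover have "z' \<in> triangle_ext u v w (flip {v, w} ` R)" using r by (auto simp: in_triangle_ext z'_def)
  ultimately show "\<exists>z'\<in>triangle_ext u v w (flip {v, w} ` R). straight_off (transpose v w t) z' \<and>
     (fst (z t) = snd (z t) \<longrightarrow> z' (transpose v w t) = z t) \<and>
     (fst (z t) \<noteq> snd (z t) \<longrightarrow> fst (z' (transpose v w t)) \<noteq> snd (z' (transpose v w t))) \<and>
     (\<Sum>j\<in>V - {transpose v w t}. fst (z' j)) = (\<Sum>j\<in>V - {t}. fst (z j))"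
    using key by (intro bexI[of _ z']) (simp_all add: prod_eq_iff)
qed

lemma even_set_triangle:
  assumes V: "finite V" "u \<in> V" "v \<in> V" "w \<in> V" and d: "u \<noteq> v" "u \<noteq> w" "v \<noteq> w" and t: "t \<in> V"
  shows "t \<in> even_set knot V (triangle_ext u v w R) \<longleftrightarrow> transpose v w t \<in> even_set knot V (triangle_ext u v w (flip {v, w} ` R))"
proof (rule parity_transfer_even_set)
  show "parity_transfer V (triangle_ext u v w R) t V (triangle_ext u v w (flip {v, w} ` R)) (transpose v w t)" by (rule parity_transfer_triangle[OF assms])
  have tV: "transpose v w t \<in> V" using V t by (auto simp: transpose_def)
  show "parity_transfer V (triangle_ext u v w (flip {v, w} ` R)) (transpose v w t) V (triangle_ext u v w R) t"
    using parity_transfer_triangle[OF V d tV, of "flip {v, w} ` R"] by simp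
qed (use V t in \<open>auto simp: transpose_def\<close>)

text \<open>
  On straight vectors the correspondence is the exchange of \<open>v\<close> and
  \<open>w\<close>.
\<close>

lemma card_straight_part_triangle:
  assumes d: "u \<noteq> v" "u \<noteq> w" "v \<noteq> w"
  shows "card (straight_part (triangle_ext u v w R)) = card (straight_part (triangle_ext u v w (flip {v, w} ` R)))"
proof -
  let ?s = "transpose v w"
  have sub: "(\<lambda>z. z \<circ> ?s) ` straight_part (triangle_ext u v w R) \<subseteq> straight_part (triangle_ext u v w (flip {v, w} ` R))" for R
  proof
    fix z' assume "z' \<in> (\<lambda>z. z \<circ> ?s) ` straight_part (triangle_ext u v w R)"
    then obtain r e where r: "r \<in> R" and c: "straight (triangle_vec u v w r e)" and z': "z' = triangle_vec u v w r e \<circ> ?s"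
      by (auto simp: straight_part_def in_triangle_ext)
    obtain X P where rv: "r v = (X, P)" by (cases "r v")
    obtain Y Q where rw: "r w = (Y, Q)" by (cases "r w")
    have c': "fst (triangle_vec u v w r e j) = snd (triangle_vec u v w r e j)" for j using c by (simp add: straight_def)
    have b: "X = P + e" "Y = Q + e" and b2: "e = X + Y"
      using c'[of v] c'[of w] c'[of u] by (simp_all add: triangle_vec_simps[OF d] rv rw)
    have b': "P = Y" "Q = X" using b unfolding b2 by (cases P; cases Q; cases X; cases Y; simp)+
    then have "triangle_vec u v w (flip {v, w} r) e j = z' j" for j
    proof -
      consider "j = u" | "j = v" | "j = w" | "j \<noteq> u" "j \<noteq> v" "j \<noteq> w" by blast
      then show ?thesis
        by cases (use d in \<open>simp_all add: z' triangle_vec_simps[OF d] flip2_simps rv rw transpose_def b2 b' add.commute\<close>)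
    qed
    then have "triangle_vec u v w (flip {v, w} r) e = z'" by blast
    moreover have "straight z'" using c by (simp add: z' straight_def)
    ultimately show "z' \<in> straight_part (triangle_ext u v w (flip {v, w} ` R))" using r by (auto simp: straight_part_def in_triangle_ext)
  qed
  have ss: "z \<circ> ?s \<circ> ?s = z" for z :: kvec by (simp add: fun_eq_iff)
  have "straight_part (triangle_ext u v w (flip {v, w} ` R)) \<subseteq> (\<lambda>z. z \<circ> ?s) ` straight_part (triangle_ext u v w R)"
  proof
    fix z assume "z \<in> straight_part (triangle_ext u v w (flip {v, w} ` R))"
    then have "z \<circ> ?s \<in> straight_part (triangle_ext u v w R)" using sub[of "flip {v, w} ` R"] by auto
    moreover have "z = z \<circ> ?s \<circ> ?s" by (simp only: ss)
    ultimately show "z \<in> (\<lambda>z. z \<circ> ?s) ` straight_part (triangle_ext u v w R)" by (intro rev_image_eqI)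
  qed
  with sub[of R] have "straight_part (triangle_ext u v w (flip {v, w} ` R)) = (\<lambda>z. z \<circ> ?s) ` straight_part (triangle_ext u v w R)" by blast
  moreover have "inj (\<lambda>z :: kvec. z \<circ> ?s)" by (rule inj_on_inverseI) (rule ss)
  ultimately show ?thesis by (simp add: card_image inj_on_subset)
qed

lemma graphic_isotropic:
  assumes "graphic V L" "z \<in> L" "w \<in> L"
  shows "(\<Sum>j\<in>V. fst (z j) * snd (w j) + snd (z j) * fst (w j)) = 0"
proof -
  obtain G F where G: "vertices G = V" "L = flip F ` lagrangian G" using assms by (auto simp: graphic_def)
  have "flip F z \<in> lagrangian G" "flip F w \<in> lagrangian G" using assms G by (simp_all add: in_flip_image)
  from lagrangian_isotropic[OF this]
  have "(\<Sum>j\<in>V. fst (flip F z j) * snd (flip F w j) + snd (flip F z j) * fst (flip F w j)) = 0"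
    by (simp add: G sum.distrib)
  moreover have "fst (flip F z j) * snd (flip F w j) + snd (flip F z j) * fst (flip F w j) =
    fst (z j) * snd (w j) + snd (z j) * fst (w j)" for j
    by (simp add: flip_def add.commute)
  ultimately show ?thesis by simp
qed

text \<open>
  The inverse matrix is symmetric; here this follows from isotropy, since \<open>m\<close> and
  \<open>n\<close> pair trivially outside \<open>s\<close> and \<open>t\<close>.
\<close>

lemma straight_off_sym:
  assumes L: "graphic V L" and V: "finite V" "s \<in> V" "t \<in> V" "s \<noteq> t"
    and m: "m \<in> L" "straight_off s m" "fst (m s) \<noteq> snd (m s)" and n: "n \<in> L" "straight_off t n" "fst (n t) \<noteq> snd (n t)"
  shows "fst (m t) = fst (n s)"
proof -
  have b: "p * q' + q * q' = q'" if "p \<noteq> q" for p q q' :: bit using that by (cases p; cases q) simp_all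
  have "(\<Sum>j\<in>V. fst (m j) * snd (n j) + snd (m j) * fst (n j)) =
    (\<Sum>j\<in>V. (if j = s then fst (n s) else 0) + (if j = t then fst (m t) else 0))"
  proof (rule sum.cong[OF refl])
    fix j assume "j \<in> V"
    have mj: "j \<noteq> s \<Longrightarrow> snd (m j) = fst (m j)" and nj: "j \<noteq> t \<Longrightarrow> snd (n j) = fst (n j)"
      using m(2) n(2) by (simp_all add: straight_off_def)
    consider "j = s" | "j = t" | "j \<noteq> s" "j \<noteq> t" by blast
    then show "fst (m j) * snd (n j) + snd (m j) * fst (n j) =
      (if j = s then fst (n s) else 0) + (if j = t then fst (m t) else 0)"
    proof cases
      case 1 then show ?thesis using V(4) nj b[OF m(3)] by simp
    next
      case 2 then show ?thesis using V(4) mj b[OF n(3), of "fst (m t)"] by (simp add: mult.commute add.commute)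
    next
      case 3 then show ?thesis using mj nj by simp
    qed
  qed
  also have "\<dots> = fst (n s) + fst (m t)" using V by (simp add: sum.distrib)
  finally show ?thesis using graphic_isotropic[OF L m(1) n(1)] by simp
qed

text \<open>
  The consequences of corank zero that the parity argument uses: uniqueness and existence of the
  vectors in \<open>even_knot\<close>.
\<close>

definition knotlike :: "nat set \<Rightarrow> kvec set \<Rightarrow> bool" where
  "knotlike V L \<longleftrightarrow> (\<forall>z\<in>L. straight z \<longrightarrow> z = 0) \<and> (\<forall>t\<in>V. \<exists>m\<in>L. straight_off t m \<and> fst (m t) \<noteq> snd (m t))"

lemma even_knot_iff:
  assumes L: "graphic V L" "knotlike V L" and m: "m \<in> L" "straight_off t m" "fst (m t) \<noteq> snd (m t)" and t: "t \<in> V"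
  shows "t \<in> even_knot V L \<longleftrightarrow> (\<Sum>j\<in>V - {t}. fst (m j)) = 0"
proof
  assume "t \<in> even_knot V L"
  then obtain n where n: "n \<in> L" "straight_off t n" "fst (n t) \<noteq> snd (n t)" "(\<Sum>j\<in>V - {t}. fst (n j)) = 0"
    by (auto simp: even_knot_def)
  have b: "p \<noteq> q \<Longrightarrow> p' \<noteq> q' \<Longrightarrow> p + p' = q + q'" for p q p' q' :: bit by (cases p; cases q; cases p'; cases q') simp_all
  have "straight (m + n)" unfolding straight_def
  proof
    fix j show "fst ((m + n) j) = snd ((m + n) j)"
      using m(2) n(2) b[OF m(3) n(3)] by (cases "j = t") (simp_all add: straight_off_def)
  qed
  moreover have "m + n \<in> L" by (rule graphic_add[OF L(1) m(1) n(1)])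
  ultimately have "m + n = 0" using L(2) by (simp add: knotlike_def)
  then have "m + n + n = n" by simp
  then have "m = n" by simp
  with n(4) show "(\<Sum>j\<in>V - {t}. fst (m j)) = 0" by simp
next
  assume "(\<Sum>j\<in>V - {t}. fst (m j)) = 0"
  then show "t \<in> even_knot V L" using m t by (auto simp: even_knot_def)
qed

lemma bit_sum3:
  fixes p q r p' q' r' :: bit
  assumes "p' + q' + r' = 1" "p + q + r = 1"
  shows "(p + p') + (q + q') + (r + r') = 0"
proof -
  have "(p + p') + (q + q') + (r + r') = (p + q + r) + (p' + q' + r')" by (simp only: add_ac)
  then show ?thesis using assms by simp
qed

lemma bit_triangle:
  fixes p q r x y z :: bit
  shows "p + x + y = 1 \<Longrightarrow> x + q + z = 0 \<Longrightarrow> y + z + r = 0 \<Longrightarrow> p + q + r = 1"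
  by (cases p; cases q; cases r; cases x; cases y; cases z) simp_all

text \<open>
  The vector \<open>\<tau>\<close> of the triangle is the sum of the three vectors defining the
  parities of \<open>u, v, w\<close>, because it has the same values modulo \<open>c\<close>.
  Summing first coordinates, the three degrees add up to the first coordinates within the
  triangle, which cancel in pairs by \<open>straight_off_sym\<close>.
\<close>

lemma triangle_parity_knot:
  assumes L: "graphic V (triangle_ext u v w R)" "knotlike V (triangle_ext u v w R)"
    and V: "finite V" "u \<in> V" "v \<in> V" "w \<in> V" and d: "u \<noteq> v" "u \<noteq> w" "v \<noteq> w" and R: "0 \<in> R"
  shows "u \<in> even_knot V (triangle_ext u v w R) \<longleftrightarrow> (v \<in> even_knot V (triangle_ext u v w R) \<longleftrightarrow> w \<in> even_knot V (triangle_ext u v w R))"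
proof -
  let ?L = "triangle_ext u v w R"
  obtain a where a: "a \<in> ?L" "straight_off u a" "fst (a u) \<noteq> snd (a u)" using L(2) V by (auto simp: knotlike_def)
  obtain b where b: "b \<in> ?L" "straight_off v b" "fst (b v) \<noteq> snd (b v)" using L(2) V by (auto simp: knotlike_def)
  obtain c where c: "c \<in> ?L" "straight_off w c" "fst (c w) \<noteq> snd (c w)" using L(2) V by (auto simp: knotlike_def)
  define \<tau> where "\<tau> = triangle_vec u v w 0 1"
  have \<tau>: "\<tau> \<in> ?L" "\<tau> u = (1, 0)" "\<tau> v = (0, 1)" "\<tau> w = (0, 1)" "\<And>j. j \<noteq> u \<Longrightarrow> j \<noteq> v \<Longrightarrow> j \<noteq> w \<Longrightarrow> \<tau> j = 0"
    using R triangle_vec_simps[OF d, where r = 0 and e = 1] by (auto simp: in_triangle_ext \<tau>_def)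
  have bb: "p \<noteq> q \<Longrightarrow> p + 1 = q" "p \<noteq> q \<Longrightarrow> p = q + 1" for p q :: bit by (cases p; cases q; simp)+
  \<comment> \<open>In corank zero it suffices that the difference is straight.\<close>
  have "straight (a + b + c + \<tau>)" unfolding straight_def
  proof
    fix j
    have ja: "j \<noteq> u \<Longrightarrow> fst (a j) = snd (a j)" and jb: "j \<noteq> v \<Longrightarrow> fst (b j) = snd (b j)"
      and jc: "j \<noteq> w \<Longrightarrow> fst (c j) = snd (c j)" using a b c by (simp_all add: straight_off_def)
    consider "j = u" | "j = v" | "j = w" | "j \<noteq> u" "j \<noteq> v" "j \<noteq> w" by blast
    then show "fst ((a + b + c + \<tau>) j) = snd ((a + b + c + \<tau>) j)"
    proof cases
      case 1
      then have "fst (b u) = snd (b u)" "fst (c u) = snd (c u)" using jb jc d by auto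
      moreover have "fst (a u) = snd (a u) + 1" using bb(2)[OF a(3)] .
      ultimately show ?thesis using 1 \<tau> by (simp add: add_ac)
    next
      case 2
      then have "fst (a v) = snd (a v)" "fst (c v) = snd (c v)" using ja jc d by auto
      moreover have "fst (b v) = snd (b v) + 1" using bb(2)[OF b(3)] .
      ultimately show ?thesis using 2 \<tau> by (simp add: add_ac)
    next
      case 3
      then have "fst (a w) = snd (a w)" "fst (b w) = snd (b w)" using ja jb d by auto
      moreover have "fst (c w) = snd (c w) + 1" using bb(2)[OF c(3)] .
      ultimately show ?thesis using 3 \<tau> by (simp add: add_ac)
    next
      case 4
      then show ?thesis using ja jb jc \<tau>(5) by simp
    qed
  qed
  moreover have "a + b + c + \<tau> \<in> ?L" using a b c \<tau>(1) graphic_add[OF L(1)] by blast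
  ultimately have "a + b + c + \<tau> = 0" using L(2) by (simp add: knotlike_def)
  then have "a + b + c + \<tau> + \<tau> = \<tau>" by simp
  then have abc: "a + b + c = \<tau>" by simp
  have sym: "fst (b u) = fst (a v)" "fst (c u) = fst (a w)" "fst (c v) = fst (b w)"
    using straight_off_sym[OF L(1) V(1,2,3) d(1) a b] straight_off_sym[OF L(1) V(1,2,4) d(2) a c]
      straight_off_sym[OF L(1) V(1,3,4) d(3) b c] by simp_all
  have e: "fst (a j) + fst (b j) + fst (c j) = fst (\<tau> j)" for j
    unfolding abc[symmetric] by simp
  \<comment> \<open>The off-diagonal first coordinates cancel in pairs.\<close>
  have "fst (a u) + fst (b v) + fst (c w) = 1"
    using e[of u] e[of v] e[of w] unfolding sym \<tau> fst_conv by (rule bit_triangle)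
  moreover have "(\<Sum>j\<in>V. fst (a j)) + (\<Sum>j\<in>V. fst (b j)) + (\<Sum>j\<in>V. fst (c j)) = 1"
  proof -
    have "(\<Sum>j\<in>V. fst (a j)) + (\<Sum>j\<in>V. fst (b j)) + (\<Sum>j\<in>V. fst (c j)) = (\<Sum>j\<in>V. fst (\<tau> j))"
      by (simp add: sum.distrib flip: e)
    also have "\<dots> = (\<Sum>j\<in>V. if j = u then 1 else 0)"
    proof (rule sum.cong[OF refl])
      fix j show "fst (\<tau> j) = (if j = u then 1 else 0)"
        using \<tau>(2-5) by (cases "j = u"; cases "j = v"; cases "j = w") simp_all
    qed
    finally show ?thesis using V by simp
  qed
  ultimately have "(\<Sum>j\<in>V - {u}. fst (a j)) + (\<Sum>j\<in>V - {v}. fst (b j)) + (\<Sum>j\<in>V - {w}. fst (c j)) = 0"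
    unfolding sum_minus_bit[OF V(1,2)] sum_minus_bit[OF V(1,3)] sum_minus_bit[OF V(1,4)]
    by (rule bit_sum3)
  then show ?thesis
    unfolding even_knot_iff[OF L a V(2)] even_knot_iff[OF L b V(3)] even_knot_iff[OF L c V(4)]
    by (cases "\<Sum>j\<in>V - {u}. fst (a j)"; cases "\<Sum>j\<in>V - {v}. fst (b j)"; cases "\<Sum>j\<in>V - {w}. fst (c j)") simp_all
qed

text \<open>
  The values of the straight vector at \<open>u, v, w\<close> sum to zero.
\<close>

lemma triangle_parity_link:
  assumes L: "straight_part (triangle_ext u v w R) = {0, \<kappa>}"
    and V: "u \<in> V" "v \<in> V" "w \<in> V" and d: "u \<noteq> v" "u \<noteq> w" "v \<noteq> w"
  shows "u \<in> even_link V (triangle_ext u v w R) \<longleftrightarrow> (v \<in> even_link V (triangle_ext u v w R) \<longleftrightarrow> w \<in> even_link V (triangle_ext u v w R))"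
proof -
  let ?L = "triangle_ext u v w R"
  have \<kappa>: "\<kappa> \<in> ?L" "straight \<kappa>" using L by (auto simp: straight_part_def)
  have ev: "t \<in> even_link V ?L \<longleftrightarrow> \<kappa> t = 0" if "t \<in> V" for t
  proof -
    have "t \<in> even_link V ?L \<longleftrightarrow> (\<forall>z\<in>straight_part ?L. z t = 0)" using that by (auto simp: even_link_def straight_part_def)
    then show ?thesis by (simp add: L)
  qed
  obtain r e where k: "\<kappa> = triangle_vec u v w r e" using \<kappa> by (auto simp: in_triangle_ext)
  have "snd (\<kappa> u) = fst (\<kappa> v) + fst (\<kappa> w)" unfolding k triangle_vec_simps[OF d] by simp
  then have "(snd (\<kappa> u) = 0) = ((fst (\<kappa> v) = 0) = (fst (\<kappa> w) = 0))"
    by (cases "fst (\<kappa> v)"; cases "fst (\<kappa> w)") simp_all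
  moreover have "fst (\<kappa> t) = snd (\<kappa> t)" for t using \<kappa>(2) by (simp add: straight_def)
  then have "\<kappa> t = 0 \<longleftrightarrow> fst (\<kappa> t) = 0" "\<kappa> t = 0 \<longleftrightarrow> snd (\<kappa> t) = 0" for t by (simp_all add: prod_eq_iff)
  ultimately show ?thesis unfolding ev[OF V(1)] ev[OF V(2)] ev[OF V(3)] by metis
qed


section \<open>State sums under the third move\<close>

text \<open>
  The space left when the double point at \<open>v, w\<close>, obtained by smoothing
  \<open>u\<close>, is removed. Its description is symmetric under interchanging the directions
  at \<open>v\<close> and \<open>w\<close>.
\<close>

definition triangle_diag :: "nat \<Rightarrow> nat \<Rightarrow> kvec set \<Rightarrow> kvec set" where
  "triangle_diag v w R = erase {v, w} ` {r \<in> R. r v = r w}"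

text \<open>
  The space left when the double point at \<open>u, w\<close>, obtained by smoothing
  \<open>v\<close>, is removed.
\<close>

definition triangle_skew :: "nat \<Rightarrow> nat \<Rightarrow> kvec set \<Rightarrow> kvec set" where
  "triangle_skew v w R = erase {v, w} ` {r \<in> R. fst (r v) = 0 \<and> snd (r w) = 0}"

lemma triangle_ext_minor_u:
  assumes d: "u \<noteq> v" "u \<noteq> w" "v \<noteq> w" and R: "\<And>r. r \<in> R \<Longrightarrow> r u = 0"
  shows "minor {u} {u} (triangle_ext u v w R) = R" "circle_free {u} {u} (triangle_ext u v w R)"
proof -
  have t: "compatible {u} {u} (triangle_vec u v w r e) \<longleftrightarrow> e = 0" for r e
    by (cases e) (auto simp: compatible_def state_dir_def triangle_vec_simps[OF d] zero_prod_def)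
  have o: "erase {u} (triangle_vec u v w r 0) = r" if "r \<in> R" for r
    by (rule HOL.ext) (simp add: erase_def triangle_vec_def R[OF that])
  have in_iff: "z \<in> triangle_ext u v w R \<and> compatible {u} {u} z \<longleftrightarrow> (\<exists>r\<in>R. z = triangle_vec u v w r 0)" for z
    using t by (auto simp: in_triangle_ext)
  show "minor {u} {u} (triangle_ext u v w R) = R"
  proof (intro Set.set_eqI iffI)
    fix x assume "x \<in> minor {u} {u} (triangle_ext u v w R)"
    then obtain z where "z \<in> triangle_ext u v w R \<and> compatible {u} {u} z" "x = erase {u} z" by (auto simp: in_minor)
    then show "x \<in> R" unfolding in_iff using o by auto
  next
    fix r assume r: "r \<in> R"
    then have "triangle_vec u v w r 0 \<in> triangle_ext u v w R \<and> compatible {u} {u} (triangle_vec u v w r 0)" unfolding in_iff by blast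
    then show "r \<in> minor {u} {u} (triangle_ext u v w R)" using o[OF r] unfolding in_minor by metis
  qed
  show "circle_free {u} {u} (triangle_ext u v w R)" unfolding circle_free_def
  proof (intro ballI impI)
    fix z assume z: "z \<in> triangle_ext u v w R" "compatible {u} {u} z" "erase {u} z = 0"
    then obtain r where r: "r \<in> R" "z = triangle_vec u v w r 0" using in_iff by blast
    with z(3) o have "r = 0" by simp
    then show "z = 0" unfolding r(2) by (auto simp: triangle_vec_def fun_eq_iff zero_prod_def)
  qed
qed

lemma triangle_vec_line:
  assumes d: "u \<noteq> v" "u \<noteq> w" "v \<noteq> w" and r: "r u = 0" and z: "erase {u, v, w} (triangle_vec u v w r e) = 0"
  shows "r = two_point v (r v) w (r w)"
proof (rule two_point_eqI[OF d(3)])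
  show "erase {v, w} r = 0" unfolding erase_eq_0_iff
  proof (intro allI impI)
    fix j assume j: "j \<notin> {v, w}"
    show "r j = 0"
    proof (cases "j = u")
      case False
      then have "triangle_vec u v w r e j = 0" using z j by (auto simp: erase_eq_0_iff)
      then show ?thesis using False j d by (simp add: triangle_vec_simps)
    qed (use r in simp)
  qed
qed simp_all

lemma bit_ex: "(\<exists>e :: bit. Q e) \<longleftrightarrow> Q 0 \<or> Q 1"
proof -
  have "e = 0 \<or> e = 1" for e :: bit by (cases e) simp_all
  then show ?thesis by metis
qed

lemma bit_pair_neq0: "(\<exists>p :: bit \<times> bit. p \<noteq> 0 \<and> Q p) \<longleftrightarrow> Q (0, 1) \<or> Q (1, 0) \<or> Q (1, 1)"
proof
  assume "\<exists>p :: bit \<times> bit. p \<noteq> 0 \<and> Q p"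
  then obtain p where p: "p \<noteq> 0" "Q p" by blast
  show "Q (0, 1) \<or> Q (1, 0) \<or> Q (1, 1)"
    by (rule bit_pair_cases[of p]) (use p in \<open>auto simp: zero_prod_def\<close>)
next
  assume "Q (0, 1) \<or> Q (1, 0) \<or> Q (1, 1)"
  then show "\<exists>p :: bit \<times> bit. p \<noteq> 0 \<and> Q p" by (metis pair_nonzero)
qed

text \<open>
  Smoothing \<open>u\<close> in direction \<open>b\<close> gives \<open>R\<close>. Smoothing it
  in direction \<open>a\<close> gives a space with \<open>b\<close> at \<open>v, w\<close>, a
  double point after a \<open>flip\<close>. The three reasons for which its contribution may
  vanish, a circle at \<open>u\<close> or an isolated edge in one of two forms, combine into one
  condition on \<open>R\<close> that is symmetric in the directions at \<open>v\<close> and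
  \<open>w\<close>.
\<close>

lemma state_sum_triangle_u:
  assumes L: "graphic (insert u V) (triangle_ext u v w R)" and R: "graphic V R" and V: "u \<notin> V" "v \<in> V" "w \<in> V" "v \<noteq> w"
    and S: "S \<subseteq> V" "finite S" "v \<in> S \<longleftrightarrow> w \<in> S"
  shows "state_sum (triangle_ext u v w R) (insert u S) =
    state_sum R S + (if \<exists>p. p \<noteq> 0 \<and> two_point v p w p \<in> R then 0 else state_sum (triangle_diag v w R) (S - {v, w}))"
proof -
  let ?L = "triangle_ext u v w R"
  have d: "u \<noteq> v" "u \<noteq> w" "v \<noteq> w" using V by auto
  have R0: "r u = 0" if "r \<in> R" for r using graphic_outside[OF R that V(1)] .
  have uS: "u \<notin> S" using S(1) V(1) by auto
  define N where "N = flip {v, w} ` minor {u} {} ?L"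
  have t: "compatible {u} {} (triangle_vec u v w r e) \<longleftrightarrow> fst (r v) = fst (r w)" for r e
    by (cases e) (auto simp: compatible_def state_dir_def triangle_vec_simps[OF d] zero_prod_def)
  have oj: "erase {u} (triangle_vec u v w r e) j = (if j = v then (fst (r v), snd (r v) + e) else if j = w then (fst (r w), snd (r w) + e) else r j)"
    if "r \<in> R" for r e j
    using d R0[OF that] by (auto simp: erase_def triangle_vec_def)
  have minor: "x \<in> minor {u} {} ?L \<longleftrightarrow> (\<exists>r\<in>R. \<exists>e. fst (r v) = fst (r w) \<and> x = erase {u} (triangle_vec u v w r e))" for x
    unfolding in_minor Bex_def in_triangle_ext using t by blast
  \<comment> \<open>The vector that splits off a circle is the one extending \<open>b\<close> at \<open>v, w\<close> by \<open>e = 1\<close>; the latter cancels both values.\<close>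
  have deg_u: "circle_free {u} {} ?L \<longleftrightarrow> two_point v (0, 1) w (0, 1) \<notin> R"
  proof
    assume n: "circle_free {u} {} ?L"
    show "two_point v (0, 1) w (0, 1) \<notin> R"
    proof
      assume r: "two_point v (0, 1) w (0, 1) \<in> R"
      let ?z = "triangle_vec u v w (two_point v (0, 1) w (0, 1)) 1"
      have "erase {u} ?z j = 0" for j unfolding oj[OF r] using d by (auto simp: two_point_def zero_prod_def)
      then have "erase {u} ?z = 0" by (simp add: fun_eq_iff)
      moreover have "compatible {u} {} ?z" using d by (simp add: t)
      moreover have "?z \<in> ?L" using r by (auto simp: in_triangle_ext)
      ultimately have "?z = 0" using n by (simp add: circle_free_def)
      then have "?z u = 0" by simp
      then show False using d by (simp add: triangle_vec_def zero_prod_def)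
    qed
  next
    assume b: "two_point v (0, 1) w (0, 1) \<notin> R"
    show "circle_free {u} {} ?L" unfolding circle_free_def
    proof (intro ballI impI)
      fix z assume z: "z \<in> ?L" "compatible {u} {} z" "erase {u} z = 0"
      then obtain r e where r: "r \<in> R" "z = triangle_vec u v w r e" by (auto simp: in_triangle_ext)
      have oz: "erase {u} (triangle_vec u v w r e) j = 0" for j using z(3) r by simp
      have "r v = (0, e)" "r w = (0, e)" using oz[of v] oz[of w] d unfolding oj[OF r(1)] by (simp_all add: prod_eq_iff)
      moreover have "r = two_point v (r v) w (r w)"
      proof (rule triangle_vec_line[where e = e and r = r, OF d R0[OF r(1)]])
        show "erase {u, v, w} (triangle_vec u v w r e) = 0"
        proof
          fix j show "erase {u, v, w} (triangle_vec u v w r e) j = 0 j" using oz[of j] by (auto simp: erase_def split: if_splits)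
        qed
      qed
      ultimately have rr: "r = two_point v (0, e) w (0, e)" by simp
      with b r(1) have "e = 0" by (cases e) auto
      then show "z = 0" unfolding r(2) rr by (auto simp: triangle_vec_def two_point_def fun_eq_iff zero_prod_def)
    qed
  qed
  have "state_sum (minor {u} {} ?L) S = (if two_point v (1, 0) w (1, 0) \<in> R \<or> two_point v (1, 1) w (1, 1) \<in> R then 0 else state_sum (triangle_diag v w R) (S - {v, w}))"
    if nd: "circle_free {u} {} ?L"
  proof -
    have gm: "graphic V (minor {u} {} ?L)" using graphic_minor[OF L, of "{u}" "{}"] V(1) by simp
    have gN: "graphic V N" unfolding N_def by (rule graphic_flip[OF gm])
    have inN: "x \<in> N \<longleftrightarrow> (\<exists>r\<in>R. \<exists>e. fst (r v) = fst (r w) \<and> flip {v, w} x = erase {u} (triangle_vec u v w r e))" for x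
      unfolding N_def in_flip_image minor ..
    have eqv: "two_point v p w q = erase {u} (triangle_vec u v w r e) \<longleftrightarrow> r = two_point v (fst p, snd p + e) w (fst q, snd q + e)"
      if r: "r \<in> R" for r e p q
    proof
      assume a: "two_point v p w q = erase {u} (triangle_vec u v w r e)"
      have aj: "two_point v p w q j = erase {u} (triangle_vec u v w r e) j" for j using a by simp
      have rv: "r v = (fst p, snd p + e)" "r w = (fst q, snd q + e)"
        using aj[of v] aj[of w] d unfolding oj[OF r] by (simp_all add: prod_eq_iff add.assoc)
      show "r = two_point v (fst p, snd p + e) w (fst q, snd q + e)"
      proof (rule two_point_eqI[OF d(3) _ rv])
        show "erase {v, w} r = 0" unfolding erase_eq_0_iff
        proof (intro allI impI)
          fix j assume "j \<notin> {v, w}"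
          then show "r j = 0" using aj[of j] unfolding oj[OF r] by (simp add: two_point_def)
        qed
      qed
    next
      assume rr: "r = two_point v (fst p, snd p + e) w (fst q, snd q + e)"
      show "two_point v p w q = erase {u} (triangle_vec u v w r e)"
      proof
        fix j show "two_point v p w q j = erase {u} (triangle_vec u v w r e) j"
          unfolding oj[OF r] using d by (simp add: rr two_point_def add.assoc prod_eq_iff)
      qed
    qed
    have vin: "two_point v p w q \<in> minor {u} {} ?L \<longleftrightarrow> fst p = fst q \<and> (\<exists>e. two_point v (fst p, snd p + e) w (fst q, snd q + e) \<in> R)" for p q
    proof
      assume "two_point v p w q \<in> minor {u} {} ?L"
      then obtain r e where r: "r \<in> R" "fst (r v) = fst (r w)" "two_point v p w q = erase {u} (triangle_vec u v w r e)" unfolding minor by blast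
      from r(3) have rr: "r = two_point v (fst p, snd p + e) w (fst q, snd q + e)" unfolding eqv[OF r(1)] .
      have "fst p = fst q" using r(2) d unfolding rr by simp
      then show "fst p = fst q \<and> (\<exists>e. two_point v (fst p, snd p + e) w (fst q, snd q + e) \<in> R)" using r(1) rr by metis
    next
      assume "fst p = fst q \<and> (\<exists>e. two_point v (fst p, snd p + e) w (fst q, snd q + e) \<in> R)"
      then obtain e where e: "fst p = fst q" "two_point v (fst p, snd p + e) w (fst q, snd q + e) \<in> R" by blast
      from eqv[OF e(2), of p q e] have "two_point v p w q = erase {u} (triangle_vec u v w (two_point v (fst p, snd p + e) w (fst q, snd q + e)) e)" by simp
      moreover have "fst (two_point v (fst p, snd p + e) w (fst q, snd q + e) v) = fst (two_point v (fst p, snd p + e) w (fst q, snd q + e) w)"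
        using e(1) d by simp
      ultimately show "two_point v p w q \<in> minor {u} {} ?L" unfolding minor using e(2) by blast
    qed
    have zR: "0 \<in> R" by (rule graphic_0[OF R])
    have f2: "flip {v, w} (two_point v p w q) = two_point v (prod.swap p) w (prod.swap q)" for p q
      by (simp add: flip_two_point[OF d(3)])
    \<comment> \<open>The extension of the zero vector by \<open>e = 1\<close>.\<close>
    have aN: "two_point v (1, 0) w (1, 0) \<in> N"
      unfolding N_def in_flip_image f2 vin using zR by (auto intro!: exI[of _ 1] simp: zero_prod_def[symmetric])
    \<comment> \<open>Up to the choice of \<open>e\<close>, the values of \<open>r\<close> at \<open>v, w\<close> are \<open>a\<close> or \<open>c\<close>.\<close>
    have bN: "two_point v (0, 1) w (0, 1) \<in> N \<longleftrightarrow> two_point v (1, 0) w (1, 0) \<in> R \<or> two_point v (1, 1) w (1, 1) \<in> R"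
      unfolding N_def in_flip_image f2 vin bit_ex by simp
    have M: "minor {v, w} {v, w} N = triangle_diag v w R"
    proof (intro Set.set_eqI iffI)
      fix x assume "x \<in> minor {v, w} {v, w} N"
      then obtain y where y: "y \<in> N" "compatible {v, w} {v, w} y" "x = erase {v, w} y" by (auto simp: in_minor)
      then obtain r e where r: "r \<in> R" "fst (r v) = fst (r w)" "flip {v, w} y = erase {u} (triangle_vec u v w r e)" using inN by blast
      have yj: "flip {v, w} y j = (if j = v then (fst (r v), snd (r v) + e) else if j = w then (fst (r w), snd (r w) + e) else r j)" for j
        unfolding r(3) by (rule oj[OF r(1)])
      have "snd (r v) + e = fst (y v)" "snd (r w) + e = fst (y w)" using yj[of v] yj[of w] d(3) by (simp_all add: flip_def prod_eq_iff)
      moreover have "fst (y v) = 0" "fst (y w) = 0" using y(2) by (auto simp: compatible_def state_dir_def)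
      ultimately have "r v = r w" using r(2) by (simp add: prod_eq_iff)
      moreover have "x = erase {v, w} r"
      proof
        fix j show "x j = erase {v, w} r j" using yj[of j] by (auto simp: y(3) erase_def flip_def)
      qed
      ultimately show "x \<in> triangle_diag v w R" using r(1) by (auto simp: triangle_diag_def)
    next
      fix x assume "x \<in> triangle_diag v w R"
      then obtain r where r: "r \<in> R" "r v = r w" "x = erase {v, w} r" by (auto simp: triangle_diag_def)
      define y where "y = flip {v, w} (erase {u} (triangle_vec u v w r (snd (r v))))"
      have "flip {v, w} y = erase {u} (triangle_vec u v w r (snd (r v)))" by (simp add: y_def)
      moreover have "fst (r v) = fst (r w)" using r(2) by simp
      ultimately have "y \<in> N" unfolding inN using r(1) by blast
      moreover have yj: "y j = (if j = v \<or> j = w then (0, fst (r v)) else r j)" for j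
      proof -
        have yy: "y j = (if j \<in> {v, w} then prod.swap (erase {u} (triangle_vec u v w r (snd (r v))) j) else erase {u} (triangle_vec u v w r (snd (r v))) j)"
          unfolding y_def flip_apply ..
        have "snd (r w) = snd (r v)" "fst (r w) = fst (r v)" using r(2) by simp_all
        then show ?thesis unfolding yy oj[OF r(1)] by simp
      qed
      have "compatible {v, w} {v, w} y"
        by (cases "fst (r v)") (simp_all add: compatible_def state_dir_def zero_prod_def yj)
      moreover have "x = erase {v, w} y"
      proof
        fix j show "x j = erase {v, w} y j" by (simp add: r(3) erase_def yj)
      qed
      ultimately show "x \<in> minor {v, w} {v, w} N" unfolding in_minor by blast
    qed
    have "state_sum (minor {u} {} ?L) S = state_sum N S" unfolding N_def by (simp add: state_sum_flip[OF S(2)])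
    also have "\<dots> = (if two_point v (0, 1) w (0, 1) \<in> N then 0 else state_sum (triangle_diag v w R) (S - {v, w}))"
      unfolding state_sum_double_point[OF gN d(3) aN S] M ..
    finally show ?thesis unfolding bN .
  qed
  moreover have eb: "minor {u} {u} ?L = R" "circle_free {u} {u} ?L"
    by (rule triangle_ext_minor_u[OF d], rule R0, assumption)+
  ultimately show ?thesis
    unfolding state_sum_insert[OF S(2) uS] bit_pair_neq0 using eb deg_u by (simp add: add.commute)
qed

lemma triangle_diag_flip: "triangle_diag v w (flip {v, w} ` R) = triangle_diag v w R"
proof -
  have "flip {v, w} r v = flip {v, w} r w \<longleftrightarrow> r v = r w" for r by (auto simp: flip_def prod_eq_iff)
  then have "{r \<in> flip {v, w} ` R. r v = r w} = flip {v, w} ` {r \<in> R. r v = r w}" by auto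
  moreover have "erase {v, w} (flip {v, w} r) = erase {v, w} r" for r by (rule HOL.ext) (simp add: erase_def flip_def)
  ultimately show ?thesis by (simp add: triangle_diag_def image_image)
qed

lemma triangle_skew_flip: "triangle_skew w v (flip {v, w} ` R) = triangle_skew v w R"
proof -
  have "fst (flip {v, w} r w) = 0 \<and> snd (flip {v, w} r v) = 0 \<longleftrightarrow> fst (r v) = 0 \<and> snd (r w) = 0" for r by (auto simp: flip_def)
  then have "{r \<in> flip {v, w} ` R. fst (r w) = 0 \<and> snd (r v) = 0} = flip {v, w} ` {r \<in> R. fst (r v) = 0 \<and> snd (r w) = 0}" by auto
  moreover have "erase {w, v} (flip {v, w} r) = erase {v, w} r" for r by (rule HOL.ext) (simp add: erase_def flip_def)
  ultimately show ?thesis by (simp add: triangle_skew_def image_image)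
qed

text \<open>
  Smoothing \<open>v\<close> in direction \<open>b\<close> makes \<open>u, w\<close> a double
  point, up to a \<open>flip\<close>. The condition under which its contribution vanishes is
  invariant under exchanging \<open>v\<close> and \<open>w\<close> together with their
  directions.
\<close>

lemma state_sum_triangle_v:
  assumes L: "graphic (insert u V) (triangle_ext u v w R)" and R: "graphic V R" and V: "u \<notin> V" "v \<in> V" "w \<in> V" "v \<noteq> w"
    and S: "S \<subseteq> V - {v, w}" "finite S"
  shows "state_sum (triangle_ext u v w R) (insert v S) = state_sum (minor {v} {} (triangle_ext u v w R)) S +
    (if \<exists>p q. (p, q) \<noteq> 0 \<and> two_point v (0, p) w (q, 0) \<in> R then 0 else state_sum (triangle_skew v w R) S)"
proof -
  let ?L = "triangle_ext u v w R"
  have d: "u \<noteq> v" "u \<noteq> w" "v \<noteq> w" using V by auto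
  have R0: "r u = 0" if "r \<in> R" for r using graphic_outside[OF R that V(1)] .
  have vS: "v \<notin> S" "u \<notin> S" "w \<notin> S" using S(1) V(1) by auto
  note e1 = triangle_vec_simps[OF d]
  \<comment> \<open>The value at \<open>u\<close> shows \<open>e = 0\<close>, and then the direction at \<open>v\<close> leaves no nonzero value.\<close>
  have nd_a: "circle_free {v} {} ?L" unfolding circle_free_def
  proof (intro ballI impI)
    fix z assume z: "z \<in> ?L" "compatible {v} {} z" "erase {v} z = 0"
    then obtain r e where r: "r \<in> R" "z = triangle_vec u v w r e" by (auto simp: in_triangle_ext)
    have zj: "triangle_vec u v w r e j = 0" if "j \<noteq> v" for j using z(3) r(2) that by (auto simp: erase_eq_0_iff)
    have "snd (r v) = e" using z(2) by (auto simp: r(2) compatible_def state_dir_def e1 zero_prod_def)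
    moreover have "e = 0" "fst (r v) = fst (r w)" using zj[of u] d by (simp_all add: e1 zero_prod_def)
    moreover have "fst (r w) = 0" "snd (r w) = e" using zj[of w] d by (simp_all add: e1 zero_prod_def)
    ultimately have rr: "r v = 0" "r w = 0" "e = 0" by (simp_all add: prod_eq_iff)
    moreover have "r = two_point v (r v) w (r w)"
    proof (rule triangle_vec_line[where e = e and r = r, OF d R0[OF r(1)]])
      show "erase {u, v, w} (triangle_vec u v w r e) = 0"
      proof
        fix j show "erase {u, v, w} (triangle_vec u v w r e) j = 0 j" using zj[of j] by (auto simp: erase_def)
      qed
    qed
    ultimately have "r = 0" by simp
    then show "z = 0" unfolding r(2) rr(3) by (auto simp: triangle_vec_def fun_eq_iff zero_prod_def)
  qed
  have tb: "compatible {v} {v} (triangle_vec u v w r e) \<longleftrightarrow> fst (r v) = 0" for r e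
    by (cases "snd (r v) + e") (auto simp: compatible_def state_dir_def e1 zero_prod_def)
  have oj: "erase {v} (triangle_vec u v w r e) j = (if j = v then 0 else if j = u then (e, fst (r w)) else if j = w then (fst (r w), snd (r w) + e) else r j)"
    if "fst (r v) = 0" for r e j
    using d that by (auto simp: erase_def triangle_vec_def)
  have minor: "x \<in> minor {v} {v} ?L \<longleftrightarrow> (\<exists>r\<in>R. \<exists>e. fst (r v) = 0 \<and> x = erase {v} (triangle_vec u v w r e))" for x
    unfolding in_minor Bex_def in_triangle_ext using tb by blast
  have nd_b: "circle_free {v} {v} ?L \<longleftrightarrow> two_point v (0, 1) w (0, 0) \<notin> R"
  proof
    assume n: "circle_free {v} {v} ?L"
    show "two_point v (0, 1) w (0, 0) \<notin> R"
    proof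
      assume r: "two_point v (0, 1) w (0, 0) \<in> R"
      let ?z = "triangle_vec u v w (two_point v (0, 1) w (0, 0)) 0"
      have "erase {v} ?z j = 0" for j using d by (subst oj) (auto simp: two_point_def zero_prod_def)
      then have "erase {v} ?z = 0" by (simp add: fun_eq_iff)
      moreover have "compatible {v} {v} ?z" by (simp add: tb)
      moreover have "?z \<in> ?L" using r by (auto simp: in_triangle_ext)
      ultimately have "?z = 0" using n by (simp add: circle_free_def)
      then have "?z v = 0" by simp
      then show False using d by (simp add: e1 zero_prod_def)
    qed
  next
    assume b: "two_point v (0, 1) w (0, 0) \<notin> R"
    show "circle_free {v} {v} ?L" unfolding circle_free_def
    proof (intro ballI impI)
      fix z assume z: "z \<in> ?L" "compatible {v} {v} z" "erase {v} z = 0"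
      then obtain r e where r: "r \<in> R" "z = triangle_vec u v w r e" by (auto simp: in_triangle_ext)
      have f0: "fst (r v) = 0" using z(2) tb r(2) by simp
      have oz: "erase {v} (triangle_vec u v w r e) j = 0" for j using z(3) r by simp
      have e0: "e = 0" "fst (r w) = 0" "snd (r w) = e" using oz[of u] oz[of w] d unfolding oj[where r = r, OF f0] by (simp_all add: prod_eq_iff)
      have "erase {u, v, w} (triangle_vec u v w r e) = 0"
      proof
        fix j show "erase {u, v, w} (triangle_vec u v w r e) j = 0 j" using oz[of j] by (auto simp: erase_def split: if_splits)
      qed
      then have "r = two_point v (r v) w (r w)" by (rule triangle_vec_line[where r = r and e = e, OF d R0[OF r(1)]])
      moreover have "r w = (0, 0)" "r v = (0, snd (r v))" using e0 f0 by (simp_all add: prod_eq_iff)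
      ultimately have rr: "r = two_point v (0, snd (r v)) w (0, 0)" by metis
      have "snd (r v) = 0"
      proof (rule ccontr)
        assume "snd (r v) \<noteq> 0"
        then have "snd (r v) = 1" by simp
        with rr b r(1) show False by metis
      qed
      then have "r = 0" using rr by (simp add: zero_prod_def[symmetric])
      then show "z = 0" unfolding r(2) e0(1) by (auto simp: triangle_vec_def fun_eq_iff zero_prod_def)
    qed
  qed
  define N where "N = flip {w} ` minor {v} {v} ?L"
  have "state_sum (minor {v} {v} ?L) S = (if two_point v (0, 0) w (1, 0) \<in> R \<or> two_point v (0, 1) w (1, 0) \<in> R then 0 else state_sum (triangle_skew v w R) S)"
  proof -
    have gm: "graphic (insert u V - {v}) (minor {v} {v} ?L)" using graphic_minor[OF L, of "{v}" "{v}"] V by simp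
    have gN: "graphic (insert u V - {v}) N" unfolding N_def by (rule graphic_flip[OF gm])
    \<comment> \<open>The value of \<open>r\<close> at \<open>v\<close> is forgotten, which is why \<open>t\<close> is arbitrary.\<close>
    have vin: "two_point u p w q \<in> minor {v} {v} ?L \<longleftrightarrow> snd p = fst q \<and> (\<exists>t. two_point v (0, t) w (fst q, snd q + fst p) \<in> R)" for p q
    proof
      assume "two_point u p w q \<in> minor {v} {v} ?L"
      then obtain r e where r: "r \<in> R" "fst (r v) = 0" "two_point u p w q = erase {v} (triangle_vec u v w r e)" unfolding minor by blast
      have aj: "two_point u p w q j = (if j = v then 0 else if j = u then (e, fst (r w)) else if j = w then (fst (r w), snd (r w) + e) else r j)" for j
        unfolding r(3) by (rule oj) (rule r(2))
      have pq: "p = (e, fst (r w))" "q = (fst (r w), snd (r w) + e)" using aj[of u] aj[of w] d by simp_all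
      have "r = two_point v (r v) w (r w)"
      proof (rule two_point_eqI[OF d(3)])
        show "erase {v, w} r = 0" unfolding erase_eq_0_iff
        proof (intro allI impI)
          fix j assume j: "j \<notin> {v, w}"
          show "r j = 0" using aj[of j] j R0[OF r(1)] by (cases "j = u") (auto simp: two_point_def)
        qed
      qed simp_all
      moreover have "r v = (0, snd (r v))" "r w = (fst q, snd q + fst p)" using r(2) by (simp_all add: prod_eq_iff pq add.assoc)
      ultimately have "two_point v (0, snd (r v)) w (fst q, snd q + fst p) \<in> R" using r(1) by metis
      then show "snd p = fst q \<and> (\<exists>t. two_point v (0, t) w (fst q, snd q + fst p) \<in> R)" using pq by auto
    next
      assume "snd p = fst q \<and> (\<exists>t. two_point v (0, t) w (fst q, snd q + fst p) \<in> R)"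
      then obtain t where t: "snd p = fst q" "two_point v (0, t) w (fst q, snd q + fst p) \<in> R" by blast
      let ?r = "two_point v (0, t) w (fst q, snd q + fst p)"
      have "two_point u p w q = erase {v} (triangle_vec u v w ?r (fst p))"
      proof
        fix j show "two_point u p w q j = erase {v} (triangle_vec u v w ?r (fst p)) j"
          using d t(1) by (subst oj) (auto simp: two_point_def prod_eq_iff add.assoc)
      qed
      moreover have "fst (?r v) = 0" by simp
      ultimately show "two_point u p w q \<in> minor {v} {v} ?L" unfolding minor using t(2) by blast
    qed
    have zR: "two_point v (0, 0) w (0, 0) \<in> R" using graphic_0[OF R] by (simp add: zero_prod_def[symmetric])
    have fl: "flip {w} (two_point u p w q) = two_point u p w (prod.swap q)" for p q
      using d by (simp add: flip_two_point)
    have aN: "two_point u (1, 0) w (1, 0) \<in> N"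
      unfolding N_def in_flip_image fl vin using zR by auto
    have bN: "two_point u (0, 1) w (0, 1) \<in> N \<longleftrightarrow> two_point v (0, 0) w (1, 0) \<in> R \<or> two_point v (0, 1) w (1, 0) \<in> R"
      unfolding N_def in_flip_image fl vin bit_ex by simp
    have M: "minor {u, w} {u, w} N = triangle_skew v w R"
    proof (intro Set.set_eqI iffI)
      fix x assume "x \<in> minor {u, w} {u, w} N"
      then obtain y where y: "y \<in> N" "compatible {u, w} {u, w} y" "x = erase {u, w} y" by (auto simp: in_minor)
      then obtain r e where r: "r \<in> R" "fst (r v) = 0" "flip {w} y = erase {v} (triangle_vec u v w r e)"
        unfolding N_def in_flip_image minor by blast
      have yj: "flip {w} y j = (if j = v then 0 else if j = u then (e, fst (r w)) else if j = w then (fst (r w), snd (r w) + e) else r j)" for j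
        unfolding r(3) by (rule oj) (rule r(2))
      have "e = fst (y u)" "snd (r w) + e = fst (y w)" using yj[of u] yj[of w] d by (simp_all add: flip_def prod_eq_iff)
      moreover have "fst (y u) = 0" "fst (y w) = 0" using y(2) by (auto simp: compatible_def state_dir_def)
      ultimately have "snd (r w) = 0" by simp
      moreover have "x = erase {v, w} r"
      proof
        fix j show "x j = erase {v, w} r j" using yj[of j] d R0[OF r(1)] by (auto simp: y(3) erase_def flip_def)
      qed
      ultimately show "x \<in> triangle_skew v w R" using r by (auto simp: triangle_skew_def)
    next
      fix x assume "x \<in> triangle_skew v w R"
      then obtain r where r: "r \<in> R" "fst (r v) = 0" "snd (r w) = 0" "x = erase {v, w} r" by (auto simp: triangle_skew_def)
      define y where "y = flip {w} (erase {v} (triangle_vec u v w r 0))"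
      have "y \<in> N" unfolding N_def in_flip_image minor using r by (auto simp: y_def)
      moreover have yj: "y j = (if j = v then 0 else if j = u then (0, fst (r w)) else if j = w then (0, fst (r w)) else r j)" for j
      proof -
        have yy: "y j = (if j \<in> {w} then prod.swap (erase {v} (triangle_vec u v w r 0) j) else erase {v} (triangle_vec u v w r 0) j)"
          unfolding y_def flip_apply ..
        show ?thesis unfolding yy oj[where r = r, OF r(2)] using d r(3) by simp
      qed
      have "compatible {u, w} {u, w} y"
        using d by (cases "fst (r w)") (simp_all add: compatible_def state_dir_def zero_prod_def yj)
      moreover have "x = erase {u, w} y"
      proof
        fix j show "x j = erase {u, w} y j" using R0[OF r(1)] by (simp add: r(4) erase_def yj)
      qed
      ultimately show "x \<in> minor {u, w} {u, w} N" unfolding in_minor by blast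
    qed
    have S': "S \<subseteq> insert u V - {v}" "u \<in> S \<longleftrightarrow> w \<in> S" using S(1) vS by auto
    have "state_sum (minor {v} {v} ?L) S = state_sum N S" unfolding N_def by (simp add: state_sum_flip[OF S(2)])
    also have "\<dots> = (if two_point u (0, 1) w (0, 1) \<in> N then 0 else state_sum (triangle_skew v w R) (S - {u, w}))"
      unfolding state_sum_double_point[OF gN d(2) aN S'(1) S(2) S'(2)] M ..
    also have "S - {u, w} = S" using vS by auto
    finally show ?thesis unfolding bN .
  qed
  moreover have "(\<exists>p q. (p, q) \<noteq> 0 \<and> two_point v (0, p) w (q, 0) \<in> R) \<longleftrightarrow>
    two_point v (0, 1) w (0, 0) \<in> R \<or> two_point v (0, 0) w (1, 0) \<in> R \<or> two_point v (0, 1) w (1, 0) \<in> R"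
    unfolding bit_ex by (auto simp: zero_prod_def)
  ultimately show ?thesis unfolding state_sum_insert[OF S(2) vS(1)] using nd_a nd_b by simp
qed

text \<open>
  Smoothing \<open>v\<close> in direction \<open>a\<close> forces \<open>e = P\<close> and
  leaves the values \<open>(P, X + Y)\<close> at \<open>u\<close> and \<open>(Y, Q + P)\<close>
  at \<open>w\<close>. On the other side, smoothing \<open>w\<close> in direction
  \<open>a\<close> forces \<open>e = Y\<close> and leaves \<open>(Y, P + Q)\<close> at
  \<open>u\<close> and \<open>(P, X + Y)\<close> at \<open>v\<close>.
\<close>

lemma triangle_ext_minor_relabel:
  assumes V: "u \<noteq> v" "u \<noteq> w" "v \<noteq> w"
  obtains \<pi> where "bij \<pi>" "\<And>j. j \<notin> {u, v, w} \<Longrightarrow> \<pi> j = j" "\<pi> ` {u, v, w} = {u, v, w}"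
    "minor {w} {} (triangle_ext u w v (flip {v, w} ` R)) = relabel \<pi> (minor {v} {} (triangle_ext u v w R))"
proof -
  define \<pi> where "\<pi> j = (if j = u then w else if j = v then u else if j = w then v else j)" for j
  have p: "\<pi> u = w" "\<pi> v = u" "\<pi> w = v" "\<And>j. j \<noteq> u \<Longrightarrow> j \<noteq> v \<Longrightarrow> j \<noteq> w \<Longrightarrow> \<pi> j = j" using V by (auto simp: \<pi>_def)
  have b: "bij \<pi>"
  proof (rule bijI')
    show "\<pi> x = \<pi> y \<longleftrightarrow> x = y" for x y using V by (auto simp: \<pi>_def)
    show "\<exists>x. y = \<pi> x" for y
    proof -
      consider "y = u" | "y = v" | "y = w" | "y \<noteq> u" "y \<noteq> v" "y \<noteq> w" by blast
      then show ?thesis using p by cases metis+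
    qed
  qed
  have V': "u \<noteq> w" "u \<noteq> v" "w \<noteq> v" using V by auto
  have t: "compatible {v} {} (triangle_vec u v w r e) \<longleftrightarrow> e = snd (r v)" for r e
    by (cases "fst (r v)"; cases "snd (r v)"; cases e) (auto simp: compatible_def state_dir_def triangle_vec_simps[OF V] zero_prod_def)
  have t': "compatible {w} {} (triangle_vec u w v (flip {v, w} r) e) \<longleftrightarrow> e = fst (r w)" for r e
    by (cases "fst (r w)"; cases "snd (r w)"; cases e) (auto simp: compatible_def state_dir_def triangle_vec_simps[OF V'] flip2_simps zero_prod_def)
  have e: "erase {w} (triangle_vec u w v (flip {v, w} r) (fst (r w))) = erase {v} (triangle_vec u v w r (snd (r v))) \<circ> \<pi>" for r
  proof
    fix j
    consider "j = u" | "j = v" | "j = w" | "j \<noteq> u" "j \<noteq> v" "j \<noteq> w" by blast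
    then show "erase {w} (triangle_vec u w v (flip {v, w} r) (fst (r w))) j = (erase {v} (triangle_vec u v w r (snd (r v))) \<circ> \<pi>) j"
    proof cases
      case 1 then show ?thesis using V by (simp add: p erase_def triangle_vec_def flip2_simps add.commute)
    next
      case 2 then show ?thesis using V by (simp add: p erase_def triangle_vec_def flip2_simps add.commute)
    next
      case 3 then show ?thesis using V by (simp add: p erase_def)
    next
      case 4 then show ?thesis by (simp add: p erase_def triangle_vec_def flip2_simps)
    qed
  qed
  have "{z \<in> triangle_ext u w v (flip {v, w} ` R). compatible {w} {} z} = (\<lambda>r. triangle_vec u w v (flip {v, w} r) (fst (r w))) ` R"
  proof (intro Set.set_eqI iffI)
    fix z assume "z \<in> {z \<in> triangle_ext u w v (flip {v, w} ` R). compatible {w} {} z}"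
    then obtain r e where "r \<in> R" "z = triangle_vec u w v (flip {v, w} r) e" "compatible {w} {} z" by (auto simp: triangle_ext_def)
    moreover from this have "e = fst (r w)" using t'[of r e] by simp
    ultimately show "z \<in> (\<lambda>r. triangle_vec u w v (flip {v, w} r) (fst (r w))) ` R" by simp
  next
    fix z assume "z \<in> (\<lambda>r. triangle_vec u w v (flip {v, w} r) (fst (r w))) ` R"
    then obtain r where "r \<in> R" "z = triangle_vec u w v (flip {v, w} r) (fst (r w))" by blast
    then show "z \<in> {z \<in> triangle_ext u w v (flip {v, w} ` R). compatible {w} {} z}" using t' by (auto simp: triangle_ext_def)
  qed
  moreover have "{z \<in> triangle_ext u v w R. compatible {v} {} z} = (\<lambda>r. triangle_vec u v w r (snd (r v))) ` R"
  proof (intro Set.set_eqI iffI)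
    fix z assume "z \<in> {z \<in> triangle_ext u v w R. compatible {v} {} z}"
    then obtain r e where "r \<in> R" "z = triangle_vec u v w r e" "compatible {v} {} z" by (auto simp: in_triangle_ext)
    moreover from this have "e = snd (r v)" using t[of r e] by simp
    ultimately show "z \<in> (\<lambda>r. triangle_vec u v w r (snd (r v))) ` R" by simp
  next
    fix z assume "z \<in> (\<lambda>r. triangle_vec u v w r (snd (r v))) ` R"
    then obtain r where "r \<in> R" "z = triangle_vec u v w r (snd (r v))" by blast
    then show "z \<in> {z \<in> triangle_ext u v w R. compatible {v} {} z}" using t by (auto simp: triangle_ext_def)
  qed
  ultimately have m: "minor {w} {} (triangle_ext u w v (flip {v, w} ` R)) = relabel \<pi> (minor {v} {} (triangle_ext u v w R))"
    by (simp add: minor_def relabel_def image_image e)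
  show thesis
  proof (rule that[OF b _ _ m])
    show "\<pi> ` {u, v, w} = {u, v, w}" by (auto simp: p)
    show "\<pi> j = j" if "j \<notin> {u, v, w}" for j using that by (intro p(4)) auto
  qed
qed


lemma state_sum_triangle_move_u:
  assumes L: "graphic (insert u V) (triangle_ext u v w R)" "graphic (insert u V) (triangle_ext u v w (flip {v, w} ` R))"
    and R: "graphic V R" and V: "u \<notin> V" "v \<in> V" "w \<in> V" "v \<noteq> w"
    and S: "S \<subseteq> V" "finite S" "v \<in> S \<longleftrightarrow> w \<in> S"
  shows "state_sum (triangle_ext u v w R) (insert u S) = state_sum (triangle_ext u v w (flip {v, w} ` R)) (insert u S)"
proof -
  have "two_point v p w p \<in> flip {v, w} ` R \<longleftrightarrow> two_point v (prod.swap p) w (prod.swap p) \<in> R" for p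
    unfolding in_flip_image by (simp add: flip_two_point[OF V(4)])
  then have "(\<exists>p. p \<noteq> 0 \<and> two_point v p w p \<in> flip {v, w} ` R) \<longleftrightarrow> (\<exists>p. p \<noteq> 0 \<and> two_point v p w p \<in> R)"
    unfolding bit_pair_neq0 by auto
  then show ?thesis
    unfolding state_sum_triangle_u[OF L(1) R V S] state_sum_triangle_u[OF L(2) graphic_flip[OF R] V S] triangle_diag_flip state_sum_flip[OF S(2)] by simp
qed

lemma state_sum_triangle_move_v:
  assumes L: "graphic (insert u V) (triangle_ext u v w R)" "graphic (insert u V) (triangle_ext u v w (flip {v, w} ` R))"
    and R: "graphic V R" and V: "u \<notin> V" "v \<in> V" "w \<in> V" "v \<noteq> w"
    and S: "S \<subseteq> V - {v, w}" "finite S"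
  shows "state_sum (triangle_ext u v w R) (insert v S) = state_sum (triangle_ext u v w (flip {v, w} ` R)) (insert w S)"
proof -
  let ?R' = "flip {v, w} ` R"
  have d: "u \<noteq> v" "u \<noteq> w" "v \<noteq> w" and V': "w \<noteq> v" using V by auto
  have L': "graphic (insert u V) (triangle_ext u w v ?R')" using L(2) by (simp add: triangle_ext_commute)
  have S': "S \<subseteq> V - {w, v}" using S(1) by auto
  obtain \<pi> where \<pi>: "bij \<pi>" "\<And>j. j \<notin> {u, v, w} \<Longrightarrow> \<pi> j = j" "\<pi> ` {u, v, w} = {u, v, w}"
    "minor {w} {} (triangle_ext u w v ?R') = relabel \<pi> (minor {v} {} (triangle_ext u v w R))"
    by (rule triangle_ext_minor_relabel[OF d]) blast
  have "\<pi> -` S = S"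
  proof (rule Set.set_eqI)
    fix j
    show "j \<in> \<pi> -` S \<longleftrightarrow> j \<in> S"
    proof (cases "j \<in> {u, v, w}")
      case True
      then have "\<pi> j \<in> {u, v, w}" using \<pi>(3) by blast
      then show ?thesis using True S(1) V(1) by auto
    next
      case False
      then show ?thesis using \<pi>(2)[OF False] by simp
    qed
  qed
  moreover have "graphic (insert u V - {v}) (minor {v} {} (triangle_ext u v w R))"
    using graphic_minor[OF L(1), of "{v}" "{}"] V by simp
  moreover have "S \<subseteq> insert u V - {v}" using S(1) by auto
  ultimately have a: "state_sum (minor {w} {} (triangle_ext u w v ?R')) S = state_sum (minor {v} {} (triangle_ext u v w R)) S"
    unfolding \<pi>(4) using state_sum_relabel[OF \<pi>(1) _ _ S(2)] by metis
  have "two_point w (0, p) v (q, 0) \<in> ?R' \<longleftrightarrow> two_point v (0, q) w (p, 0) \<in> R" for p q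
    unfolding in_flip_image two_point_commute[OF V'] flip_two_point[OF V(4)] by simp
  note vec_iff = this
  have D: "(\<exists>p q. (p, q) \<noteq> 0 \<and> two_point w (0, p) v (q, 0) \<in> ?R') \<longleftrightarrow> (\<exists>p q. (p, q) \<noteq> 0 \<and> two_point v (0, p) w (q, 0) \<in> R)"
    unfolding bit_ex vec_iff by (simp add: zero_prod_def) blast
  show ?thesis
    unfolding state_sum_triangle_v[OF L(1) R V S] triangle_ext_commute[of u v w ?R']
      state_sum_triangle_v[OF L' graphic_flip[OF R] V(1,3,2) V' S' S(2)] a D triangle_skew_flip ..
qed

text \<open>
  An even number of odd vertices among three leaves four cases: all even, or exactly one even.
\<close>

lemma state_sum_triangle_move:
  assumes L: "graphic (insert u V) (triangle_ext u v w R)" "graphic (insert u V) (triangle_ext u v w (flip {v, w} ` R))"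
    and R: "graphic V R" and V: "finite V" "u \<notin> V" "v \<in> V" "w \<in> V" "v \<noteq> w"
    and S: "S \<subseteq> insert u V" "S' \<subseteq> insert u V"
    and par: "u \<in> S \<longleftrightarrow> (v \<in> S \<longleftrightarrow> w \<in> S)"
    and tr: "\<And>t. t \<in> insert u V \<Longrightarrow> t \<in> S \<longleftrightarrow> transpose v w t \<in> S'"
  shows "state_sum (triangle_ext u v w R) S = state_sum (triangle_ext u v w (flip {v, w} ` R)) S'"
proof -
  have d: "u \<noteq> v" "u \<noteq> w" using V by auto
  have fS: "finite S" using S(1) V(1) finite_subset by blast
  have tu: "u \<in> S \<longleftrightarrow> u \<in> S'" using tr[of u] d by (simp add: transpose_def)
  have tvw: "v \<in> S \<longleftrightarrow> w \<in> S'" "w \<in> S \<longleftrightarrow> v \<in> S'" using tr[of v] tr[of w] V by simp_all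
  have to: "t \<in> S \<longleftrightarrow> t \<in> S'" if "t \<noteq> v" "t \<noteq> w" for t
    using tr[of t] that S by (cases "t \<in> insert u V") (auto simp: transpose_def)
  show ?thesis
  proof (cases "u \<in> S")
    case True
    then have vw: "v \<in> S \<longleftrightarrow> w \<in> S" using par by simp
    have "S' = S"
    proof (rule Set.set_eqI)
      fix t show "t \<in> S' \<longleftrightarrow> t \<in> S" using to[of t] tvw vw by metis
    qed
    moreover have "insert u (S - {u}) = S" using True by auto
    moreover have "S - {u} \<subseteq> V" "finite (S - {u})" "v \<in> S - {u} \<longleftrightarrow> w \<in> S - {u}" using S(1) fS vw d by auto
    from state_sum_triangle_move_u[OF L R V(2-5) this]
    have "state_sum (triangle_ext u v w R) (insert u (S - {u})) = state_sum (triangle_ext u v w (flip {v, w} ` R)) (insert u (S - {u}))" .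
    ultimately show ?thesis by (simp only:)
  next
    case uS: False
    then have uS': "u \<notin> S'" using tu by simp
    show ?thesis
    proof (cases "v \<in> S")
      case True
      then have w: "w \<notin> S" using par uS by simp
      define S0 where "S0 = S - {v}"
      have s: "S = insert v S0" using True by (auto simp: S0_def)
      have s': "S' = insert w S0"
      proof (rule Set.set_eqI)
        fix t show "t \<in> S' \<longleftrightarrow> t \<in> insert w S0"
          using to[of t] tvw True w V(5) by (cases "t = v"; cases "t = w") (auto simp: S0_def)
      qed
      have "S0 \<subseteq> V - {v, w}" "finite S0" using S(1) uS w fS by (auto simp: S0_def)
      from state_sum_triangle_move_v[OF L R V(2-5) this] show ?thesis unfolding s s' .
    next
      case False
      then have w: "w \<in> S" using par uS by simp
      define S0 where "S0 = S - {w}"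
      have s: "S = insert w S0" using w by (auto simp: S0_def)
      have s': "S' = insert v S0"
      proof (rule Set.set_eqI)
        fix t show "t \<in> S' \<longleftrightarrow> t \<in> insert v S0"
          using to[of t] tvw False w V(5) by (cases "t = v"; cases "t = w") (auto simp: S0_def)
      qed
      have S0: "S0 \<subseteq> V - {w, v}" "finite S0" using S(1) uS False fS by (auto simp: S0_def)
      have c: "triangle_ext u v w R = triangle_ext u w v R" "triangle_ext u v w (flip {v, w} ` R) = triangle_ext u w v (flip {w, v} ` R)"
        by (simp_all add: triangle_ext_commute[of u v w] insert_commute)
      show ?thesis unfolding s s' c
        by (rule state_sum_triangle_move_v[OF L[unfolded c] R V(2,4,3) V(5)[symmetric] S0])
    qed
  qed
qed

lemma omega3_obtain:
  assumes "omega3 G H"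
  obtains u v w R where "u \<notin> vertices G - {u}" "u \<in> vertices G" "v \<in> vertices G" "w \<in> vertices G"
    "u \<noteq> v" "u \<noteq> w" "v \<noteq> w" "graphic (vertices G - {u}) R" "vertices H = vertices G"
    "lagrangian G = triangle_ext u v w R" "lagrangian H = flip {v, w} ` triangle_ext u v w (flip {v, w} ` R)"
proof -
  obtain u v w where V: "u \<in> vertices G" "v \<in> vertices G" "w \<in> vertices G" and d: "u \<noteq> v" "u \<noteq> w" "v \<noteq> w"
    and fr: "framing G u = 0" "framing G v = 0" "framing G w = 0" and nb: "nbhd G u = {v, w}"
    and H: "H = mk_graph (vertices G) (\<lambda>x y. adj G x y \<noteq>
      (x = u \<and> y \<in> (closed_nbhd G v - closed_nbhd G w) \<union> (closed_nbhd G w - closed_nbhd G v) \<or>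
       y = u \<and> x \<in> (closed_nbhd G v - closed_nbhd G w) \<union> (closed_nbhd G w - closed_nbhd G v))) (framing G)"
    using assms unfolding omega3_def Let_def by (simp only: distinct.simps list.set) blast
  define T where "T = (closed_nbhd G v - closed_nbhd G w) \<union> (closed_nbhd G w - closed_nbhd G v)"
  have HV: "vertices H = vertices G" by (simp add: H)
  have u_adj: "adj G u j \<longleftrightarrow> j = v \<or> j = w" for j using nb by (auto simp: nbhd_def)
  have sym: "adj G x y \<Longrightarrow> adj G y x" for x y by (auto dest: adjD)
  have irr: "\<not> adj G x x" for x by (auto dest: adjD)
  have vertex_row: "entry G u j = of_bool (j = v \<or> j = w)" for j
    using fr(1) d by (auto simp: entry_def u_adj)
  have T: "j \<in> T \<longleftrightarrow> (j = v \<or> adj G v j) \<noteq> (j = w \<or> adj G w j)" for j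
    by (auto simp: T_def closed_nbhd_def nbhd_def)
  have adjH: "adj H x y \<longleftrightarrow> x \<in> vertices G \<and> y \<in> vertices G \<and> x \<noteq> y \<and> adj G x y \<noteq> (x = u \<and> y \<in> T \<or> y = u \<and> x \<in> T)" for x y
    unfolding H T_def[symmetric] using sym[of x y] sym[of y x] by auto
  have frH: "framing H x = framing G x" for x by (simp add: H framing_outside)
  have uu: "entry H u u = 0" by (simp add: entry_def frH fr)
  have rest: "entry H i j = entry G i j" if "i \<noteq> u" "j \<noteq> u" for i j
    using that adjD[of G i j] by (auto simp: entry_def frH adjH)
  have rowH: "entry H u j = entry G v j + entry G w j" if j: "j \<noteq> u" for j
  proof (cases "j \<in> vertices G")
    case False
    then show ?thesis using HV by (simp add: entry_outside)
  next
    case True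
    have "entry H u j = of_bool ((j = v \<or> j = w) \<noteq> (j \<in> T))"
      using j True V by (simp add: entry_def adjH u_adj)
    also have "\<dots> = of_bool (adj G v j) + of_bool (adj G w j)"
      using d(3) irr[of v] irr[of w] sym[of v w] sym[of w v] unfolding T
      by (cases "j = v"; cases "j = w"; cases "adj G v j"; cases "adj G w j") simp_all
    also have "\<dots> = entry G v j + entry G w j" using fr irr by (auto simp: entry_def)
    finally show ?thesis .
  qed
  let ?R = "lagrangian (delete_vertices {u} G)"
  have "graphic (vertices G - {u}) ?R" using graphic_lagrangian[of "delete_vertices {u} G"] by simp
  moreover have "lagrangian G = triangle_ext u v w ?R" by (rule lagrangian_omega3_before[OF V(1) d V(2,3) vertex_row])
  moreover have "lagrangian H = flip {v, w} ` triangle_ext u v w (flip {v, w} ` ?R)"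
    by (rule lagrangian_omega3_after[OF V(1) d V(2,3) HV uu rowH rest]) (use fr in \<open>simp_all add: framing_entry\<close>)
  ultimately show thesis using that[of u v w ?R] V d HV by simp
qed

lemma state_sum_omega3:
  assumes "omega3 G H"
    and par: "knot \<Longrightarrow> knotlike (vertices G) (lagrangian G)" "\<not> knot \<Longrightarrow> \<exists>\<kappa>. straight_part (lagrangian G) = {0, \<kappa>}"
  shows "state_sum (lagrangian G) (even_set knot (vertices G) (lagrangian G)) = state_sum (lagrangian H) (even_set knot (vertices H) (lagrangian H))"
proof -
  obtain u v w R where V: "u \<notin> vertices G - {u}" "u \<in> vertices G" "v \<in> vertices G" "w \<in> vertices G"
    and d: "u \<noteq> v" "u \<noteq> w" "v \<noteq> w" and R: "graphic (vertices G - {u}) R" and VH: "vertices H = vertices G"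
    and L: "lagrangian G = triangle_ext u v w R" "lagrangian H = flip {v, w} ` triangle_ext u v w (flip {v, w} ` R)"
    by (rule omega3_obtain[OF assms(1)])
  let ?V = "vertices G"
  define L' where "L' = triangle_ext u v w (flip {v, w} ` R)"
  have iV: "insert u (?V - {u}) = ?V" using V by auto
  have gL: "graphic ?V (triangle_ext u v w R)" using graphic_lagrangian[of G] by (simp add: L)
  have "graphic ?V (lagrangian H)" using graphic_lagrangian[of H] by (simp add: VH)
  then have "graphic ?V (flip {v, w} ` lagrangian H)" by (rule graphic_flip)
  then have gL': "graphic ?V (triangle_ext u v w (flip {v, w} ` R))" unfolding L(2) by simp
  have sub: "even_set knot ?V (triangle_ext u v w R) \<subseteq> ?V" "even_set knot ?V L' \<subseteq> ?V" by (rule even_set_subset)+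
  have fin: "finite (even_set knot ?V L')" using sub(2) finite_subset[OF _ finite_vertices] by blast
  have parity: "u \<in> even_set knot ?V (triangle_ext u v w R) \<longleftrightarrow> (v \<in> even_set knot ?V (triangle_ext u v w R) \<longleftrightarrow> w \<in> even_set knot ?V (triangle_ext u v w R))"
  proof (cases knot)
    case True
    have "0 \<in> R" by (rule graphic_0[OF R])
    with triangle_parity_knot[OF gL par(1)[OF True, unfolded L(1)] finite_vertices V(2-4) d] True
    show ?thesis by (simp add: even_set_def)
  next
    case False
    then obtain \<kappa> where "straight_part (triangle_ext u v w R) = {0, \<kappa>}" using par(2) L(1) by auto
    from triangle_parity_link[OF this V(2-4) d] False show ?thesis by (simp add: even_set_def)
  qed
  have vw: "v \<in> ?V - {u}" "w \<in> ?V - {u}" using V d by auto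
  have "state_sum (triangle_ext u v w R) (even_set knot ?V (triangle_ext u v w R)) = state_sum L' (even_set knot ?V L')"
    unfolding L'_def
  proof (rule state_sum_triangle_move[where V = "?V - {u}" and u = u and v = v and w = w and R = R, unfolded iV])
    show "t \<in> even_set knot ?V (triangle_ext u v w R) \<longleftrightarrow> transpose v w t \<in> even_set knot ?V (triangle_ext u v w (flip {v, w} ` R))" if "t \<in> ?V" for t
      by (rule even_set_triangle[OF finite_vertices V(2-4) d that])
    show "even_set knot ?V (triangle_ext u v w (flip {v, w} ` R)) \<subseteq> ?V" by (rule even_set_subset)
  qed (fact gL gL' R vw V(1) d(3) sub parity | simp)+
  also have "\<dots> = state_sum (flip {v, w} ` L') (even_set knot ?V (flip {v, w} ` L'))"
    unfolding even_set_flip state_sum_flip[OF fin] ..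
  finally show ?thesis by (simp add: L VH L'_def)
qed

lemma card_straight_part_omega3:
  assumes "omega3 G H"
  shows "card (straight_part (lagrangian G)) = card (straight_part (lagrangian H))"
proof -
  obtain u v w R where d: "u \<noteq> v" "u \<noteq> w" "v \<noteq> w"
    and L: "lagrangian G = triangle_ext u v w R" "lagrangian H = flip {v, w} ` triangle_ext u v w (flip {v, w} ` R)"
    by (rule omega3_obtain[OF assms])
  show ?thesis unfolding L straight_part_flip by (rule card_straight_part_triangle[OF d])
qed


section \<open>Corank and kernels\<close>

text \<open>
  Over two elements, the linear combinations of an independent set are the sums of its subsets.
\<close>

lemma card_image_rank:
  fixes A :: "bit mat"
  assumes A: "A \<in> carrier_mat n nc"
  shows "card {y \<in> carrier_vec n. \<exists>x\<in>carrier_vec nc. A *\<^sub>v x = y} = 2 ^ vec_space.rank n A"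
proof -
  interpret vec_space "TYPE(bit)" n .
  have C: "set (cols A) \<subseteq> carrier_vec n" using cols_dim A by blast
  obtain U where U: "maximal U (\<lambda>T. T \<subseteq> set (cols A) \<and> lin_indpt T)"
  proof -
    have "lin_indpt {}" by (auto simp: lin_dep_def)
    then show thesis
      using maximal_exists_superset[of "set (cols A)" "\<lambda>T. T \<subseteq> set (cols A) \<and> lin_indpt T" "{}"] that by auto
  qed
  then have Uc: "U \<subseteq> set (cols A)" and Ui: "lin_indpt U" by (auto simp: maximal_def)
  have fU: "finite U" using Uc finite_subset by blast
  have UC: "U \<subseteq> carrier_vec n" using Uc C by blast
  have r: "rank A = card U" by (rule rank_card_indpt[OF A U])
  have "span U = span (set (cols A))"
  proof (rule ccontr)
    assume ne: "span U \<noteq> span (set (cols A))"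
    have "span U \<subseteq> span (set (cols A))" using span_is_monotone Uc by metis
    then have "\<not> set (cols A) \<subseteq> span U"
      using ne UC C span_subsetI span_span by (metis subset_antisym span_is_monotone)
    then obtain s where s: "s \<in> set (cols A)" "s \<notin> span U" by blast
    have sU: "s \<notin> U" using s(2) UC in_own_span by blast
    have "s \<in> carrier_vec n" using s(1) C by blast
    then have "lin_indpt (U \<union> {s})" using lin_dep_iff_in_span[of U s] UC Ui s(2) sU by auto
    with sU show False using U s(1) Uc unfolding maximal_def by blast
  qed
  also have "\<dots> = {y \<in> carrier_vec n. \<exists>x\<in>carrier_vec nc. A *\<^sub>v x = y}"
    using col_space_eq[OF A] A by (simp add: col_space_def)
  finally have sp: "{y \<in> carrier_vec n. \<exists>x\<in>carrier_vec nc. A *\<^sub>v x = y} = span U" ..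
  let ?ind = "\<lambda>T v. of_bool (v \<in> T) :: bit"
  have "bij_betw (\<lambda>T. lincomb (?ind T) U) (Pow U) (span U)"
  proof (rule bij_betw_imageI)
    show "inj_on (\<lambda>T. lincomb (?ind T) U) (Pow U)"
    proof (rule inj_onI, rule ccontr)
      fix S T assume ST: "S \<in> Pow U" "T \<in> Pow U" "lincomb (?ind S) U = lincomb (?ind T) U" "S \<noteq> T"
      then obtain v where v: "v \<in> U" "(v \<in> S) \<noteq> (v \<in> T)" by blast
      define a where "a w = ?ind S w + ?ind T w" for w
      have "lincomb a U = 0\<^sub>v n"
      proof (rule eq_vecI)
        fix i assume "i < dim_vec (0\<^sub>v n :: bit vec)"
        then have i: "i < n" by simp
        have "lincomb a U $ i = lincomb (?ind S) U $ i + lincomb (?ind T) U $ i"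
          unfolding lincomb_index[OF i UC] a_def by (simp add: distrib_right sum.distrib)
        then show "lincomb a U $ i = 0\<^sub>v n $ i" using ST(3) i by simp
      qed (simp add: lincomb_dim[OF fU UC])
      moreover have "a v \<noteq> 0" using v by (auto simp: a_def)
      ultimately have "lin_dep U"
        using lin_dep_crit[OF fU subset_refl _ v(1), of a] by auto
      with Ui show False by blast
    qed
    show "(\<lambda>T. lincomb (?ind T) U) ` Pow U = span U"
    proof (intro Set.set_eqI iffI)
      fix y assume "y \<in> (\<lambda>T. lincomb (?ind T) U) ` Pow U"
      then show "y \<in> span U" using finite_span[OF fU UC] by auto
    next
      fix y assume "y \<in> span U"
      then obtain a where a: "y = lincomb a U" using finite_span[OF fU UC] by auto
      have "lincomb a U = lincomb (?ind {v \<in> U. a v = 1}) U"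
      proof (rule eq_vecI)
        fix i assume "i < dim_vec (lincomb (?ind {v \<in> U. a v = 1}) U)"
        then have i: "i < n" by (simp add: lincomb_dim[OF fU UC])
        show "lincomb a U $ i = lincomb (?ind {v \<in> U. a v = 1}) U $ i"
          unfolding lincomb_index[OF i UC] by (intro sum.cong refl) (auto simp: mult.commute)
      qed (simp add: lincomb_dim[OF fU UC])
      then show "y \<in> (\<lambda>T. lincomb (?ind T) U) ` Pow U" unfolding a by blast
    qed
  qed
  then have "card (span U) = card (Pow U)" by (metis bij_betw_same_card)
  then show ?thesis unfolding sp r using card_Pow[OF fU] by simp
qed

lemma card_carrier_vec_bit: "card (carrier_vec n :: bit vec set) = 2 ^ n" "finite (carrier_vec n :: bit vec set)"
proof -
  have "bij_betw (\<lambda>T. vec n (\<lambda>i. of_bool (i \<in> T)) :: bit vec) (Pow {..<n}) (carrier_vec n)"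
  proof (rule bij_betw_byWitness[where f' = "\<lambda>x. {i. i < n \<and> x $ i = 1}"])
    show "\<forall>T\<in>Pow {..<n}. {i. i < n \<and> (vec n (\<lambda>i. of_bool (i \<in> T)) :: bit vec) $ i = 1} = T" by auto
    show "\<forall>x\<in>carrier_vec n. vec n (\<lambda>i. of_bool (i \<in> {i. i < n \<and> x $ i = 1})) = (x :: bit vec)"
      by (auto intro!: eq_vecI)
  qed auto
  note b = this
  show "card (carrier_vec n :: bit vec set) = 2 ^ n" using bij_betw_same_card[OF b] by (simp add: card_Pow)
  show "finite (carrier_vec n :: bit vec set)" using bij_betw_finite[OF b] by simp
qed

definition vec_kernel :: "bit mat \<Rightarrow> bit vec set" where
  "vec_kernel A = {x \<in> carrier_vec (dim_col A). A *\<^sub>v x = 0\<^sub>v (dim_row A)}"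

text \<open>
  All nonempty fibres of a linear map have the size of its kernel. Counting replaces the
  rank-nullity theorem, and sizes of kernels are transported by bijections that need not be
  linear.
\<close>

lemma card_vec_kernel:
  fixes A :: "bit mat"
  assumes A: "A \<in> carrier_mat n n"
  shows "card (vec_kernel A) = 2 ^ corank A"
proof -
  let ?C = "carrier_vec n :: bit vec set"
  let ?f = "\<lambda>x. A *\<^sub>v x"
  have dims: "dim_row A = n" "dim_col A = n" using A by auto
  have fib: "card {x \<in> ?C. ?f x = y} = card (vec_kernel A)" if y: "y \<in> ?f ` ?C" for y
  proof -
    obtain x0 where x0: "x0 \<in> ?C" "y = ?f x0" using y by blast
    have bit_self: "x + x = 0\<^sub>v n" if "x \<in> ?C" for x using that by (auto intro!: eq_vecI)
    have xx: "x + x0 + x0 = x" if "x \<in> ?C" for x using that x0(1) by (auto intro!: eq_vecI simp: add.assoc)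
    have "bij_betw (\<lambda>x. x + x0) (vec_kernel A) {x \<in> ?C. ?f x = y}"
    proof (rule bij_betw_byWitness[where f' = "\<lambda>x. x + x0"])
      show "\<forall>x\<in>vec_kernel A. x + x0 + x0 = x" "\<forall>x\<in>{x \<in> ?C. ?f x = y}. x + x0 + x0 = x"
        using xx dims by (auto simp: vec_kernel_def)
      have yC: "y \<in> carrier_vec n" using A x0 by auto
      show "(\<lambda>x. x + x0) ` vec_kernel A \<subseteq> {x \<in> ?C. ?f x = y}"
        using x0 A yC by (auto simp: vec_kernel_def dims mult_add_distrib_mat_vec[OF A])
      show "(\<lambda>x. x + x0) ` {x \<in> ?C. ?f x = y} \<subseteq> vec_kernel A"
        using x0 A yC bit_self by (auto simp: vec_kernel_def dims mult_add_distrib_mat_vec[OF A])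
    qed
    then show ?thesis by (metis bij_betw_same_card)
  qed
  have "card ?C = (\<Sum>x\<in>?C. 1)" by simp
  also have "\<dots> = (\<Sum>y\<in>?f ` ?C. \<Sum>x\<in>{x \<in> ?C. ?f x = y}. 1)"
    by (rule sum.image_gen[OF card_carrier_vec_bit(2)])
  also have "\<dots> = (\<Sum>y\<in>?f ` ?C. card (vec_kernel A))" by (rule sum.cong[OF refl]) (simp add: fib)
  also have "\<dots> = card (?f ` ?C) * card (vec_kernel A)" by simp
  also have "?f ` ?C = {y \<in> carrier_vec n. \<exists>x\<in>carrier_vec n. A *\<^sub>v x = y}" using A by auto
  also have "card \<dots> = 2 ^ vec_space.rank n A" by (rule card_image_rank[OF A])
  finally have e: "2 ^ n = 2 ^ vec_space.rank n A * card (vec_kernel A)" by (simp add: card_carrier_vec_bit)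
  have "vec_space.rank n A \<le> n" by (rule vec_space.rank_le_nc[OF A])
  then have "(2::nat) ^ n = 2 ^ vec_space.rank n A * 2 ^ (n - vec_space.rank n A)" by (simp flip: power_add)
  with e have "card (vec_kernel A) = 2 ^ (n - vec_space.rank n A)" by simp
  then show ?thesis by (simp add: corank_def dims)
qed


section \<open>Parity in terms of matrices\<close>

definition vertex_at :: "framed_graph \<Rightarrow> nat \<Rightarrow> nat" where
  "vertex_at G i = vertex_list G ! i"

definition position_of :: "framed_graph \<Rightarrow> nat \<Rightarrow> nat" where
  "position_of G = the_inv_into {..<num_vertices G} (vertex_at G)"

lemma bij_vertex_at: "bij_betw (vertex_at G) {..<num_vertices G} (vertices G)"
proof -
  have "distinct (vertex_list G)" "set (vertex_list G) = vertices G" "length (vertex_list G) = num_vertices G"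
    by (simp_all add: vertex_list_def num_vertices_def)
  then show ?thesis unfolding vertex_at_def[abs_def] by (metis bij_betw_nth)
qed

lemma vertex_at_position_of: "j \<in> vertices G \<Longrightarrow> vertex_at G (position_of G j) = j" "j \<in> vertices G \<Longrightarrow> position_of G j < num_vertices G"
proof -
  assume j: "j \<in> vertices G"
  have im: "vertex_at G ` {..<num_vertices G} = vertices G" and inj: "inj_on (vertex_at G) {..<num_vertices G}"
    using bij_vertex_at by (auto simp: bij_betw_def)
  show "vertex_at G (position_of G j) = j" unfolding position_of_def by (rule f_the_inv_into_f[OF inj]) (use j im in simp)
  show "position_of G j < num_vertices G" using the_inv_into_into[OF inj _ subset_refl, of j] j im by (simp add: position_of_def)
qed

lemma position_of_vertex_at: "i < num_vertices G \<Longrightarrow> position_of G (vertex_at G i) = i" "i < num_vertices G \<Longrightarrow> vertex_at G i \<in> vertices G"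
  using bij_vertex_at[of G] by (auto simp: position_of_def bij_betw_def the_inv_into_f_f)

lemma sum_vertex_at: "(\<Sum>i<num_vertices G. f (vertex_at G i)) = (\<Sum>j\<in>vertices G. f j)"
  by (rule sum.reindex_bij_betw[OF bij_vertex_at])

definition coordinate :: "framed_graph \<Rightarrow> bit vec \<Rightarrow> nat \<Rightarrow> bit" where
  "coordinate G x j = (if j \<in> vertices G then x $ position_of G j else 0)"

text \<open>
  The vector of the space with the given first coordinates.
\<close>

definition graph_vec :: "framed_graph \<Rightarrow> bit vec \<Rightarrow> kvec" where
  "graph_vec G x j = (coordinate G x j, \<Sum>k\<in>vertices G. entry G j k * coordinate G x k)"

lemma graph_vec_in_lagrangian: "graph_vec G x \<in> lagrangian G"
  by (rule lagrangianI) (simp_all add: graph_vec_def coordinate_def entry_outside zero_prod_def)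

lemma fst_graph_vec [simp]: "fst (graph_vec G x j) = coordinate G x j"
  by (simp add: graph_vec_def)

lemma shifted_carrier: "shifted_matrix G \<in> carrier_mat (num_vertices G) (num_vertices G)"
  by (simp add: shifted_matrix_def adj_matrix_def)

lemma shifted_index:
  assumes "i < num_vertices G" "k < num_vertices G"
  shows "shifted_matrix G $$ (i, k) = entry G (vertex_at G i) (vertex_at G k) + of_bool (i = k)"
proof -
  have "vertex_at G i = vertex_at G k \<longleftrightarrow> i = k" using position_of_vertex_at(1) assms by metis
  then show ?thesis using assms by (auto simp: shifted_matrix_def adj_matrix_def entry_def vertex_at_def)
qed

lemma shifted_mult:
  assumes i: "i < num_vertices G" and x: "x \<in> carrier_vec (num_vertices G)"
  shows "(shifted_matrix G *\<^sub>v x) $ i = snd (graph_vec G x (vertex_at G i)) + fst (graph_vec G x (vertex_at G i))"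
proof -
  let ?n = "num_vertices G"
  have "(shifted_matrix G *\<^sub>v x) $ i = (\<Sum>k<?n. shifted_matrix G $$ (i, k) * x $ k)"
    using i x shifted_carrier[of G] by (simp add: scalar_prod_def atLeast0LessThan)
  also have "\<dots> = (\<Sum>k<?n. entry G (vertex_at G i) (vertex_at G k) * coordinate G x (vertex_at G k) + (if k = i then x $ i else 0))"
    by (intro sum.cong) (use i in \<open>auto simp: shifted_index coordinate_def position_of_vertex_at distrib_right\<close>)
  also have "\<dots> = (\<Sum>k<?n. entry G (vertex_at G i) (vertex_at G k) * coordinate G x (vertex_at G k)) + x $ i"
    using i by (simp add: sum.distrib)
  also have "(\<Sum>k<?n. entry G (vertex_at G i) (vertex_at G k) * coordinate G x (vertex_at G k)) = (\<Sum>j\<in>vertices G. entry G (vertex_at G i) j * coordinate G x j)"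
    by (rule sum_vertex_at)
  finally show ?thesis using i by (simp add: graph_vec_def coordinate_def position_of_vertex_at)
qed

lemma B_mult:
  assumes i: "i < num_vertices G" and j: "j < num_vertices G" and x: "x \<in> carrier_vec (num_vertices G)"
  shows "(B_matrix G i *\<^sub>v x) $ j = (shifted_matrix G *\<^sub>v x) $ j + (if j = i then x $ i else 0)"
proof -
  let ?n = "num_vertices G"
  have U: "unit_matrix ?n i \<in> carrier_mat ?n ?n" by (simp add: unit_matrix_def)
  have B: "B_matrix G i = shifted_matrix G + unit_matrix ?n i" by (simp add: B_matrix_def shifted_matrix_def)
  have "(unit_matrix ?n i *\<^sub>v x) $ j = (\<Sum>k<?n. of_bool (j = i \<and> k = i) * x $ k)"
    using j x by (simp add: unit_matrix_def scalar_prod_def atLeast0LessThan)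
  also have "\<dots> = (\<Sum>k<?n. if k = i then (if j = i then x $ i else 0) else 0)"
    by (intro sum.cong) auto
  finally have "(unit_matrix ?n i *\<^sub>v x) $ j = (if j = i then x $ i else 0)" using i by simp
  moreover have "(B_matrix G i *\<^sub>v x) $ j = (shifted_matrix G *\<^sub>v x) $ j + (unit_matrix ?n i *\<^sub>v x) $ j"
    unfolding B add_mult_distrib_mat_vec[OF shifted_carrier U x] using j U by (simp add: unit_matrix_def)
  ultimately show ?thesis by simp
qed

lemma graph_vec_cases:
  assumes "z \<in> lagrangian G"
  obtains x where "x \<in> carrier_vec (num_vertices G)" "z = graph_vec G x"
proof -
  define x where "x = vec (num_vertices G) (\<lambda>i. fst (z (vertex_at G i)))"
  have "z = graph_vec G x"
  proof (rule lagrangian_eqI[OF assms graph_vec_in_lagrangian])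
    fix j show "fst (z j) = fst (graph_vec G x j)"
      using lagrangian_outside[OF assms, of j] by (cases "j \<in> vertices G") (auto simp: coordinate_def x_def vertex_at_position_of)
  qed
  moreover have "x \<in> carrier_vec (num_vertices G)" by (simp add: x_def)
  ultimately show thesis using that by blast
qed

lemma graph_vec_inj:
  assumes "x \<in> carrier_vec (num_vertices G)" "y \<in> carrier_vec (num_vertices G)" "graph_vec G x = graph_vec G y"
  shows "x = y"
proof (rule eq_vecI)
  fix i assume "i < dim_vec y"
  then have i: "i < num_vertices G" using assms(2) by simp
  have "fst (graph_vec G x (vertex_at G i)) = fst (graph_vec G y (vertex_at G i))" by (simp only: assms(3))
  then show "x $ i = y $ i" using i by (simp add: coordinate_def position_of_vertex_at)
qed (use assms in simp)

lemma all_vertices: "(\<forall>j\<in>vertices G. P j) \<longleftrightarrow> (\<forall>i<num_vertices G. P (vertex_at G i))"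
  by (metis position_of_vertex_at(2) vertex_at_position_of)

lemma graph_vec_outside: "j \<notin> vertices G \<Longrightarrow> graph_vec G x j = 0"
  using lagrangian_outside[OF graph_vec_in_lagrangian] by blast

lemma vec_kernel_shifted: "vec_kernel (shifted_matrix G) = {x \<in> carrier_vec (num_vertices G). graph_vec G x \<in> straight_part (lagrangian G)}"
proof -
  have "shifted_matrix G *\<^sub>v x = 0\<^sub>v (num_vertices G) \<longleftrightarrow> straight (graph_vec G x)" if x: "x \<in> carrier_vec (num_vertices G)" for x
  proof -
    have "straight (graph_vec G x) \<longleftrightarrow> (\<forall>j\<in>vertices G. fst (graph_vec G x j) = snd (graph_vec G x j))"
      unfolding straight_def using graph_vec_outside[of _ G x] by (metis fst_zero snd_zero)
    also have "\<dots> \<longleftrightarrow> (\<forall>i<num_vertices G. (shifted_matrix G *\<^sub>v x) $ i = 0)"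
      unfolding all_vertices using shifted_mult[OF _ x] by auto
    also have "\<dots> \<longleftrightarrow> shifted_matrix G *\<^sub>v x = 0\<^sub>v (num_vertices G)"
      using shifted_carrier[of G] by (auto simp: vec_eq_iff)
    finally show ?thesis ..
  qed
  then show ?thesis using shifted_carrier[of G] graph_vec_in_lagrangian[of G] by (auto simp: vec_kernel_def straight_part_def)
qed

lemma card_straight_part: "card (straight_part (lagrangian G)) = 2 ^ graph_corank G"
proof -
  have "bij_betw (graph_vec G) (vec_kernel (shifted_matrix G)) (straight_part (lagrangian G))"
  proof (rule bij_betw_imageI)
    show "inj_on (graph_vec G) (vec_kernel (shifted_matrix G))"
      unfolding vec_kernel_shifted by (rule inj_onI) (auto dest: graph_vec_inj)
    show "graph_vec G ` vec_kernel (shifted_matrix G) = straight_part (lagrangian G)"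
    proof (intro Set.set_eqI iffI)
      fix z assume z: "z \<in> straight_part (lagrangian G)"
      then have "z \<in> lagrangian G" by (simp add: straight_part_def)
      then obtain x where "x \<in> carrier_vec (num_vertices G)" "z = graph_vec G x" by (rule graph_vec_cases)
      with z show "z \<in> graph_vec G ` vec_kernel (shifted_matrix G)" by (auto simp: vec_kernel_shifted)
    qed (auto simp: vec_kernel_shifted)
  qed
  then have "card (straight_part (lagrangian G)) = card (vec_kernel (shifted_matrix G))" by (metis bij_betw_same_card)
  then show ?thesis using card_vec_kernel[OF shifted_carrier[of G]] by (simp add: graph_corank_def)
qed

lemma straight_part_0: "0 \<in> straight_part (lagrangian G)"
  by (simp add: straight_part_def straight_def)

lemma straight_part_corank0: "graph_corank G = 0 \<Longrightarrow> straight_part (lagrangian G) = {0}"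
  using card_straight_part[of G] straight_part_0[of G] by (auto simp: card_1_singleton_iff)

lemma straight_part_corank1:
  assumes "graph_corank G = 1"
  obtains \<kappa> where "straight_part (lagrangian G) = {0, \<kappa>}" "\<kappa> \<noteq> 0"
proof -
  have "card (straight_part (lagrangian G)) = 2" using card_straight_part[of G] assms by simp
  then obtain a b where "straight_part (lagrangian G) = {a, b}" "a \<noteq> b" by (auto simp: card_2_iff)
  then show thesis using that straight_part_0[of G] by (metis doubleton_eq_iff insert_iff singletonD)
qed

lemma sum_bit_eq_0_iff:
  fixes f :: "'a \<Rightarrow> bit"
  assumes "finite K"
  shows "(\<Sum>k\<in>K. f k) = 0 \<longleftrightarrow> even (card {k \<in> K. f k = 1})"
  using assms
proof (induction K rule: finite_induct)
  case (insert a K)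
  have e: "{k \<in> insert a K. f k = 1} = (if f a = 1 then insert a {k \<in> K. f k = 1} else {k \<in> K. f k = 1})" by auto
  show ?case
  proof (cases "f a = 1")
    case True
    then have "(\<Sum>k\<in>insert a K. f k) = 0 \<longleftrightarrow> (\<Sum>k\<in>K. f k) \<noteq> 0" using insert by (cases "\<Sum>k\<in>K. f k") simp_all
    then show ?thesis unfolding e using True insert by simp
  next
    case False
    then show ?thesis unfolding e using insert by simp
  qed
qed simp

text \<open>
  The first coordinates are a row of the inverse of \<open>A + E\<close>, whose product with
  \<open>A + E\<close> is a unit vector. So the two coordinates differ at the vertex with number
  \<open>i\<close> only.
\<close>

lemma inverse_matrix_row:
  assumes "graph_corank G = 0" and i: "i < num_vertices G"
  obtains x where "x \<in> carrier_vec (num_vertices G)" "\<And>k. k < num_vertices G \<Longrightarrow> x $ k = the (mat_inverse (shifted_matrix G)) $$ (i, k)"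
    "straight_off (vertex_at G i) (graph_vec G x)" "fst (graph_vec G x (vertex_at G i)) \<noteq> snd (graph_vec G x (vertex_at G i))"
proof -
  let ?n = "num_vertices G" and ?A = "shifted_matrix G"
  have A: "?A \<in> carrier_mat ?n ?n" by (rule shifted_carrier)
  have "det ?A \<noteq> 0"
  proof
    assume "det ?A = 0"
    then obtain v where v: "v \<in> carrier_vec ?n" "v \<noteq> 0\<^sub>v ?n" "?A *\<^sub>v v = 0\<^sub>v ?n"
      using det_0_iff_vec_prod_zero_field[OF A] by blast
    have "card (vec_kernel ?A) = 1" using card_vec_kernel[OF A] assms(1) by (simp add: graph_corank_def)
    moreover have "v \<in> vec_kernel ?A" "0\<^sub>v ?n \<in> vec_kernel ?A" using v A by (auto simp: vec_kernel_def)
    ultimately show False using v(2) by (metis card_1_singletonE singletonD)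
  qed
  then have "?A \<in> Units (ring_mat TYPE(bit) ?n ())" by (rule det_non_zero_imp_unit[OF A])
  then obtain M where M: "mat_inverse ?A = Some M" using mat_inverse(1)[OF A, of "()"] by (cases "mat_inverse ?A") auto
  from mat_inverse(2)[OF A M] have MA: "M * ?A = 1\<^sub>m ?n" and Mc: "M \<in> carrier_mat ?n ?n" by auto
  define x where "x = vec ?n (\<lambda>k. M $$ (i, k))"
  have x: "x \<in> carrier_vec ?n" by (simp add: x_def)
  have sym: "?A $$ (k, j) = ?A $$ (j, k)" if "k < ?n" "j < ?n" for k j
    using that by (simp add: shifted_index entry_sym[of G "vertex_at G k"])
  have Ax: "(?A *\<^sub>v x) $ j = of_bool (i = j)" if j: "j < ?n" for j
  proof -
    have "(?A *\<^sub>v x) $ j = (\<Sum>k<?n. ?A $$ (j, k) * M $$ (i, k))"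
      using j A by (simp add: scalar_prod_def atLeast0LessThan x_def)
    also have "\<dots> = (\<Sum>k<?n. M $$ (i, k) * ?A $$ (k, j))"
      using j sym by (intro sum.cong) (auto simp: mult.commute)
    also have "\<dots> = (M * ?A) $$ (i, j)" using i j A Mc by (simp add: scalar_prod_def atLeast0LessThan)
    also have "\<dots> = of_bool (i = j)" unfolding MA using i j by simp
    finally show ?thesis .
  qed
  have l: "snd (graph_vec G x (vertex_at G j)) + fst (graph_vec G x (vertex_at G j)) = of_bool (i = j)" if "j < ?n" for j
    using shifted_mult[OF that x] Ax[OF that] by simp
  show thesis
  proof (rule that[OF x])
    show "x $ k = the (mat_inverse ?A) $$ (i, k)" if "k < ?n" for k using that by (simp add: x_def M)
    show "fst (graph_vec G x (vertex_at G i)) \<noteq> snd (graph_vec G x (vertex_at G i))" using l[OF i] by auto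
    show "straight_off (vertex_at G i) (graph_vec G x)" unfolding straight_off_def
    proof (intro allI impI)
      fix j assume j: "j \<noteq> vertex_at G i"
      show "fst (graph_vec G x j) = snd (graph_vec G x j)"
      proof (cases "j \<in> vertices G")
        case True
        have "i \<noteq> position_of G j" using j vertex_at_position_of(1)[OF True] by auto
        then show ?thesis using l[OF vertex_at_position_of(2)[OF True]] vertex_at_position_of(1)[OF True] by simp
      next
        case False
        have "graph_vec G x j = 0" by (rule graph_vec_outside[OF False])
        then show ?thesis by (simp only: fst_zero snd_zero)
      qed
    qed
  qed
qed

lemma knotlike_lagrangian:
  assumes "graph_corank G = 0"
  shows "knotlike (vertices G) (lagrangian G)"
  unfolding knotlike_def
proof
  show "\<forall>z\<in>lagrangian G. straight z \<longrightarrow> z = 0" using straight_part_corank0[OF assms] by (auto simp: straight_part_def)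
  show "\<forall>t\<in>vertices G. \<exists>m\<in>lagrangian G. straight_off t m \<and> fst (m t) \<noteq> snd (m t)"
    unfolding all_vertices
  proof (intro allI impI)
    fix i assume i: "i < num_vertices G"
    obtain x where "straight_off (vertex_at G i) (graph_vec G x)" "fst (graph_vec G x (vertex_at G i)) \<noteq> snd (graph_vec G x (vertex_at G i))"
      by (rule inverse_matrix_row[OF assms i]) blast
    then show "\<exists>m\<in>lagrangian G. straight_off (vertex_at G i) m \<and> fst (m (vertex_at G i)) \<noteq> snd (m (vertex_at G i))"
      using graph_vec_in_lagrangian by blast
  qed
qed

lemma even_vertices_even_set:
  assumes "free_corank \<G> = 0"
  shows "even_vertices_knot \<G> = even_set True (vertices (some_rep \<G>)) (lagrangian (some_rep \<G>))"
proof -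
  define G where "G = some_rep \<G>"
  let ?n = "num_vertices G"
  have c: "graph_corank G = 0" using assms by (simp add: free_corank_def G_def)
  have key: "vertex_at G i \<in> even_knot (vertices G) (lagrangian G) \<longleftrightarrow> even (card {j. L_adj G i j})" if i: "i < ?n" for i
  proof -
    obtain x where x: "x \<in> carrier_vec ?n" "\<And>k. k < ?n \<Longrightarrow> x $ k = the (mat_inverse (shifted_matrix G)) $$ (i, k)"
      "straight_off (vertex_at G i) (graph_vec G x)" "fst (graph_vec G x (vertex_at G i)) \<noteq> snd (graph_vec G x (vertex_at G i))"
      by (rule inverse_matrix_row[OF c i]) blast
    have "vertex_at G i \<in> even_knot (vertices G) (lagrangian G) \<longleftrightarrow> (\<Sum>j\<in>vertices G - {vertex_at G i}. fst (graph_vec G x j)) = 0"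
      by (rule even_knot_iff[OF graphic_lagrangian knotlike_lagrangian[OF c] graph_vec_in_lagrangian x(3,4) position_of_vertex_at(2)[OF i]])
    also have "(\<Sum>j\<in>vertices G - {vertex_at G i}. fst (graph_vec G x j)) = (\<Sum>k\<in>{..<?n} - {i}. fst (graph_vec G x (vertex_at G k)))"
    proof -
      have "bij_betw (vertex_at G) ({..<?n} - {i}) (vertices G - {vertex_at G i})"
      proof (rule bij_betw_imageI)
        have vertex_at: "inj_on (vertex_at G) {..<?n}" "vertex_at G ` {..<?n} = vertices G" using bij_vertex_at by (auto simp: bij_betw_def)
        show "inj_on (vertex_at G) ({..<?n} - {i})" using vertex_at(1) by (rule inj_on_diff)
        show "vertex_at G ` ({..<?n} - {i}) = vertices G - {vertex_at G i}"
          using inj_on_image_set_diff[OF vertex_at(1), of "{..<?n}" "{i}"] i vertex_at(2) by auto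
      qed
      from sum.reindex_bij_betw[OF this, of "\<lambda>j. fst (graph_vec G x j)"] show ?thesis ..
    qed
    also have "\<dots> = (\<Sum>k\<in>{..<?n} - {i}. x $ k)"
      by (intro sum.cong) (auto simp: coordinate_def position_of_vertex_at)
    also have "\<dots> = 0 \<longleftrightarrow> even (card {k \<in> {..<?n} - {i}. x $ k = 1})" by (rule sum_bit_eq_0_iff) simp
    also have "{k \<in> {..<?n} - {i}. x $ k = 1} = {j. L_adj G i j}"
      using x(2) i by (auto simp: L_adj_def)
    finally show ?thesis .
  qed
  have "even_knot (vertices G) (lagrangian G) \<subseteq> vertices G" using even_set_subset[of True] by (simp add: even_set_def)
  then have "even_knot (vertices G) (lagrangian G) = {vertex_at G i | i. i < ?n \<and> vertex_at G i \<in> even_knot (vertices G) (lagrangian G)}"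
    using vertex_at_position_of[of _ G] by force
  also have "\<dots> = {vertex_list G ! i | i. i < ?n \<and> even (card {j. L_adj G i j})}"
    unfolding vertex_at_def[symmetric] using key by blast
  finally show ?thesis by (simp add: even_vertices_knot_def Let_def even_set_def G_def)
qed

text \<open>
  A nonzero kernel vector of \<open>B\<close> with index \<open>i\<close> has all values in
  \<open>{0, c}\<close> except possibly the value \<open>a\<close> at the vertex with number
  \<open>i\<close>. If \<open>\<kappa>\<close> has value \<open>c\<close> there, pairing with
  \<open>\<kappa>\<close> excludes the value \<open>a\<close>, and then the vector would be
  \<open>\<kappa>\<close>, whose value at this vertex is \<open>c\<close>.
\<close>

lemma oriented_vertices_even_set:
  assumes "free_corank \<H> = 1"
  shows "oriented_vertices \<H> = even_set False (vertices (some_rep \<H>)) (lagrangian (some_rep \<H>))"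
proof -
  define G where "G = some_rep \<H>"
  let ?n = "num_vertices G"
  have c: "graph_corank G = 1" using assms by (simp add: free_corank_def G_def)
  obtain \<kappa> where \<kappa>: "straight_part (lagrangian G) = {0, \<kappa>}" "\<kappa> \<noteq> 0" by (rule straight_part_corank1[OF c])
  have \<kappa>L: "\<kappa> \<in> lagrangian G" "straight \<kappa>" using \<kappa>(1) by (auto simp: straight_part_def)
  have ev: "t \<in> even_link (vertices G) (lagrangian G) \<longleftrightarrow> \<kappa> t = 0" if "t \<in> vertices G" for t
  proof -
    have "t \<in> even_link (vertices G) (lagrangian G) \<longleftrightarrow> (\<forall>z\<in>straight_part (lagrangian G). z t = 0)" using that by (auto simp: even_link_def straight_part_def)
    then show ?thesis by (simp add: \<kappa>)
  qed
  have key: "vertex_at G i \<in> even_link (vertices G) (lagrangian G) \<longleftrightarrow> graph_corank G \<le> corank (B_matrix G i)" if i: "i < ?n" for i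
  proof -
    let ?B = "B_matrix G i"
    have B: "?B \<in> carrier_mat ?n ?n" by (simp add: B_matrix_def adj_matrix_def unit_matrix_def)
    have inB: "x \<in> vec_kernel ?B \<longleftrightarrow> x \<in> carrier_vec ?n \<and> (\<forall>j<?n. snd (graph_vec G x (vertex_at G j)) + fst (graph_vec G x (vertex_at G j)) = (if j = i then x $ i else 0))" for x
    proof -
      have "x \<in> vec_kernel ?B \<longleftrightarrow> x \<in> carrier_vec ?n \<and> (\<forall>j<?n. (?B *\<^sub>v x) $ j = 0)"
        using B by (auto simp: vec_kernel_def vec_eq_iff)
      moreover have "(?B *\<^sub>v x) $ j = 0 \<longleftrightarrow> snd (graph_vec G x (vertex_at G j)) + fst (graph_vec G x (vertex_at G j)) = (if j = i then x $ i else 0)"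
        if "x \<in> carrier_vec ?n" "j < ?n" for j
        unfolding B_mult[OF i that(2,1)] shifted_mult[OF that(2,1)] by (rule bit_add_eq_0_iff)
      ultimately show ?thesis by blast
    qed
    have "0\<^sub>v ?n \<in> vec_kernel ?B" using B by (auto simp: vec_kernel_def)
    have "graph_corank G \<le> corank ?B \<longleftrightarrow> card (vec_kernel ?B) \<noteq> 1"
      unfolding c card_vec_kernel[OF B] by (cases "corank ?B") simp_all
    also have "\<dots> \<longleftrightarrow> (\<exists>x\<in>vec_kernel ?B. x \<noteq> 0\<^sub>v ?n)"
      using \<open>0\<^sub>v ?n \<in> vec_kernel ?B\<close> by (auto simp: card_1_singleton_iff)
    also have "\<dots> \<longleftrightarrow> \<kappa> (vertex_at G i) = 0"
    proof
      assume k0: "\<kappa> (vertex_at G i) = 0"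
      obtain x where x: "x \<in> carrier_vec ?n" "\<kappa> = graph_vec G x" by (rule graph_vec_cases[OF \<kappa>L(1)])
      have "fst (graph_vec G x (vertex_at G i)) = 0" using k0 unfolding x(2) by (simp only: fst_zero)
      then have "x $ i = 0" using i by (simp add: coordinate_def position_of_vertex_at)
      moreover have "snd (graph_vec G x j) = fst (graph_vec G x j)" for j using \<kappa>L(2) by (simp only: x(2) straight_def)
      ultimately have "x \<in> vec_kernel ?B" unfolding inB using x(1) by simp
      moreover have "x \<noteq> 0\<^sub>v ?n"
      proof
        assume "x = 0\<^sub>v ?n"
        then have "fst (\<kappa> j) = 0" for j unfolding x(2) by (simp add: coordinate_def vertex_at_position_of)
        with \<kappa>L(1) have "\<kappa> = 0" by (rule lagrangian_fst_0)
        with \<kappa>(2) show False ..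
      qed
      ultimately show "\<exists>x\<in>vec_kernel ?B. x \<noteq> 0\<^sub>v ?n" by blast
    next
      assume "\<exists>x\<in>vec_kernel ?B. x \<noteq> 0\<^sub>v ?n"
      then obtain x where x: "x \<in> vec_kernel ?B" "x \<noteq> 0\<^sub>v ?n" by blast
      have xC: "x \<in> carrier_vec ?n" using x(1) inB by blast
      define z where "z = graph_vec G x"
      have z0: "z \<noteq> 0"
      proof
        assume "z = 0"
        then have "graph_vec G x = graph_vec G (0\<^sub>v ?n)"
          unfolding z_def by (intro lagrangian_eqI[OF graph_vec_in_lagrangian graph_vec_in_lagrangian]) (simp add: coordinate_def vertex_at_position_of prod_eq_iff fun_eq_iff)
        with graph_vec_inj[OF xC] x(2) show False by simp
      qed
      have zj: "snd (z (vertex_at G j)) + fst (z (vertex_at G j)) = (if j = i then x $ i else 0)" if "j < ?n" for j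
        using x(1) that unfolding inB z_def by blast
      have zi: "fst (z (vertex_at G i)) = x $ i" using i by (simp add: z_def coordinate_def position_of_vertex_at)
      have z_off: "fst (z t) = snd (z t)" if "t \<in> vertices G" "t \<noteq> vertex_at G i" for t
      proof -
        have "position_of G t \<noteq> i" using that(2) vertex_at_position_of(1)[OF that(1)] by auto
        then show ?thesis using zj[OF vertex_at_position_of(2)[OF that(1)]] vertex_at_position_of(1)[OF that(1)] by simp
      qed
      have \<kappa>c: "fst (\<kappa> t) = snd (\<kappa> t)" for t using \<kappa>L(2) by (simp add: straight_def)
      show "\<kappa> (vertex_at G i) = 0"
      proof (rule ccontr)
        assume k1: "\<kappa> (vertex_at G i) \<noteq> 0"
        then have k1: "\<kappa> (vertex_at G i) = (1, 1)" using diag_cases[OF \<kappa>c] by blast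
        \<comment> \<open>The pairing of \<open>z\<close> and \<open>\<kappa>\<close> is concentrated at the vertex with number \<open>i\<close>.\<close>
        have "(\<Sum>t\<in>vertices G. fst (z t) * snd (\<kappa> t) + snd (z t) * fst (\<kappa> t)) =
          (\<Sum>t\<in>vertices G. if t = vertex_at G i then x $ i else 0)"
        proof (rule sum.cong[OF refl])
          fix t assume t: "t \<in> vertices G"
          show "fst (z t) * snd (\<kappa> t) + snd (z t) * fst (\<kappa> t) = (if t = vertex_at G i then x $ i else 0)"
          proof (cases "t = vertex_at G i")
            case True
            then show ?thesis using zj[OF i] k1 by (simp add: add.commute)
          next
            case False
            then show ?thesis using z_off[OF t False] \<kappa>c[of t] by simp
          qed
        qed
        also have "\<dots> = x $ i" using position_of_vertex_at(2)[OF i] by simp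
        finally have xi: "x $ i = 0"
          using graphic_isotropic[OF graphic_lagrangian, of z G \<kappa>] graph_vec_in_lagrangian[of G x] \<kappa>L(1) by (simp add: z_def)
        have "fst (z t) = snd (z t)" for t
        proof (cases "t \<in> vertices G")
          case True
          then show ?thesis using z_off[OF True] zj[OF i] xi by (cases "t = vertex_at G i") auto
        next
          case False
          then have "z t = 0" unfolding z_def by (rule graph_vec_outside)
          then show ?thesis by simp
        qed
        then have "z \<in> straight_part (lagrangian G)" using graph_vec_in_lagrangian by (simp add: straight_part_def straight_def z_def)
        then have "z = \<kappa>" using z0 \<kappa>(1) by blast
        then show False using k1 zi xi by simp
      qed
    qed
    finally show ?thesis using ev[OF position_of_vertex_at(2)[OF i]] by simp
  qed
  have "even_link (vertices G) (lagrangian G) \<subseteq> vertices G" using even_set_subset[of False] by (simp add: even_set_def)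
  then have "even_link (vertices G) (lagrangian G) = {vertex_at G i | i. i < ?n \<and> vertex_at G i \<in> even_link (vertices G) (lagrangian G)}"
    using vertex_at_position_of[of _ G] by force
  also have "\<dots> = {vertex_list G ! i | i. i < ?n \<and> graph_corank G \<le> corank (B_matrix G i)}"
    unfolding vertex_at_def[symmetric] using key by blast
  finally show ?thesis by (simp add: oriented_vertices_def Let_def even_set_def G_def)
qed


section \<open>Invariance of the brackets\<close>

lemma graph_corank_eq:
  assumes "card (straight_part (lagrangian G)) = card (straight_part (lagrangian H))"
  shows "graph_corank G = graph_corank H"
  using assms by (simp add: card_straight_part)

lemma corank_free_equiv: "free_equiv G H \<Longrightarrow> graph_corank G = graph_corank H"
  by (rule graph_corank_eq) (auto simp: free_equiv_iff_lagrangian straight_part_flip)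

lemma corank_iso:
  assumes "graph_iso G H"
  shows "graph_corank G = graph_corank H"
proof (rule graph_corank_eq)
  obtain \<pi> where \<pi>: "bij \<pi>" "G = relabel_graph \<pi> H" by (rule graph_iso_obtain[OF assms])
  show "card (straight_part (lagrangian G)) = card (straight_part (lagrangian H))"
    unfolding \<pi>(2) lagrangian_relabel_graph[OF \<pi>(1)] by (rule card_straight_part_relabel[OF \<pi>(1)])
qed

text \<open>
  The bracket of the free framed graph of \<open>G\<close>, in canonical form and before
  restricting to a corank.
\<close>

definition bracket_sum :: "bool \<Rightarrow> framed_graph \<Rightarrow> chain" where
  "bracket_sum knot G = state_sum (lagrangian G) (even_set knot (vertices G) (lagrangian G))"

lemma bracket_sum_free_equiv:
  assumes "free_equiv G H"
  shows "bracket_sum knot G = bracket_sum knot H"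
proof -
  obtain F where F: "vertices H = vertices G" "lagrangian H = flip F ` lagrangian G" using assms unfolding free_equiv_iff_lagrangian by blast
  have "finite (even_set knot (vertices G) (lagrangian G))" by (rule finite_subset[OF even_set_subset finite_vertices])
  then show ?thesis unfolding bracket_sum_def F even_set_flip by (rule state_sum_flip[symmetric])
qed

lemma bracket_sum_iso:
  assumes "graph_iso G H"
  shows "bracket_sum knot G = bracket_sum knot H"
proof -
  obtain \<pi> where \<pi>: "bij \<pi>" "G = relabel_graph \<pi> H" by (rule graph_iso_obtain[OF assms])
  have "finite (even_set knot (vertices H) (lagrangian H))" by (rule finite_subset[OF even_set_subset finite_vertices])
  then show ?thesis
    unfolding bracket_sum_def \<pi>(2) relabel_graph(1)[OF \<pi>(1)] lagrangian_relabel_graph[OF \<pi>(1)] even_set_relabel[OF \<pi>(1)]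
    using state_sum_relabel[OF \<pi>(1) graphic_lagrangian even_set_subset] by blast
qed

text \<open>
  An equivalence relation on framed graphs, so that invariance can be proved one move at a time.
\<close>

definition same_brackets :: "framed_graph \<Rightarrow> framed_graph \<Rightarrow> bool" where
  "same_brackets G H \<longleftrightarrow> graph_corank G = graph_corank H \<and>
     (graph_corank G = 0 \<longrightarrow> bracket_sum True G = bracket_sum True H) \<and>
     (graph_corank G = 1 \<longrightarrow> bracket_sum False G = bracket_sum False H)"

lemma same_brackets_sym: "same_brackets G H \<Longrightarrow> same_brackets H G"
  and same_brackets_trans: "same_brackets G H \<Longrightarrow> same_brackets H K \<Longrightarrow> same_brackets G K"
  by (auto simp: same_brackets_def)

lemma same_brackets_free_equiv: "free_equiv G H \<Longrightarrow> same_brackets G H"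
  using corank_free_equiv bracket_sum_free_equiv by (auto simp: same_brackets_def)

lemma same_brackets_iso: "graph_iso G H \<Longrightarrow> same_brackets G H"
  using corank_iso bracket_sum_iso by (auto simp: same_brackets_def)

lemma same_brackets_omega:
  assumes "omega1 G H \<or> omega2 G H \<or> omega3 G H"
  shows "same_brackets G H"
  using assms
proof (elim disjE)
  assume o: "omega1 G H"
  then show ?thesis using state_sum_omega1[OF o] graph_corank_eq[of G H] by (auto simp: same_brackets_def bracket_sum_def)
next
  assume o: "omega2 G H"
  then show ?thesis using state_sum_omega2[OF o] graph_corank_eq[of G H] by (auto simp: same_brackets_def bracket_sum_def)
next
  assume o: "omega3 G H"
  have "bracket_sum True G = bracket_sum True H" if "graph_corank G = 0"
    unfolding bracket_sum_def by (rule state_sum_omega3[OF o]) (use knotlike_lagrangian[OF that] in auto)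
  moreover have "bracket_sum False G = bracket_sum False H" if "graph_corank G = 1"
    unfolding bracket_sum_def by (rule state_sum_omega3[OF o]) (use straight_part_corank1[OF that] in auto)
  ultimately show ?thesis using graph_corank_eq[OF card_straight_part_omega3[OF o]] by (auto simp: same_brackets_def)
qed

lemma same_brackets_free_class:
  assumes "free_class G = free_class H"
  shows "same_brackets G H"
proof -
  let ?r = "\<lambda>\<G> \<H>. \<exists>G\<in>representatives \<G>. \<exists>H\<in>representatives \<H>. graph_iso G H"
  have rep: "G \<in> representatives \<G> \<Longrightarrow> H \<in> representatives \<G> \<Longrightarrow> same_brackets G H" for G H \<G>
    by (rule same_brackets_free_equiv) (simp add: representatives_def free_graph_of_eq_iff[symmetric])
  have one: "same_brackets G H" if r: "?r \<G> \<H>" and G: "G \<in> representatives \<G>" and H: "H \<in> representatives \<H>" for G H \<G> \<H>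
  proof -
    obtain G' H' where GH: "G' \<in> representatives \<G>" "H' \<in> representatives \<H>" "graph_iso G' H'" using r by blast
    from same_brackets_trans[OF same_brackets_trans[OF rep[OF G GH(1)] same_brackets_iso[OF GH(3)]] rep[OF GH(2) H]]
    show ?thesis .
  qed
  have "equivclp ?r (free_graph_of G) (free_graph_of H)"
    using assms unfolding free_class_def iso_class_def free_graph.abs_eq_iff .
  then have "\<forall>H\<in>representatives (free_graph_of H). same_brackets G H"
  proof (induction rule: equivclp_induct)
    case base
    then show ?case using rep[of G "free_graph_of G"] by (simp add: representatives_def)
  next
    case (step \<G> \<H>)
    show ?case
    proof
      fix H assume H: "H \<in> representatives \<H>"
      obtain K where K: "K \<in> representatives \<G>" using representatives_nonempty by blast
      have "same_brackets K H" using step(2)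
      proof
        assume "?r \<G> \<H>"
        then show ?thesis by (rule one[OF _ K H])
      next
        assume "?r \<H> \<G>"
        then show ?thesis by (rule same_brackets_sym[OF one[OF _ H K]])
      qed
      moreover have "same_brackets G K" using step(3) K by blast
      ultimately show "same_brackets G H" by (rule same_brackets_trans[rotated])
    qed
  qed
  then show ?thesis by (simp add: representatives_def)
qed

lemma free_class_corank: "free_class G = free_class H \<Longrightarrow> graph_corank G = graph_corank H"
  by (drule same_brackets_free_class) (simp add: same_brackets_def)

lemma free_class_ex: "\<exists>G. free_class G = x"
proof -
  obtain \<G> where "x = abs_free_graph \<G>"
    by (rule that[of "rep_free_graph x"]) (rule Quotient3_abs_rep[OF Quotient3_free_graph, symmetric])
  then have "free_class (some_rep \<G>) = x" unfolding free_class_def iso_class_def free_graph_of_some_rep by (rule sym)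
  then show ?thesis by (rule exI)
qed

lemma same_brackets_link:
  assumes "equivclp link_move x y" "free_class G = x" "free_class H = y"
  shows "same_brackets G H"
proof -
  have "\<forall>H. free_class H = y \<longrightarrow> same_brackets G H"
    using assms(1)
  proof (induction rule: equivclp_induct)
    case base
    show ?case using same_brackets_free_class assms(2) by auto
  next
    case (step y z)
    have *: "same_brackets A B" if l: "link_move p q" and A: "free_class A = p" and B: "free_class B = q" for p q A B
    proof -
      obtain A' B' where "free_class A' = p" "free_class B' = q" "omega1 A' B' \<or> omega2 A' B' \<or> omega3 A' B'"
        using l unfolding link_move_def by blast
      note AB = this
      have "same_brackets A' B'" "free_class A = free_class A'" "free_class B' = free_class B"
        using same_brackets_omega[OF AB(3)] AB(1,2) A B by simp_all
      from same_brackets_trans[OF same_brackets_trans[OF same_brackets_free_class[OF this(2)] this(1)] same_brackets_free_class[OF this(3)]]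
      show ?thesis .
    qed
    obtain K where K: "free_class K = y" using free_class_ex by blast
    show ?case
    proof (intro allI impI)
      fix H assume H: "free_class H = z"
      have "same_brackets K H" using step(2)
      proof
        assume "link_move y z"
        then show ?thesis by (rule *[OF _ K H])
      next
        assume "link_move z y"
        then show ?thesis by (rule same_brackets_sym[OF *[OF _ H K]])
      qed
      moreover have "same_brackets G K" using step(3) K by blast
      ultimately show "same_brackets G H" by (rule same_brackets_trans[rotated])
    qed
  qed
  with assms(3) show ?thesis by blast
qed


section \<open>The quotient spaces\<close>

lemma generators_iff: "free_class G \<in> generators i \<longleftrightarrow> graph_corank G + 1 = i"
proof
  assume "free_class G \<in> generators i"
  then obtain H where "free_class H = free_class G" "graph_corank H + 1 = i" by (auto simp: generators_def)
  then show "graph_corank G + 1 = i" using free_class_corank[of H G] by simp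
qed (auto simp: generators_def)

lemma generators_unique:
  assumes "x \<in> generators i" "x \<in> generators j"
  shows "i = j"
proof -
  obtain G where "free_class G = x" using free_class_ex by blast
  with assms show ?thesis using generators_iff[of G i] generators_iff[of G j] by simp
qed

lemma omega2_related_generators:
  assumes "omega2_related x y"
  shows "x \<in> generators i \<longleftrightarrow> y \<in> generators i"
proof -
  obtain G H where G: "free_class G = x" "free_class H = y" "omega2 G H" using assms unfolding omega2_related_def by blast
  have "graph_corank G = graph_corank H" using same_brackets_omega[of G H] G(3) by (simp add: same_brackets_def)
  then show ?thesis unfolding G(1,2)[symmetric] generators_iff by simp
qed

lemma span_sum_in: "(\<And>a. a \<in># A \<Longrightarrow> f a \<in> chain.span S) \<Longrightarrow> (\<Sum>a\<in>#A. f a) \<in> chain.span S"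
  by (induction A) (auto intro: chain.span_zero chain.span_add)

lemma equivclp_omega2_span:
  assumes "equivclp omega2_related x y" "x \<in> generators i"
  shows "y \<in> generators i \<and> gen x - gen y \<in> chain.span (relations i)"
  using assms(1)
proof (induction rule: equivclp_induct)
  case base
  then show ?case using assms(2) by (simp add: chain.span_zero)
next
  case (step y z)
  have "gen y - gen z \<in> chain.span (relations i) \<and> z \<in> generators i"
    using step(2)
  proof
    assume o: "omega2_related y z"
    then have z: "z \<in> generators i" using step(3) omega2_related_generators by blast
    then have "gen y - gen z \<in> relations i" using o step(3) unfolding relations_def by blast
    with z show ?thesis by (blast intro: chain.span_base)
  next
    assume o: "omega2_related z y"
    then have z: "z \<in> generators i" using step(3) omega2_related_generators by blast
    then have "gen z - gen y \<in> relations i" using o step(3) unfolding relations_def by blast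
    then have "- (gen z - gen y) \<in> chain.span (relations i)" by (blast intro: chain.span_base chain.span_neg)
    with z show ?thesis by simp
  qed
  then show ?case using step(3) chain.span_add[of "gen x - gen y" "relations i" "gen y - gen z"] by simp
qed

text \<open>
  The two rows of an isolated edge add up to a nonzero straight vector.
\<close>

lemma vanishing_corank:
  assumes "vanishing x" "x \<in> generators i"
  shows "i > 1"
proof -
  obtain y where y: "equivclp omega2_related x y" "has_isolated_edge y" using assms(1) by (auto simp: vanishing_def)
  have yi: "y \<in> generators i" using equivclp_omega2_span[OF y(1) assms(2)] by simp
  obtain G u v where G: "free_class G = y" "framing G u = 0" "framing G v = 0" "nbhd G u = {v}" "nbhd G v = {u}"
    using y(2) unfolding has_isolated_edge_def by blast
  have adj: "adj G u j \<longleftrightarrow> j = v" "adj G v j \<longleftrightarrow> j = u" for j using G(4,5) by (auto simp: nbhd_def)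
  have uv: "u \<in> vertices G" "v \<in> vertices G" "u \<noteq> v" using adjD[of G u v] adj by auto
  have am: "entry G j u = of_bool (j = v)" "entry G j v = of_bool (j = u)" for j
    unfolding entry_sym[of G j] using G(2,3) adj uv by (auto simp: entry_def)
  have "straight (vertex_row G u + vertex_row G v)" using uv(3) by (auto simp: straight_def vertex_row_def am)
  moreover have "vertex_row G u + vertex_row G v \<in> lagrangian G" using uv by (blast intro: lagrangian_add vertex_row_in_lagrangian)
  moreover have "vertex_row G u + vertex_row G v \<noteq> 0"
  proof
    assume "vertex_row G u + vertex_row G v = 0"
    then have "(vertex_row G u + vertex_row G v) u = 0" by simp
    then show False using uv(3) by (simp add: vertex_row_def prod_eq_iff)
  qed
  ultimately have "straight_part (lagrangian G) \<noteq> {0}" by (auto simp: straight_part_def)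
  then have "graph_corank G \<noteq> 0" using straight_part_corank0 by blast
  moreover have "graph_corank G + 1 = i" using yi G(1) generators_iff by blast
  ultimately show ?thesis by simp
qed

lemma canonical_generator:
  assumes "x \<in> generators i" "\<not> vanishing x"
  shows "\<exists>y\<in>generators i. canonical x = gen y \<and> gen x - gen y \<in> chain.span (relations i)"
proof -
  have "equivclp omega2_related x (SOME y. equivclp omega2_related x y)"
    by (rule someI[of _ x]) simp
  from equivclp_omega2_span[OF this assms(1)] show ?thesis using assms(2) by (auto simp: canonical_def)
qed

lemma lookup_component: "poly_mapping.lookup (component i x) k = (if k \<in> generators i then poly_mapping.lookup x k else 0)"
  by (simp add: component_def lookup_mapp when_def in_keys_iff)

lemma component_add: "component i (x + y) = component i x + component i y"
  by (rule poly_mapping_eqI) (simp add: lookup_component lookup_add)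

lemma component_zero [simp]: "component i 0 = 0"
  by (rule poly_mapping_eqI) (simp add: lookup_component)

lemma component_gen: "component i (gen x) = (if x \<in> generators i then gen x else 0)"
  by (rule poly_mapping_eqI) (simp add: lookup_component gen_def lookup_single when_def)

lemma component_sum: "component i (\<Sum>a\<in>#A. f a) = (\<Sum>a\<in>#A. component i (f a))"
  by (induction A) (simp_all add: component_add)

lemma sum_mset_diff: "(\<Sum>a\<in>#A. f a) - (\<Sum>a\<in>#A. g a) = (\<Sum>a\<in>#A. f a - g a :: chain)"
  by (induction A) (simp_all add: algebra_simps)

lemma generators_ex: "\<exists>j\<ge>1. x \<in> generators j"
proof -
  obtain G where "free_class G = x" using free_class_ex by blast
  then show ?thesis using generators_iff[of G "graph_corank G + 1"] by auto
qed

text \<open>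
  The second move does not change the corank, so passing to the canonical form respects the
  grading.
\<close>

lemma component_canonical:
  assumes "\<not> vanishing x"
  shows "component i (gen x) - component i (canonical x) \<in> chain.span (relations i)"
proof -
  obtain j where j: "x \<in> generators j" using generators_ex by blast
  obtain y where y: "y \<in> generators j" "canonical x = gen y" "gen x - gen y \<in> chain.span (relations j)"
    using canonical_generator[OF j assms] by blast
  show ?thesis
  proof (cases "i = j")
    case True
    then show ?thesis using j y by (simp add: component_gen)
  next
    case False
    then have "x \<notin> generators i" "y \<notin> generators i" using generators_unique j y(1) by blast+
    then show ?thesis using y by (simp add: component_gen chain.span_zero)
  qed
qed

lemma space_class_eqI:
  assumes "x - y \<in> chain.span (relations i)"
  shows "space_class i x = space_class i y"
proof -
  have "y - x \<in> chain.span (relations i)" using chain.span_neg[OF assms] by simp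
  have sub: "space_class i a \<subseteq> space_class i b" if d: "a - b \<in> chain.span (relations i)" for a b
  proof
    fix c assume "c \<in> space_class i a"
    then obtain r where r: "r \<in> chain.span (relations i)" "c = a + r" by (auto simp: space_class_def)
    have "c = b + ((a - b) + r)" using r(2) by simp
    then show "c \<in> space_class i b" unfolding space_class_def using chain.span_add[OF d r(1)] by blast
  qed
  show ?thesis using sub[OF assms] sub[OF \<open>y - x \<in> _\<close>] by blast
qed

lemma smoothings_canonical:
  assumes "S \<subseteq> vertices (some_rep \<G>)"
  shows "(\<Sum>s\<in>#smoothings S \<G>. canonical (iso_class s)) = state_sum (lagrangian (some_rep \<G>)) S"
proof -
  have f: "finite S" using assms finite_subset[OF _ finite_vertices] by blast
  have "smoothing_sum (sorted_list_of_set S) (free_graph_of (some_rep \<G>)) = state_sum (lagrangian (some_rep \<G>)) (set (sorted_list_of_set S))"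
    by (rule smoothings_state_sum) (use f assms in auto)
  then show ?thesis using f by (simp add: smoothing_sum_def smoothings_def)
qed

lemma iso_class_generators: "iso_class s \<in> generators i \<longleftrightarrow> free_corank s + 1 = i"
  using generators_iff[of "some_rep s" i] by (simp add: free_class_def free_corank_def)

lemma square_bracket_class:
  assumes "free_corank \<G> = 0"
  shows "space_class 1 (square_bracket \<G>) = space_class 1 (component 1 (bracket_sum True (some_rep \<G>)))"
proof (rule space_class_eqI)
  let ?M = "smoothings (even_vertices_knot \<G>) \<G>"
  have ev: "even_vertices_knot \<G> = even_set True (vertices (some_rep \<G>)) (lagrangian (some_rep \<G>))"
    by (rule even_vertices_even_set[OF assms])
  have "bracket_sum True (some_rep \<G>) = (\<Sum>s\<in>#?M. canonical (iso_class s))"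
    unfolding bracket_sum_def ev by (rule smoothings_canonical[symmetric, OF even_set_subset])
  then have c: "component 1 (bracket_sum True (some_rep \<G>)) = (\<Sum>s\<in>#?M. component 1 (canonical (iso_class s)))"
    by (simp add: component_sum)
  have filt: "(\<Sum>s\<in>#{#s \<in># A. free_corank s = 0#}. gen (iso_class s)) = (\<Sum>s\<in>#A. component 1 (gen (iso_class s)))" for A
    by (induction A) (simp_all add: component_gen iso_class_generators)
  have "component 1 (gen x) - component 1 (canonical x) \<in> chain.span (relations 1)" for x
  proof (cases "vanishing x")
    case True
    then have "x \<notin> generators 1" using vanishing_corank by blast
    then show ?thesis using True by (simp add: component_gen canonical_def chain.span_zero)
  qed (rule component_canonical)
  then show "square_bracket \<G> - component 1 (bracket_sum True (some_rep \<G>)) \<in> chain.span (relations 1)"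
    unfolding square_bracket_def filt c sum_mset_diff by (intro span_sum_in)
qed

lemma curly_bracket_class:
  assumes "free_corank \<H> = 1"
  shows "direct_sum_class (curly_bracket \<H>) = direct_sum_class (bracket_sum False (some_rep \<H>))"
proof -
  let ?M = "smoothings (oriented_vertices \<H>) \<H>"
  have ev: "oriented_vertices \<H> = even_set False (vertices (some_rep \<H>)) (lagrangian (some_rep \<H>))"
    by (rule oriented_vertices_even_set[OF assms])
  have "bracket_sum False (some_rep \<H>) = (\<Sum>s\<in>#?M. canonical (iso_class s))"
    unfolding bracket_sum_def ev by (rule smoothings_canonical[symmetric, OF even_set_subset])
  also have "\<dots> = (\<Sum>s\<in>#{#s \<in># ?M. \<not> vanishing (iso_class s)#}. canonical (iso_class s))"
  proof -
    have "(\<Sum>s\<in>#A. canonical (iso_class s)) = (\<Sum>s\<in>#{#s \<in># A. \<not> vanishing (iso_class s)#}. canonical (iso_class s))" for A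
      by (induction A) (simp_all add: canonical_def)
    then show ?thesis .
  qed
  finally have i: "bracket_sum False (some_rep \<H>) = \<dots>" .
  have "space_class i (component i (curly_bracket \<H>)) = space_class i (component i (bracket_sum False (some_rep \<H>)))" for i
  proof (rule space_class_eqI)
    show "component i (curly_bracket \<H>) - component i (bracket_sum False (some_rep \<H>)) \<in> chain.span (relations i)"
      unfolding curly_bracket_def vanishing_def[symmetric] i component_sum sum_mset_diff
      by (intro span_sum_in component_canonical) simp
  qed
  then show ?thesis by (simp add: direct_sum_class_def)
qed

lemma same_brackets_some_rep:
  assumes "graph_link_of \<G> = graph_link_of \<G>'"
  shows "same_brackets (some_rep \<G>) (some_rep \<G>')"
proof (rule same_brackets_link)
  show "equivclp link_move (iso_class \<G>) (iso_class \<G>')"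
    using assms unfolding graph_link_of_def graph_link.abs_eq_iff .
qed (simp_all add: free_class_def)

theorem theorem3p3:
  shows "(\<forall>\<G> \<G>' :: labelled_free_graph.
            free_corank \<G> = 0 \<longrightarrow> free_corank \<G>' = 0 \<longrightarrow> graph_link_of \<G> = graph_link_of \<G>' \<longrightarrow>
            space_class 1 (square_bracket \<G>) = space_class 1 (square_bracket \<G>')) \<and>
         (\<forall>\<H> \<H>' :: labelled_free_graph.
            free_corank \<H> = 1 \<longrightarrow> free_corank \<H>' = 1 \<longrightarrow> graph_link_of \<H> = graph_link_of \<H>' \<longrightarrow>
            direct_sum_class (curly_bracket \<H>) = direct_sum_class (curly_bracket \<H>'))"
proof (intro conjI allI impI)
  fix \<G> \<G>' assume c: "free_corank \<G> = 0" "free_corank \<G>' = 0" and l: "graph_link_of \<G> = graph_link_of \<G>'"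
  have "bracket_sum True (some_rep \<G>) = bracket_sum True (some_rep \<G>')"
    using same_brackets_some_rep[OF l] c(1) by (simp add: same_brackets_def free_corank_def)
  then show "space_class 1 (square_bracket \<G>) = space_class 1 (square_bracket \<G>')"
    by (simp only: square_bracket_class[OF c(1)] square_bracket_class[OF c(2)])
next
  fix \<H> \<H>' assume c: "free_corank \<H> = 1" "free_corank \<H>' = 1" and l: "graph_link_of \<H> = graph_link_of \<H>'"
  have "bracket_sum False (some_rep \<H>) = bracket_sum False (some_rep \<H>')"
    using same_brackets_some_rep[OF l] c(1) by (simp add: same_brackets_def free_corank_def)
  then show "direct_sum_class (curly_bracket \<H>) = direct_sum_class (curly_bracket \<H>')"
    by (simp only: curly_bracket_class[OF c(1)] curly_bracket_class[OF c(2)])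
qed

end
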